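(* Let $n\ge 1$, $N=2n+1$, $m=2n$, and let $f:\mathbb{R}^N\times\mathbb{R}^m\to\mathbb{R}$ be measurable and satisfy: (a) there exist $C_1,C_2>0$ and $\alpha>1$ such that $C_1|q|^\alpha\le f(x,q)\le C_2(|q|^\alpha+1)$ for all $q\in\mathbb{R}^m$, $x\in\mathbb{R}^N$; (b) $f((2k)*x,q)=f(x,q)$ for all $x\in\mathbb{R}^N$, $q\in\mathbb{R}^m$, $k\in\mathbb{Z}^N$. Let $Q=[-1,1)^N$, $Q^k=\delta_k(Q)$ and $q\in\mathbb{R}^m$. Then $$\lim_{k\to+\infty}\frac{\mu_q(Q^k)}{|Q^k|}=C_q$$ (limit over $k\in\mathbb{N}$), where $C_q$ is the non-negative constant $$C_q=\inf_{k\in\mathbb{N},\,k\ge1}\frac{\mu_q(Q^k)}{|Q^k|}.$$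
   Context: The Heisenberg group $\mathbb{H}^n$ is $\mathbb{R}^N\equiv\mathbb{R}^n\times\mathbb{R}^n\times\mathbb{R}$ with group law $x*y=\big(\underline x_1+\underline y_1,\underline x_2+\underline y_2,x_3+y_3+\tfrac12(\underline x_1\cdot\underline y_2-\underline x_2\cdot\underline y_1)\big)$ and dilations $\delta_t(x)=(t\underline x_1,t\underline x_2,t^2x_3)$, $t>0$. Here $2k$ is the usual Euclidean multiple of $k$. The left-invariant vector fields are, for $i=1,\dots,n$, $X_i=\partial_{x_i}-\tfrac{x_{n+i}}2\partial_{x_{2n+1}}$ and $X_{n+i}=\partial_{x_{n+i}}+\tfrac{x_i}2\partial_{x_{2n+1}}$, and $\nabla_{\mathcal X}u=(X_1u,\dots,X_{2n}u)^T\in\mathbb{R}^m$ (in the distributional sense). $W^{1,\alpha}_{\mathcal X}(A)=\{u\in L^\alpha(A): X_iu\in L^\alpha(A),\ i=1,\dots,m\}$ with norm $\big(\int_A|u|^\alpha+\sum_i\int_A|X_iu|^\alpha\big)^{1/\alpha}$, and $W^{1,\alpha}_{\mathcal X,0}(A)$ is the closure of $C_0^\infty(A)$ in this norm. $\pi_m:\mathbb{R}^N\to\mathbb{R}^m$ is the projection on the first $m$ components and $l_q(x)=q\cdot\pi_m(x)$. For a bounded domain $A\subset\mathbb{R}^N$, $\mu_q(A)=\inf\big\{\int_A f(x,\nabla_{\mathcal X}u(x))\,dx: u\in W^{1,\alpha}_{\mathcal X}(A),\ u-l_q\in W^{1,\alpha}_{\mathcal X,0}(A)\big\}$; for $A=Q^k$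 the Sobolev spaces are those on the interior of $Q^k$. Measurability of $f$ is understood in the sense that $x\mapsto f(x,v(x))$ is Lebesgue measurable for every Lebesgue measurable $v$, so that the integrals are defined. $|\cdot|$ of a set denotes Lebesgue measure. *)

theory Defs
  imports "HOL-Analysis.Analysis"
begin

section \<open>The Heisenberg group\<close>

text \<open>
  With \<open>n = CARD('n)\<close>, the underlying space \<open>R^N\<close>, \<open>N = 2 n + 1\<close>, is \<open>R^n \<times> R^n \<times> R\<close>
  (with its Euclidean structure and Lebesgue measure), and \<open>R^m\<close>, \<open>m = 2 n\<close>, is indexed by
  the sum type \<open>'n + 'n\<close>: \<open>Inl i\<close> plays the role of the index \<open>i\<close>, \<open>Inr i\<close> that of \<open>n + i\<close>.
\<close>

type_synonym 'n heis = "(real^'n) \<times> (real^'n) \<times> real"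
type_synonym 'n horiz = "real^('n + 'n)"

definition hmul :: "'n::finite heis \<Rightarrow> 'n heis \<Rightarrow> 'n heis" where
  "hmul = (\<lambda>(x1, x2, x3) (y1, y2, y3).
     (x1 + y1, x2 + y2, x3 + y3 + (x1 \<bullet> y2 - x2 \<bullet> y1) / 2))"

definition hdil :: "real \<Rightarrow> 'n::finite heis \<Rightarrow> 'n heis" where
  "hdil t = (\<lambda>(x1, x2, x3). (t *\<^sub>R x1, t *\<^sub>R x2, t\<^sup>2 * x3))"

definition int_points :: "'n::finite heis set" where
  "int_points = {(x1, x2, x3). (\<forall>i. x1 $ i \<in> \<int>) \<and> (\<forall>i. x2 $ i \<in> \<int>) \<and> x3 \<in> \<int>}"

definition hproj :: "'n::finite heis \<Rightarrow> 'n horiz" where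
  "hproj = (\<lambda>(x1, x2, x3). \<chi> j. case j of Inl i \<Rightarrow> x1 $ i | Inr i \<Rightarrow> x2 $ i)"

definition lin_fun :: "'n::finite horiz \<Rightarrow> 'n heis \<Rightarrow> real" where
  "lin_fun q x = q \<bullet> hproj x"

definition cubeQ :: "'n::finite heis set" where
  "cubeQ = {(x1, x2, x3). (\<forall>i. x1 $ i \<in> {-1..<1}) \<and> (\<forall>i. x2 $ i \<in> {-1..<1}) \<and> x3 \<in> {-1..<1}}"

definition cubeQk :: "nat \<Rightarrow> 'n::finite heis set" where
  "cubeQk k = hdil (real k) ` cubeQ"


section \<open>Horizontal vector fields and test functions\<close>

text \<open>The coefficient vector, at \<open>x\<close>, of the left-invariant vector field with index \<open>j\<close>.\<close>

definition hfield :: "'n + 'n \<Rightarrow> 'n::finite heis \<Rightarrow> 'n heis" where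
  "hfield j = (\<lambda>(x1, x2, x3). case j of
       Inl i \<Rightarrow> (axis i 1, 0, - (x2 $ i) / 2)
     | Inr i \<Rightarrow> (0, axis i 1, x1 $ i / 2))"

definition X_classical :: "'n + 'n \<Rightarrow> ('n::finite heis \<Rightarrow> real) \<Rightarrow> 'n heis \<Rightarrow> real" where
  "X_classical j \<phi> x = frechet_derivative \<phi> (at x) (hfield j x)"

primrec Ck :: "nat \<Rightarrow> ('a::euclidean_space \<Rightarrow> real) \<Rightarrow> bool" where
  "Ck 0 \<phi> \<longleftrightarrow> continuous_on UNIV \<phi>"
| "Ck (Suc k) \<phi> \<longleftrightarrow> (\<forall>x. \<phi> differentiable (at x)) \<and>
     (\<forall>b\<in>Basis. Ck k (\<lambda>x. frechet_derivative \<phi> (at x) b))"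

definition test_funs :: "'a::euclidean_space set \<Rightarrow> ('a \<Rightarrow> real) set" where
  "test_funs A = {\<phi>. (\<forall>k. Ck k \<phi>) \<and>
     compact (closure {x. \<phi> x \<noteq> 0}) \<and> closure {x. \<phi> x \<noteq> 0} \<subseteq> A}"


section \<open>Horizontal Sobolev spaces\<close>

text \<open>
  Functions are total; only their values on the (open) set \<open>A\<close> matter. As usual, functions
  stand for their classes modulo equality almost everywhere on \<open>A\<close>.
\<close>

definition Lp_fun :: "real \<Rightarrow> 'a::euclidean_space set \<Rightarrow> ('a \<Rightarrow> real) set" where
  "Lp_fun \<alpha> A = {u. u \<in> borel_measurable (lebesgue_on A) \<and>
     integrable (lebesgue_on A) (\<lambda>x. \<bar>u x\<bar> powr \<alpha>)}"

definition loc_integrable :: "'a::euclidean_space set \<Rightarrow> ('a \<Rightarrow> real) \<Rightarrow> bool" where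
  "loc_integrable A u \<longleftrightarrow> (\<forall>K. compact K \<and> K \<subseteq> A \<longrightarrow> integrable (lebesgue_on K) u)"

text \<open>
  \<open>w\<close> is the distributional derivative of \<open>u\<close> on \<open>A\<close> along the vector field with index \<open>j\<close>.
  That field is divergence free (its last coefficient does not depend on the last variable and
  its other coefficients are constant), so its formal transpose is minus itself.
\<close>

definition weak_X ::
  "'n::finite heis set \<Rightarrow> 'n + 'n \<Rightarrow> ('n heis \<Rightarrow> real) \<Rightarrow> ('n heis \<Rightarrow> real) \<Rightarrow> bool" where
  "weak_X A j u w \<longleftrightarrow> loc_integrable A u \<and> loc_integrable A w \<and>
     (\<forall>\<phi>\<in>test_funs A.
        (\<integral>x. u x * X_classical j \<phi> x \<partial>lebesgue_on A) = - (\<integral>x. w x * \<phi> x \<partial>lebesgue_on A))"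

text \<open>
  The horizontal gradient; each component is an arbitrary representative of the distributional
  derivative, which is unique up to null subsets of \<open>A\<close>.
\<close>

definition hgrad :: "'n::finite heis set \<Rightarrow> ('n heis \<Rightarrow> real) \<Rightarrow> 'n heis \<Rightarrow> 'n horiz" where
  "hgrad A u x = (\<chi> j. (SOME w. weak_X A j u w) x)"

definition W_space :: "real \<Rightarrow> 'n::finite heis set \<Rightarrow> ('n heis \<Rightarrow> real) set" where
  "W_space \<alpha> A = {u \<in> Lp_fun \<alpha> A. \<forall>j. \<exists>w\<in>Lp_fun \<alpha> A. weak_X A j u w}"

definition W_norm :: "real \<Rightarrow> 'n::finite heis set \<Rightarrow> ('n heis \<Rightarrow> real) \<Rightarrow> real" where
  "W_norm \<alpha> A u =
     ((\<integral>x. \<bar>u x\<bar> powr \<alpha> \<partial>lebesgue_on A) +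
      (\<Sum>j\<in>UNIV. \<integral>x. \<bar>hgrad A u x $ j\<bar> powr \<alpha> \<partial>lebesgue_on A)) powr (1 / \<alpha>)"

definition W0_space :: "real \<Rightarrow> 'n::finite heis set \<Rightarrow> ('n heis \<Rightarrow> real) set" where
  "W0_space \<alpha> A = {u \<in> W_space \<alpha> A. \<forall>\<epsilon>>0. \<exists>\<phi>\<in>test_funs A. W_norm \<alpha> A (\<lambda>x. u x - \<phi> x) < \<epsilon>}"


section \<open>The minimisation problem\<close>

text \<open>
  The Sobolev spaces are those on the interior of \<open>A\<close>, so that the definition applies both to
  domains and to the half-open boxes \<open>cubeQk k\<close>, whose boundary is a null set. For integrands
  \<open>f\<close> with \<open>0 \<le> f x p \<le> C (\<bar>p\<bar>^\<alpha> + 1)\<close> and such bounded \<open>A\<close> the set of energies is nonempty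
  and bounded below by \<open>0\<close>, so the infimum in \<open>real\<close> is the true one.
\<close>

definition mu ::
  "real \<Rightarrow> ('n::finite heis \<Rightarrow> 'n horiz \<Rightarrow> real) \<Rightarrow> 'n horiz \<Rightarrow> 'n heis set \<Rightarrow> real" where
  "mu \<alpha> f q A = Inf {\<integral>x. f x (hgrad (interior A) u x) \<partial>lebesgue_on A | u.
     u \<in> W_space \<alpha> (interior A) \<and> (\<lambda>x. u x - lin_fun q x) \<in> W0_space \<alpha> (interior A)}"

text \<open>
  Superposition measurability: \<open>x \<mapsto> f x (v x)\<close> is Lebesgue measurable for every Lebesgue
  measurable \<open>v\<close>.
\<close>

definition sup_measurable ::
  "('n::finite heis \<Rightarrow> 'n horiz \<Rightarrow> real) \<Rightarrow> bool" where
  "sup_measurable f \<longleftrightarrow>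
     (\<forall>v\<in>borel_measurable lebesgue. (\<lambda>x. f x (v x)) \<in> borel_measurable lebesgue)"

end

theory Submission
  imports Defs
begin

text \<open>
  Fix \<open>k\<close>. The left translates of \<open>Q\<^sup>k\<close> by the lattice \<open>\<delta>\<^sub>k (2 \<int>\<^sup>N)\<close> tile the group, and those
  contained in \<open>Q\<^sup>h\<close> fill it up to a set of measure \<open>o (\<bar>Q\<^sup>h\<bar>)\<close> as \<open>h \<rightarrow> \<infinity>\<close>. Given a competitor
  \<open>u\<close> on \<open>Q\<^sup>k\<close>, the function \<open>l\<^sub>q\<close> plus the sum of the translates of \<open>u - l\<^sub>q\<close> to these tiles is a
  competitor on \<open>Q\<^sup>h\<close>: the horizontal gradient is left-invariant and extension by zero is harmless
  in the closure of the test functions. By the periodicity of \<open>f\<close> each tile contributes the energy of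
  \<open>u\<close>, and the remainder contributes \<open>o (\<bar>Q\<^sup>h\<bar>)\<close> by the growth bound. So the upper limit of
  \<open>\<mu>\<^sub>q (Q\<^sup>h) / \<bar>Q\<^sup>h\<bar>\<close> is at most \<open>\<mu>\<^sub>q (Q\<^sup>k) / \<bar>Q\<^sup>k\<bar>\<close> for every \<open>k\<close>.
\<close>

section \<open>Functions with continuous partial derivatives of every order\<close>

text \<open>Two obstacles shape the argument. First, \<open>hgrad\<close> is an arbitrary
  representative, so gradients are known only almost everywhere; uniqueness of weak derivatives,
  through the fundamental lemma, and completeness of Lebesgue measure remove the ambiguity. Second,
  gluing must not create singular derivatives on the faces of the tiles. A competitor
  \<open>u\<close> is therefore replaced by the jet of \<open>u - l_q\<close>: a globally defined
  pair (function, horizontal gradient) that vanishes off the open box and is an L^\<alpha> limit of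
  jets of test functions. Integration by parts holds for the latter on the whole group and passes to
  the limit, so no trace or boundary regularity enters, and sums and left translates of such jets
  are again of this kind. The leftover is small although left translation shears the tiles: at
  horizontal distance \<open>h\<close> a tile is tilted by O(h), while the height of
  \<open>Q\<^sup>h\<close> is of order h^2. Shrinking the box by a constant \<open>R\<close>
  horizontally and by \<open>R * h\<close> vertically keeps every tile that meets it inside
  \<open>Q\<^sup>h\<close>, and costs only a fraction O(1/h) of the volume.\<close>

lemma Ck_SucI:
  assumes "\<And>x. (\<phi> has_derivative D x) (at x)" and "\<And>b. b \<in> Basis \<Longrightarrow> Ck k (\<lambda>x. D x b)"
  shows "Ck (Suc k) \<phi>"
proof -
  have "frechet_derivative \<phi> (at x) = D x" for x
    using assms(1) frechet_derivative_at by metis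
  then show ?thesis
    using assms by (auto simp: differentiable_def)
qed

lemma Ck_SucD:
  assumes "Ck (Suc k) \<phi>"
  shows "(\<phi> has_derivative frechet_derivative \<phi> (at x)) (at x)"
    and "b \<in> Basis \<Longrightarrow> Ck k (\<lambda>x. frechet_derivative \<phi> (at x) b)"
  using assms frechet_derivative_works by auto

lemma Ck_Suc_imp_Ck: "Ck (Suc k) \<phi> \<Longrightarrow> Ck k \<phi>"
proof (induction k arbitrary: \<phi>)
  case 0
  then show ?case
    by (simp add: continuous_at_imp_continuous_on differentiable_imp_continuous_within)
qed simp

lemma Ck_continuous: "Ck k \<phi> \<Longrightarrow> continuous_on UNIV \<phi>"
  by (induction k) (simp, metis Ck_Suc_imp_Ck)

lemma Ck_const: "Ck k (\<lambda>x. c)"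
proof (induction k arbitrary: c)
  case (Suc k)
  then show ?case
    by (intro Ck_SucI[where D="\<lambda>x y. 0"]) auto
qed simp

lemma Ck_add: "Ck k \<phi> \<Longrightarrow> Ck k \<psi> \<Longrightarrow> Ck k (\<lambda>x. \<phi> x + \<psi> x)"
proof (induction k arbitrary: \<phi> \<psi>)
  case 0
  then show ?case by (simp add: continuous_on_add)
next
  case (Suc k)
  show ?case
    by (intro Ck_SucI[OF has_derivative_add[OF Ck_SucD(1)[OF Suc.prems(1)] Ck_SucD(1)[OF Suc.prems(2)]]]
        Suc.IH Ck_SucD(2)[OF Suc.prems(1)] Ck_SucD(2)[OF Suc.prems(2)])
qed

lemma Ck_mult: "Ck k \<phi> \<Longrightarrow> Ck k \<psi> \<Longrightarrow> Ck k (\<lambda>x. \<phi> x * \<psi> x)"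
proof (induction k arbitrary: \<phi> \<psi>)
  case 0
  then show ?case by (simp add: continuous_on_mult)
next
  case (Suc k)
  show ?case
    by (intro Ck_SucI[OF has_derivative_mult[OF Ck_SucD(1)[OF Suc.prems(1)] Ck_SucD(1)[OF Suc.prems(2)]]]
        Ck_add Suc.IH Ck_SucD(2)[OF Suc.prems(1)] Ck_SucD(2)[OF Suc.prems(2)]
        Ck_Suc_imp_Ck[OF Suc.prems(1)] Ck_Suc_imp_Ck[OF Suc.prems(2)])
qed

lemma Ck_sum: "(\<And>i. i \<in> I \<Longrightarrow> Ck k (\<phi> i)) \<Longrightarrow> Ck k (\<lambda>x. \<Sum>i\<in>I. \<phi> i x)"
  by (induction I rule: infinite_finite_induct) (auto intro: Ck_add Ck_const)

lemma Ck_prod: "(\<And>i. i \<in> I \<Longrightarrow> Ck k (\<phi> i)) \<Longrightarrow> Ck k (\<lambda>x. \<Prod>i\<in>I. \<phi> i x)"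
  by (induction I rule: infinite_finite_induct) (auto intro: Ck_mult Ck_const)

text \<open>Left translations of the group are affine, so this is what moves test functions by group
  elements; it also yields the coordinate factors of the bumps.\<close>

lemma Ck_affine:
  fixes L :: "'a::euclidean_space \<Rightarrow> 'b::euclidean_space"
  assumes L: "linear L"
  shows "Ck k \<phi> \<Longrightarrow> Ck k (\<lambda>x. \<phi> (c + L x))"
proof (induction k arbitrary: \<phi>)
  case 0
  have "continuous_on UNIV (\<lambda>x. c + L x)"
    using L by (intro continuous_intros linear_continuous_on linear_conv_bounded_linear[THEN iffD1])
  then show ?case
    using 0 by (auto intro: continuous_on_compose2)
next
  case (Suc k)
  let ?D = "\<lambda>x. frechet_derivative \<phi> (at x)"
  have 1: "((\<lambda>x. \<phi> (c + L x)) has_derivative (\<lambda>b. ?D (c + L x) (L b))) (at x)" for x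
  proof -
    have "((\<lambda>x. c + L x) has_derivative L) (at x)"
      using L by (auto intro!: derivative_eq_intros linear_imp_has_derivative)
    from diff_chain_at[OF this Ck_SucD(1)[OF Suc.prems]] show ?thesis
      by (simp add: o_def)
  qed
  \<comment> \<open>\<open>Ck\<close> controls only the derivatives in basis directions, whereas the
    chain rule produces the direction \<open>L b\<close>; expanding it in the basis leaves constant
    coefficients.\<close>
  have 2: "?D y v = (\<Sum>b\<in>Basis. (v \<bullet> b) * ?D y b)" for y v
  proof -
    interpret linear "?D y"
      using Ck_SucD(1)[OF Suc.prems] by (rule has_derivative_linear)
    have "?D y v = ?D y (\<Sum>b\<in>Basis. (v \<bullet> b) *\<^sub>R b)"
      by (simp add: euclidean_representation)
    also have "\<dots> = (\<Sum>b\<in>Basis. (v \<bullet> b) * ?D y b)"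
      by (simp add: sum scale)
    finally show ?thesis .
  qed
  show ?case
    by (rule Ck_SucI[OF 1], subst 2) (intro Ck_sum Ck_mult Ck_const Suc.IH Ck_SucD(2)[OF Suc.prems])
qed

lemma Ck_linear:
  assumes "linear (L :: 'a::euclidean_space \<Rightarrow> real)"
  shows "Ck k L"
proof (cases k)
  case 0
  then show ?thesis
    using assms by (simp add: linear_continuous_on linear_conv_bounded_linear[THEN iffD1])
next
  case (Suc l)
  show ?thesis
    unfolding Suc using linear_imp_has_derivative[OF assms] by (rule Ck_SucI) (rule Ck_const)
qed

text \<open>The derivatives of \<open>exp (-1/t)\<close> are of this form, with polynomials \<open>p\<close>.\<close>

definition flat_exp :: "real poly \<Rightarrow> real \<Rightarrow> real" where
  "flat_exp p t = (if t > 0 then poly p (1 / t) * exp (- (1 / t)) else 0)"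

lemma poly_mult_exp_minus_tendsto_0: "((\<lambda>s::real. poly p s * exp (- s)) \<longlongrightarrow> 0) at_top"
proof -
  have "((\<lambda>s. \<Sum>i\<le>degree p. coeff p i * (s ^ i / exp s)) \<longlongrightarrow> (\<Sum>i\<le>degree p. coeff p i * 0)) at_top"
    by (intro tendsto_intros tendsto_power_div_exp_0)
  then show ?thesis
    by (simp add: poly_altdef exp_minus field_simps sum_distrib_left sum_divide_distrib)
qed

text \<open>With s = 1/t one has d/dt = - s^2 d/ds, which turns p(s) exp(-s) into s^2 (p - p')(s)
  exp(-s). So the family is closed under differentiation, and smoothness follows by induction over
  all \<open>p\<close> at once.\<close>

lemma flat_exp_has_derivative:
  "(flat_exp p has_real_derivative flat_exp (monom 1 2 * (p - pderiv p)) t) (at t)"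
proof -
  consider "t > 0" | "t < 0" | "t = 0" by linarith
  then show ?thesis
  proof cases
    case 1
    have inv: "((\<lambda>t. 1 / t) has_real_derivative - (1 / t\<^sup>2)) (at t)"
      using 1 by (auto intro!: derivative_eq_intros simp: power2_eq_square)
    have "((\<lambda>t. poly p (1 / t) * exp (- (1 / t))) has_real_derivative
        poly (pderiv p) (1 / t) * - (1 / t\<^sup>2) * exp (- (1 / t)) +
        exp (- (1 / t)) * - (- (1 / t\<^sup>2)) * poly p (1 / t)) (at t)"
      by (intro DERIV_mult DERIV_chain2[OF poly_DERIV inv] DERIV_chain2[OF DERIV_exp DERIV_minus[OF inv]])
    also have "poly (pderiv p) (1 / t) * - (1 / t\<^sup>2) * exp (- (1 / t)) +
        exp (- (1 / t)) * - (- (1 / t\<^sup>2)) * poly p (1 / t) = flat_exp (monom 1 2 * (p - pderiv p)) t"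
      using 1 by (simp add: flat_exp_def poly_monom power_one_over algebra_simps)
    finally have "((\<lambda>t. poly p (1 / t) * exp (- (1 / t))) has_real_derivative
        flat_exp (monom 1 2 * (p - pderiv p)) t) (at t)" .
    then show ?thesis
      by (rule has_field_derivative_transform_within_open[where S="{0<..}"])
        (use 1 in \<open>auto simp: flat_exp_def\<close>)
  next
    case 2
    have "((\<lambda>t. 0) has_real_derivative flat_exp (monom 1 2 * (p - pderiv p)) t) (at t)"
      using 2 by (auto simp: flat_exp_def)
    then show ?thesis
      by (rule has_field_derivative_transform_within_open[where S="{..<0}"])
        (use 2 in \<open>auto simp: flat_exp_def\<close>)
  next
    case 3
    have "((\<lambda>h. flat_exp p h / h) \<longlongrightarrow> 0) (at_right 0)"
    proof -
      \<comment> \<open>Dividing by \<open>h\<close> multiplies by s = 1/h, that is, replaces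
        \<open>p\<close> by \<open>pCons 0 p\<close>; the exponential still wins.\<close>
      have "((\<lambda>h::real. poly (pCons 0 p) (inverse h) * exp (- inverse h)) \<longlongrightarrow> 0) (at_right 0)"
        using poly_mult_exp_minus_tendsto_0 filterlim_inverse_at_top_right by (rule filterlim_compose)
      moreover have "\<forall>\<^sub>F h in at_right 0.
          poly (pCons 0 p) (inverse h) * exp (- inverse h) = flat_exp p h / h"
        unfolding eventually_at_right_field
        by (intro exI[of _ 1]) (auto simp: flat_exp_def field_simps)
      ultimately show ?thesis
        by (rule Lim_transform_eventually)
    qed
    moreover have "((\<lambda>h. flat_exp p h / h) \<longlongrightarrow> 0) (at_left 0)"
    proof -
      have "\<forall>\<^sub>F h in at_left 0. 0 = flat_exp p h / h"
        unfolding eventually_at_left_field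
        by (intro exI[of _ "-1"]) (auto simp: flat_exp_def)
      with tendsto_const show ?thesis
        by (rule Lim_transform_eventually)
    qed
    ultimately have "((\<lambda>h. flat_exp p h / h) \<longlongrightarrow> 0) (at 0)"
      by (simp add: filterlim_split_at_real)
    then show ?thesis
      using 3 by (simp add: DERIV_def flat_exp_def)
  qed
qed

lemma Ck_flat_exp: "Ck k (flat_exp p)"
proof (induction k arbitrary: p)
  case 0
  show ?case
    using flat_exp_has_derivative by simp (metis DERIV_continuous_on has_field_derivative_at_within)
next
  case (Suc k)
  show ?case
    using flat_exp_has_derivative[unfolded has_field_derivative_def]
    by (rule Ck_SucI) (auto intro: Suc.IH)
qed

section \<open>The fundamental lemma of the calculus of variations\<close>

lemma test_funs_Ck: "\<phi> \<in> test_funs A \<Longrightarrow> Ck k \<phi>"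
  by (simp add: test_funs_def)

lemma test_funsE:
  assumes "\<phi> \<in> test_funs A"
  obtains K where "compact K" "K \<subseteq> A" "\<And>x. x \<notin> K \<Longrightarrow> \<phi> x = 0"
  using assms closure_subset[of "{x. \<phi> x \<noteq> 0}"] unfolding test_funs_def by blast

lemma test_funsI:
  assumes "\<And>k. Ck k \<phi>" "compact K" "K \<subseteq> A" "\<And>x. x \<notin> K \<Longrightarrow> \<phi> x = 0"
  shows "\<phi> \<in> test_funs A"
proof -
  have "closure {x. \<phi> x \<noteq> 0} \<subseteq> K"
    using assms by (intro closure_minimal compact_imp_closed) auto
  moreover have "compact (K \<inter> closure {x. \<phi> x \<noteq> 0})"
    using assms(2) by (intro compact_Int_closed) auto
  ultimately show ?thesis
    unfolding test_funs_def using assms(1,3) by (auto simp: inf.absorb2)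
qed

lemma test_funs_mono: "A \<subseteq> B \<Longrightarrow> test_funs A \<subseteq> test_funs B"
  by (auto simp: test_funs_def)

lemma test_funs_0: "(\<lambda>x. 0) \<in> test_funs A"
  by (rule test_funsI[of _ "{}"]) (auto intro: Ck_const)

lemma test_funs_add: "\<phi> \<in> test_funs A \<Longrightarrow> \<psi> \<in> test_funs A \<Longrightarrow> (\<lambda>x. \<phi> x + \<psi> x) \<in> test_funs A"
proof -
  assume \<phi>: "\<phi> \<in> test_funs A" and \<psi>: "\<psi> \<in> test_funs A"
  obtain K L where "compact K" "K \<subseteq> A" "compact L" "L \<subseteq> A"
    "\<And>x. x \<notin> K \<Longrightarrow> \<phi> x = 0" "\<And>x. x \<notin> L \<Longrightarrow> \<psi> x = 0"
    using test_funsE[OF \<phi>] test_funsE[OF \<psi>] by metis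
  then show ?thesis
    by (intro test_funsI[of _ "K \<union> L"] Ck_add test_funs_Ck[OF \<phi>] test_funs_Ck[OF \<psi>]) auto
qed

lemma test_funs_mult_Ck:
  assumes "\<And>k. Ck k u" "\<phi> \<in> test_funs A"
  shows "(\<lambda>x. u x * \<phi> x) \<in> test_funs A"
  using assms(2)
  by (rule test_funsE) (rule test_funsI, auto intro: Ck_mult assms(1) test_funs_Ck[OF assms(2)])

text \<open>Since \<open>exp (-1/(n t)) \<rightarrow> 1\<close> for \<open>t > 0\<close>, these functions tend to the indicator of the
  open box as \<open>s \<rightarrow> \<infinity>\<close>.\<close>

definition box_bump :: "'a::euclidean_space \<Rightarrow> 'a \<Rightarrow> real \<Rightarrow> 'a \<Rightarrow> real" where
  "box_bump a b s x = (\<Prod>i\<in>Basis. flat_exp 1 (s * (x \<bullet> i - a \<bullet> i)) * flat_exp 1 (s * (b \<bullet> i - x \<bullet> i)))"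

lemma flat_exp_1: "flat_exp 1 t = (if t > 0 then exp (- (1 / t)) else 0)"
  by (simp add: flat_exp_def)

lemma flat_exp_1_bounds: "0 \<le> flat_exp 1 t" "flat_exp 1 t \<le> 1"
  by (auto simp: flat_exp_def)

lemma Ck_box_bump: "Ck k (box_bump a b s)"
proof -
  have 1: "Ck k (\<lambda>x. flat_exp 1 (s * (x \<bullet> i - a \<bullet> i)))" for i
  proof -
    have "linear (\<lambda>x. s * (x \<bullet> i))"
      by (rule linearI) (auto simp: inner_simps algebra_simps)
    from Ck_affine[OF this Ck_flat_exp[of k 1], of "- s * (a \<bullet> i)"] show ?thesis
      by (simp add: algebra_simps)
  qed
  have 2: "Ck k (\<lambda>x. flat_exp 1 (s * (b \<bullet> i - x \<bullet> i)))" for i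
  proof -
    have "linear (\<lambda>x. - s * (x \<bullet> i))"
      by (rule linearI) (auto simp: inner_simps algebra_simps)
    from Ck_affine[OF this Ck_flat_exp[of k 1], of "s * (b \<bullet> i)"] show ?thesis
      by (simp add: algebra_simps)
  qed
  show ?thesis
    unfolding box_bump_def by (intro Ck_prod Ck_mult 1 2)
qed

lemma box_bump_outside:
  assumes "x \<notin> box a b" "s \<ge> 0"
  shows "box_bump a b s x = 0"
proof -
  from assms(1) obtain i where i: "i \<in> Basis" "x \<bullet> i \<le> a \<bullet> i \<or> b \<bullet> i \<le> x \<bullet> i"
    by (auto simp: box_def not_less)
  then have "s * (x \<bullet> i - a \<bullet> i) \<le> 0 \<or> s * (b \<bullet> i - x \<bullet> i) \<le> 0"
    using assms(2) by (auto simp: mult_le_0_iff)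
  then have "flat_exp 1 (s * (x \<bullet> i - a \<bullet> i)) * flat_exp 1 (s * (b \<bullet> i - x \<bullet> i)) = 0"
    by (auto simp: flat_exp_def)
  with i(1) show ?thesis
    unfolding box_bump_def by (meson finite_Basis prod_zero)
qed

lemma box_bump_bounds: "0 \<le> box_bump a b s x" "box_bump a b s x \<le> 1"
  unfolding box_bump_def by (auto intro!: prod_nonneg prod_le_1 mult_le_one flat_exp_1_bounds mult_nonneg_nonneg)

lemma flat_exp_scaled_tendsto_1: "t > 0 \<Longrightarrow> (\<lambda>n. flat_exp 1 (real (Suc n) * t)) \<longlonglongrightarrow> 1"
proof -
  assume t: "t > 0"
  have "(\<lambda>n. exp (- (inverse (real (Suc n)) * (1 / t)))) \<longlonglongrightarrow> exp (- (0 * (1 / t)))"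
    by (intro tendsto_intros LIMSEQ_inverse_real_of_nat)
  then show ?thesis
    using t by (simp add: flat_exp_1 field_simps add_pos_nonneg)
qed

lemma box_bump_tendsto:
  fixes a b :: "'a::euclidean_space"
  shows "(\<lambda>n. box_bump a b (real (Suc n)) x) \<longlonglongrightarrow> indicator (box a b) x"
proof (cases "x \<in> box a b")
  case True
  have "(\<lambda>n. box_bump a b (real (Suc n)) x) \<longlonglongrightarrow> (\<Prod>i\<in>(Basis::'a set). 1 * 1)"
    unfolding box_bump_def using True
    by (intro tendsto_prod tendsto_mult flat_exp_scaled_tendsto_1) (auto simp: box_def)
  then show ?thesis using True by simp
qed (simp add: box_bump_outside)

lemma box_bump_test_fun:
  assumes "cbox a b \<subseteq> A" "s \<ge> 0"
  shows "box_bump a b s \<in> test_funs A"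
  using assms box_subset_cbox[of a b]
  by (intro test_funsI[of _ "cbox a b"] Ck_box_bump) (auto intro: box_bump_outside)

text \<open>A \<open>\<pi>\<close>-\<open>\<lambda>\<close> argument: the boxes generate the Borel sets.\<close>

lemma AE_zero_if_box_integrals_zero:
  fixes g :: "'a::euclidean_space \<Rightarrow> real"
  assumes g: "integrable lebesgue g" and tot: "(\<integral>x. g x \<partial>lebesgue) = 0"
    and box: "\<And>a b. (\<integral>x. indicator (box a b) x * g x \<partial>lebesgue) = 0"
  shows "AE x in lebesgue. g x = 0"
proof -
  \<comment> \<open>The induction over generated sets lives on Borel sets, so \<open>g\<close> is
    replaced by a Borel function equal to it almost everywhere.\<close>
  obtain g' where g'[measurable]: "g' \<in> borel_measurable lborel" and ae: "AE x in lborel. g x = g' x"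
    using completion_ex_borel_measurable_real[of g lborel] g by auto
  have ae': "AE x in lebesgue. g x = g' x"
    using ae by (rule AE_completion)
  have eq: "(\<integral>x. indicator A x * g' x \<partial>lborel) = (\<integral>x. indicator A x * g x \<partial>lebesgue)"
    if [measurable]: "A \<in> sets borel" for A
  proof -
    have "(\<integral>x. indicator A x * g' x \<partial>lborel) = (\<integral>x. indicator A x * g' x \<partial>lebesgue)"
      by (rule integral_completion[symmetric]) measurable
    also have "\<dots> = (\<integral>x. indicator A x * g x \<partial>lebesgue)"
    proof (rule integral_cong_AE)
      show "(\<lambda>x. indicator A x * g' x) \<in> borel_measurable lebesgue"
        by (rule measurable_completion) measurable
      show "(\<lambda>x. indicator A x * g x) \<in> borel_measurable lebesgue"
        using g that by (intro borel_measurable_times borel_measurable_indicator) auto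
    qed (use ae' in auto)
    finally show ?thesis .
  qed
  have int': "integrable lborel g'"
  proof -
    have "integrable lebesgue g'"
      by (rule integrable_cong_AE_imp[OF g measurable_completion[OF g']]) (use ae' in auto)
    then show ?thesis
      by (simp add: integrable_completion)
  qed
  have seti: "set_integrable lborel A g'" if "A \<in> sets borel" for A
    using int' that unfolding set_integrable_def
    by (intro integrable_mult_indicator) auto
  have tot': "(\<integral>x. g' x \<partial>lborel) = 0"
    using eq[of UNIV] tot by simp
  have "set_lebesgue_integral lborel A g' = 0" if "A \<in> sets lborel" for A
  proof -
    have "Int_stable (range (\<lambda>(a, b). box a b :: 'a set))"
      by (auto simp: Int_stable_def box_Int_box)
    moreover have "range (\<lambda>(a, b). box a b :: 'a set) \<subseteq> Pow UNIV"
      by simp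
    moreover have "A \<in> sigma_sets UNIV (range (\<lambda>(a, b). box a b :: 'a set))"
      using that by (simp add: borel_eq_box)
    ultimately show ?thesis
    proof (induction rule: sigma_sets_induct_disjoint)
      case (basic A)
      then show ?case
        using eq box by (auto simp: set_lebesgue_integral_def)
    next
      case empty
      then show ?case by (simp add: set_lebesgue_integral_def)
    next
      \<comment> \<open>Passing to complements is where the vanishing of the total integral
        enters.\<close>
      case (compl A)
      then have A: "A \<in> sets borel"
        by (simp add: borel_eq_box)
      have "set_lebesgue_integral lborel (A \<union> (UNIV - A)) g' =
          set_lebesgue_integral lborel A g' + set_lebesgue_integral lborel (UNIV - A) g'"
        using A by (intro set_integral_Un seti) auto
      moreover have "set_lebesgue_integral lborel (A \<union> (UNIV - A)) g' = 0"
        using tot' by (simp add: set_lebesgue_integral_def)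
      ultimately show ?case using compl by simp
    next
      case (union A)
      then have A: "A i \<in> sets borel" for i
        by (auto simp: borel_eq_box)
      have "set_lebesgue_integral lborel (\<Union>i. A i) g' = (\<Sum>i. set_lebesgue_integral lborel (A i) g')"
        using A union.hyps(1)
        by (intro lebesgue_integral_countable_add seti) (auto simp: disjoint_family_on_def)
      then show ?case using union by simp
    qed
  qed
  from sigma_finite_measure.density_zero[OF sigma_finite_lborel int' this] have "AE x in lborel. g' x = 0" .
  with ae have "AE x in lborel. g x = 0" by eventually_elim simp
  then show ?thesis by (rule AE_completion)
qed

lemma loc_integrable_cbox:
  assumes "loc_integrable A w" "cbox a b \<subseteq> A"
  shows "integrable lebesgue (\<lambda>x. indicator (cbox a b) x * w x)"
  using assms integrable_restrict_space[of "cbox a b" lebesgue w]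
  by (auto simp: loc_integrable_def)

text \<open>The bumps of the box are test functions bounded by 1 that converge to the indicator of
  the open box. Dominated convergence applies with the majorant |w| on the compact box, which is
  integrable although \<open>w\<close> is only locally integrable on \<open>A\<close>.\<close>

lemma box_integral_zero:
  assumes w: "loc_integrable A w" and A: "open A"
    and zero: "\<And>\<phi>. \<phi> \<in> test_funs A \<Longrightarrow> (\<integral>x. w x * \<phi> x \<partial>lebesgue_on A) = 0"
    and sub: "cbox a b \<subseteq> A"
  shows "(\<integral>x. indicator (box a b) x * w x \<partial>lebesgue) = 0"
proof -
  let ?W = "\<lambda>x. indicator (cbox a b) x * w x"
  let ?s = "\<lambda>n x. ?W x * box_bump a b (real (Suc n)) x"
  have W: "integrable lebesgue ?W"
    using w sub by (rule loc_integrable_cbox)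
  have bump: "box_bump a b s \<in> borel_measurable lebesgue" for s
    by (intro measurable_completion) (simp add: borel_measurable_continuous_onI Ck_continuous[OF Ck_box_bump])
  have "(\<lambda>n. \<integral>x. ?s n x \<partial>lebesgue) \<longlonglongrightarrow> (\<integral>x. ?W x * indicator (box a b) x \<partial>lebesgue)"
  proof (rule integral_dominated_convergence)
    show "integrable lebesgue (\<lambda>x. \<bar>?W x\<bar>)"
      using W by (rule integrable_abs)
    show "AE x in lebesgue. (\<lambda>n. ?s n x) \<longlonglongrightarrow> ?W x * indicator (box a b) x"
      by (intro always_eventually allI tendsto_mult tendsto_const box_bump_tendsto)
    show "AE x in lebesgue. norm (?s n x) \<le> \<bar>?W x\<bar>" for n
    proof (intro always_eventually allI)
      fix x
      have "\<bar>?W x\<bar> * \<bar>box_bump a b (real (Suc n)) x\<bar> \<le> \<bar>?W x\<bar> * 1"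
        using box_bump_bounds[of a b "real (Suc n)" x] by (intro mult_left_mono) auto
      then show "norm (?s n x) \<le> \<bar>?W x\<bar>"
        by (simp add: abs_mult)
    qed
    show "(\<lambda>x. ?W x * indicator (box a b) x) \<in> borel_measurable lebesgue"
      by (rule borel_measurable_times[OF borel_measurable_integrable[OF W]]) (auto intro!: borel_measurable_indicator)
    show "?s n \<in> borel_measurable lebesgue" for n
      by (rule borel_measurable_times[OF borel_measurable_integrable[OF W] bump])
  qed
  moreover have "(\<integral>x. ?s n x \<partial>lebesgue) = 0" for n
  proof -
    have "?s n x = indicator A x *\<^sub>R (w x * box_bump a b (real (Suc n)) x)" for x
      using sub box_subset_cbox[of a b] box_bump_outside[of x a b "real (Suc n)"]
      by (auto simp: indicator_def)
    then have "(\<integral>x. ?s n x \<partial>lebesgue) =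
        (\<integral>x. indicator A x *\<^sub>R (w x * box_bump a b (real (Suc n)) x) \<partial>lebesgue)"
      by (rule Bochner_Integration.integral_cong[OF refl])
    also have "\<dots> = (\<integral>x. w x * box_bump a b (real (Suc n)) x \<partial>lebesgue_on A)"
      by (rule integral_restrict_space[symmetric]) (use A in simp)
    finally have "(\<integral>x. ?s n x \<partial>lebesgue) = (\<integral>x. w x * box_bump a b (real (Suc n)) x \<partial>lebesgue_on A)" .
    then show ?thesis
      using zero[OF box_bump_test_fun[OF sub, of "real (Suc n)"]] by simp
  qed
  ultimately have "(\<integral>x. ?W x * indicator (box a b) x \<partial>lebesgue) = 0"
    by (simp add: LIMSEQ_const_iff)
  moreover have "?W x * indicator (box a b) x = indicator (box a b) x * w x" for x
    using box_subset_cbox[of a b] by (auto simp: indicator_def)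
  ultimately show ?thesis by simp
qed

text \<open>An open set is a countable union of closed boxes, so it suffices to treat
  \<open>w\<close> truncated to one of them, where all box integrals vanish. Its use is the
  uniqueness of weak derivatives.\<close>

lemma fundamental_lemma_calculus_of_variations:
  fixes A :: "'a::euclidean_space set"
  assumes w: "loc_integrable A w" and A: "open A"
    and zero: "\<And>\<phi>. \<phi> \<in> test_funs A \<Longrightarrow> (\<integral>x. w x * \<phi> x \<partial>lebesgue_on A) = 0"
  shows "AE x in lebesgue_on A. w x = 0"
proof -
  have box: "AE x in lebesgue. indicator (box a b) x * w x = 0" if sub: "cbox a b \<subseteq> A" for a b
  proof (rule AE_zero_if_box_integrals_zero)
    have "indicator (box a b) x * (indicator (cbox a b) x * w x) = indicator (box a b) x * w x" for x
      using box_subset_cbox[of a b] by (auto simp: indicator_def)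
    moreover have "integrable lebesgue (\<lambda>x. indicator (box a b) x *\<^sub>R (indicator (cbox a b) x * w x))"
      using loc_integrable_cbox[OF w sub] by (intro integrable_mult_indicator) auto
    ultimately show "integrable lebesgue (\<lambda>x. indicator (box a b) x * w x)"
      by (simp only: real_scaleR_def)
    show "(\<integral>x. indicator (box a b) x * w x \<partial>lebesgue) = 0"
      using box_integral_zero[OF w A zero sub] .
    fix c d
    \<comment> \<open>An intersection of two boxes is a box with these corners, and its closed
      version still lies in \<open>A\<close>.\<close>
    let ?e = "\<Sum>i\<in>Basis. max (c\<bullet>i) (a\<bullet>i) *\<^sub>R i" and ?f = "\<Sum>i\<in>Basis. min (d\<bullet>i) (b\<bullet>i) *\<^sub>R i"
    have "(\<integral>x. indicator (box c d \<inter> box a b) x * w x \<partial>lebesgue) = 0"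
      unfolding box_Int_box
      by (rule box_integral_zero[OF w A zero]) (use sub in \<open>auto simp: Int_interval[symmetric]\<close>)
    then show "(\<integral>x. indicator (box c d) x * (indicator (box a b) x * w x) \<partial>lebesgue) = 0"
      by (simp add: indicator_inter_arith mult.assoc)
  qed
  obtain D where D: "countable D" "D \<subseteq> Pow A" "\<And>X. X \<in> D \<Longrightarrow> \<exists>a b. X = cbox a b" "\<Union>D = A"
    using open_countable_Union_open_cbox[OF A] by metis
  have "AE x in lebesgue. \<forall>X\<in>D. x \<in> X \<longrightarrow> w x = 0"
  proof (subst AE_ball_countable[OF D(1)], intro ballI)
    fix X assume "X \<in> D"
    then obtain a b where X: "X = cbox a b" "cbox a b \<subseteq> A"
      using D by (metis PowD subsetD)
    have "AE x in lebesgue. x \<notin> cbox a b - box a b"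
    proof (rule AE_not_in)
      show "cbox a b - box a b \<in> null_sets lebesgue"
        using negligible_frontier_interval by (simp add: negligible_iff_null_sets)
    qed
    with box[OF X(2)] show "AE x in lebesgue. x \<in> X \<longrightarrow> w x = 0"
      by eventually_elim (auto simp: X(1) split: split_indicator_asm)
  qed
  then have "AE x in lebesgue. x \<in> A \<longrightarrow> w x = 0"
    by eventually_elim (use D(4) in blast)
  then show ?thesis
    using A by (simp add: AE_restrict_space_iff)
qed

section \<open>Shears preserve Lebesgue measure\<close>

lemma nn_integral_lborel_translate:
  fixes f :: "'a::euclidean_space \<Rightarrow> ennreal"
  assumes [measurable]: "f \<in> borel_measurable borel"
  shows "(\<integral>\<^sup>+x. f (c + x) \<partial>lborel) = (\<integral>\<^sup>+x. f x \<partial>lborel)"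
proof -
  have "(\<integral>\<^sup>+x. f x \<partial>lborel) = (\<integral>\<^sup>+x. f x \<partial>distr lborel borel ((+) c))"
    by (simp add: lborel_distr_plus)
  also have "\<dots> = (\<integral>\<^sup>+x. f (c + x) \<partial>lborel)"
    by (rule nn_integral_distr) auto
  finally show ?thesis by simp
qed

lemma borel_measurable_shear:
  fixes g :: "'a::euclidean_space \<times> 'b::euclidean_space \<Rightarrow> real"
  assumes "g \<in> borel_measurable borel"
  shows "(\<lambda>(x1, x2, x3). (c1 + x1, c2 + x2, c3 + x3 + g (x1, x2))) \<in> borel_measurable borel"
proof -
  have g[measurable]: "g \<in> borel_measurable (borel \<Otimes>\<^sub>M borel)"
    using assms by (simp add: borel_prod)
  have "(\<lambda>(x1, x2, x3). (c1 + x1, c2 + x2, c3 + x3 + g (x1, x2))) \<in>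
    (borel :: 'a measure) \<Otimes>\<^sub>M ((borel :: 'b measure) \<Otimes>\<^sub>M (borel :: real measure)) \<rightarrow>\<^sub>M borel \<Otimes>\<^sub>M (borel \<Otimes>\<^sub>M borel)"
    by measurable
  then show ?thesis
    by (simp add: borel_prod)
qed

text \<open>Integrate over the vertical coordinate first: for fixed \<open>x1\<close>,
  \<open>x2\<close> the map is a mere translation there, and afterwards it is a translation in
  \<open>x2\<close> and in \<open>x1\<close>. Left translations and the flows of the horizontal
  fields are both of this form.\<close>

lemma lborel_distr_shear:
  fixes g :: "'a::euclidean_space \<times> 'b::euclidean_space \<Rightarrow> real"
  assumes "g \<in> borel_measurable borel"
  shows "distr lborel borel (\<lambda>(x1, x2, x3). (c1 + x1, c2 + x2, c3 + x3 + g (x1, x2))) = lborel"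
    (is "distr _ _ ?T = _")
proof (rule measure_eqI)
  fix A assume "A \<in> sets (distr lborel borel ?T)"
  then have A: "A \<in> sets borel" by simp
  let ?B = "(borel :: 'a measure) \<Otimes>\<^sub>M ((borel :: 'b measure) \<Otimes>\<^sub>M (borel :: real measure))"
  have [measurable]: "A \<in> sets ?B"
    using A by (simp only: borel_prod)
  have [measurable]: "g \<in> borel_measurable (borel \<Otimes>\<^sub>M borel)"
    using assms by (simp add: borel_prod)
  have T: "?T \<in> borel_measurable borel"
    using assms by (rule borel_measurable_shear)
  have iter: "(\<integral>\<^sup>+x. f x \<partial>lborel) = (\<integral>\<^sup>+x1. \<integral>\<^sup>+x2. \<integral>\<^sup>+x3. f (x1, x2, x3) \<partial>lborel \<partial>lborel \<partial>lborel)"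
    if f[measurable]: "f \<in> borel_measurable ?B" for f :: "'a \<times> 'b \<times> real \<Rightarrow> ennreal"
  proof -
    have "(\<integral>\<^sup>+x. f x \<partial>lborel) = (\<integral>\<^sup>+x1. \<integral>\<^sup>+y. f (x1, y) \<partial>(lborel \<Otimes>\<^sub>M lborel) \<partial>lborel)"
      unfolding lborel_prod[symmetric]
      by (subst lborel_pair.nn_integral_fst[symmetric]) (simp_all add: lborel_prod borel_prod[symmetric])
    also have "\<dots> = (\<integral>\<^sup>+x1. \<integral>\<^sup>+x2. \<integral>\<^sup>+x3. f (x1, x2, x3) \<partial>lborel \<partial>lborel \<partial>lborel)"
      by (intro nn_integral_cong, subst lborel.nn_integral_fst[symmetric]) simp_all
    finally show ?thesis .
  qed
  have "emeasure (distr lborel borel ?T) A = (\<integral>\<^sup>+x. indicator A (?T x) \<partial>lborel)"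
    using A T nn_integral_distr[of ?T lborel borel "indicator A"] by simp
  also have "\<dots> = (\<integral>\<^sup>+x1. \<integral>\<^sup>+x2. \<integral>\<^sup>+x3. indicator A (c1 + x1, c2 + x2, (c3 + g (x1, x2)) + x3) \<partial>lborel \<partial>lborel \<partial>lborel)"
    by (subst iter) (simp_all add: ac_simps split_beta')
  also have "\<dots> = (\<integral>\<^sup>+x1. \<integral>\<^sup>+x2. \<integral>\<^sup>+x3. indicator A (c1 + x1, c2 + x2, x3) \<partial>lborel \<partial>lborel \<partial>lborel)"
    by (intro nn_integral_cong nn_integral_lborel_translate[of "\<lambda>t. indicator A (_, _, t)"]) simp
  also have "\<dots> = (\<integral>\<^sup>+x1. \<integral>\<^sup>+x2. \<integral>\<^sup>+x3. indicator A (c1 + x1, x2, x3) \<partial>lborel \<partial>lborel \<partial>lborel)"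
    by (intro nn_integral_cong nn_integral_lborel_translate[of "\<lambda>s. \<integral>\<^sup>+x3. indicator A (_, s, x3) \<partial>lborel"]) simp
  also have "\<dots> = (\<integral>\<^sup>+x1. \<integral>\<^sup>+x2. \<integral>\<^sup>+x3. indicator A (x1, x2, x3) \<partial>lborel \<partial>lborel \<partial>lborel)"
    by (intro nn_integral_lborel_translate[of "\<lambda>s. \<integral>\<^sup>+x2. \<integral>\<^sup>+x3. indicator A (s, x2, x3) \<partial>lborel \<partial>lborel"]) simp
  also have "\<dots> = (\<integral>\<^sup>+x. indicator A x \<partial>lborel)"
    by (subst iter) simp_all
  finally show "emeasure (distr lborel borel ?T) A = emeasure lborel A"
    using A by simp
qed simp

text \<open>A map preserving the Borel measure pulls null sets back to null sets, hence it is
  compatible with the completion.\<close>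

lemma lebesgue_measure_preserving:
  fixes T :: "'a::euclidean_space \<Rightarrow> 'a"
  assumes T: "T \<in> borel_measurable borel" and distr: "distr lborel borel T = lborel"
  shows "T \<in> lebesgue \<rightarrow>\<^sub>M lebesgue" and "distr lebesgue lebesgue T = lebesgue"
proof -
  have T': "T \<in> lborel \<rightarrow>\<^sub>M lborel" "T \<in> lebesgue \<rightarrow>\<^sub>M lborel"
    using T by (auto intro: measurable_completion)
  have "distr lebesgue lborel T = distr lborel borel T"
    using distr_completion[OF T'(1)] by (simp cong: distr_cong)
  then have eq: "distr lebesgue lborel T = lborel"
    using distr by simp
  show "T \<in> lebesgue \<rightarrow>\<^sub>M lebesgue"
    by (rule completion.measurable_completion2[OF T'(2)]) (simp add: eq)
  show "distr lebesgue lebesgue T = lebesgue"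
    using completion.completion_distr_eq[OF T'(2)] by (simp add: eq)
qed

lemma
  fixes f :: "'a::euclidean_space \<Rightarrow> 'b::{banach, second_countable_topology}" and T :: "'a \<Rightarrow> 'a"
  assumes T: "T \<in> borel_measurable borel" "distr lborel borel T = lborel"
    and f: "f \<in> borel_measurable lebesgue"
  shows borel_measurable_compose_preserving: "(\<lambda>x. f (T x)) \<in> borel_measurable lebesgue"
    and integrable_compose_preserving: "integrable lebesgue (\<lambda>x. f (T x)) \<longleftrightarrow> integrable lebesgue f"
    and integral_compose_preserving: "(\<integral>x. f (T x) \<partial>lebesgue) = (\<integral>x. f x \<partial>lebesgue)"
proof -
  note p = lebesgue_measure_preserving[OF T]
  show "(\<lambda>x. f (T x)) \<in> borel_measurable lebesgue"
    using p(1) f by (rule measurable_compose)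
  show "integrable lebesgue (\<lambda>x. f (T x)) \<longleftrightarrow> integrable lebesgue f"
    using integrable_distr_eq[OF p(1) f] p(2) by simp
  show "(\<integral>x. f (T x) \<partial>lebesgue) = (\<integral>x. f x \<partial>lebesgue)"
    using integral_distr[OF p(1) f] p(2) by simp
qed

section \<open>Left translations and horizontal fields\<close>

text \<open>The differential of the left translation by \<open>c\<close>; it is the same at every
  point because that translation is affine.\<close>

definition hlin :: "'n::finite heis \<Rightarrow> 'n heis \<Rightarrow> 'n heis" where
  "hlin c = (\<lambda>(x1, x2, x3). (x1, x2, x3 + (fst c \<bullet> x2 - fst (snd c) \<bullet> x1) / 2))"

lemma linear_hlin: "linear (hlin c)"
  by (rule linearI) (auto simp: hlin_def inner_simps algebra_simps add_divide_distrib diff_divide_distrib)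

lemma hmul_eq: "hmul c x = c + hlin c x"
  by (auto simp: hmul_def hlin_def split_beta prod_eq_iff)

text \<open>The antisymmetric term of the group law vanishes on the pair \<open>c\<close>,
  \<open>- c\<close>, so the additive inverse is also the group inverse.\<close>

lemma hmul_minus_cancel [simp]: "hmul (- c) (hmul c x) = x" "hmul c (hmul (- c) x) = x"
  by (auto simp: hmul_def split_beta prod_eq_iff inner_simps inner_commute field_simps)

text \<open>Left invariance of the fields, the reason why horizontal gradients commute with left
  translations.\<close>

lemma hlin_hfield: "hlin c (hfield j x) = hfield j (hmul c x)"
  by (cases j) (auto simp: hlin_def hmul_def hfield_def split_beta inner_axis field_simps)

lemma hmul_preserves:
  fixes c :: "'n::finite heis"
  shows "hmul c \<in> borel_measurable borel" "distr lborel borel (hmul c) = lborel"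
proof -
  let ?g = "\<lambda>x :: (real^'n) \<times> (real^'n). (fst c \<bullet> snd x - fst (snd c) \<bullet> fst x) / 2"
  have g: "?g \<in> borel_measurable borel"
    by (intro borel_measurable_continuous_onI continuous_intros) simp_all
  have eq: "hmul c = (\<lambda>(x1, x2, x3). (fst c + x1, fst (snd c) + x2, snd (snd c) + x3 + ?g (x1, x2)))"
    by (auto simp: hmul_def split_beta)
  show "hmul c \<in> borel_measurable borel" "distr lborel borel (hmul c) = lborel"
    unfolding eq by (rule borel_measurable_shear[OF g], rule lborel_distr_shear[OF g])
qed

text \<open>The vertical coefficient of the field depends only on the conjugate horizontal
  coordinate, which does not change along the field. Hence the straight lines
  \<open>x + s *\<^sub>R hfield j x\<close> are its integral curves, and the time \<open>- s\<close>
  map inverts the time \<open>s\<close> map.\<close>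

lemma hfield_flow: "hfield j (x + s *\<^sub>R hfield j x) = hfield j x"
  by (cases j) (auto simp: hfield_def split_beta)

lemma hfield_flow_preserves:
  fixes j :: "'n::finite + 'n"
  shows "(\<lambda>x. x + s *\<^sub>R hfield j x) \<in> borel_measurable borel" (is ?A)
    and "distr lborel borel (\<lambda>x. x + s *\<^sub>R hfield j x) = lborel" (is ?B)
proof -
  obtain c1 c2 :: "real^'n" and g :: "(real^'n) \<times> (real^'n) \<Rightarrow> real"
    where g: "continuous_on UNIV g"
      and eq: "(\<lambda>x. x + s *\<^sub>R hfield j x) = (\<lambda>(x1, x2, x3). (c1 + x1, c2 + x2, 0 + x3 + g (x1, x2)))"
  proof (cases j)
    case (Inl i)
    show ?thesis
      by (rule that[of "\<lambda>x. - s * (snd x $ i) / 2" "s *\<^sub>R axis i 1" 0])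
        (auto simp: hfield_def Inl split_beta intro!: continuous_intros)
  next
    case (Inr i)
    show ?thesis
      by (rule that[of "\<lambda>x. s * (fst x $ i) / 2" 0 "s *\<^sub>R axis i 1"])
        (auto simp: hfield_def Inr split_beta intro!: continuous_intros)
  qed
  have g': "g \<in> borel_measurable borel"
    using g by (rule borel_measurable_continuous_onI)
  show ?A ?B
    unfolding eq by (rule borel_measurable_shear[OF g'], rule lborel_distr_shear[OF g'])
qed

lemma continuous_hfield: "continuous_on S (hfield j :: 'n::finite heis \<Rightarrow> 'n heis)"
proof (cases j)
  case (Inl i)
  then have "hfield j = (\<lambda>x :: 'n heis. (axis i 1, 0, - (fst (snd x) $ i) / 2))"
    by (auto simp: hfield_def)
  then show ?thesis by (auto intro!: continuous_intros)
next
  case (Inr i)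
  then have "hfield j = (\<lambda>x :: 'n heis. (0, axis i 1, fst x $ i / 2))"
    by (auto simp: hfield_def)
  then show ?thesis by (auto intro!: continuous_intros)
qed

lemma X_classical_continuous:
  assumes "Ck (Suc 0) \<phi>"
  shows "continuous_on UNIV (X_classical j \<phi>)"
proof -
  have "X_classical j \<phi> x = (\<Sum>b\<in>Basis. (hfield j x \<bullet> b) * frechet_derivative \<phi> (at x) b)" for x
  proof -
    interpret linear "frechet_derivative \<phi> (at x)"
      using Ck_SucD(1)[OF assms] by (rule has_derivative_linear)
    have "X_classical j \<phi> x = frechet_derivative \<phi> (at x) (\<Sum>b\<in>Basis. (hfield j x \<bullet> b) *\<^sub>R b)"
      by (simp add: euclidean_representation X_classical_def)
    also have "\<dots> = (\<Sum>b\<in>Basis. (hfield j x \<bullet> b) * frechet_derivative \<phi> (at x) b)"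
      by (simp add: sum scale)
    finally show ?thesis .
  qed
  then show ?thesis
    using Ck_SucD(2)[OF assms]
    by (auto intro!: continuous_intros continuous_hfield)
qed

lemma X_classical_add:
  assumes "Ck (Suc 0) \<phi>" "Ck (Suc 0) \<psi>"
  shows "X_classical j (\<lambda>x. \<phi> x + \<psi> x) x = X_classical j \<phi> x + X_classical j \<psi> x"
  using frechet_derivative_at[OF has_derivative_add[OF Ck_SucD(1)[OF assms(1)] Ck_SucD(1)[OF assms(2)]], of x, symmetric]
  by (simp add: X_classical_def)

lemma X_classical_mult:
  assumes "Ck (Suc 0) \<phi>" "Ck (Suc 0) \<psi>"
  shows "X_classical j (\<lambda>x. \<phi> x * \<psi> x) x = \<phi> x * X_classical j \<psi> x + X_classical j \<phi> x * \<psi> x"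
  using frechet_derivative_at[OF has_derivative_mult[OF Ck_SucD(1)[OF assms(1)] Ck_SucD(1)[OF assms(2)]], of x, symmetric]
  by (simp add: X_classical_def)

lemma X_classical_0: "X_classical j (\<lambda>x. 0) x = 0"
  by (simp add: X_classical_def)

lemma X_classical_hmul:
  assumes "Ck (Suc 0) \<phi>"
  shows "X_classical j (\<lambda>x. \<phi> (hmul c x)) x = X_classical j \<phi> (hmul c x)"
proof -
  have "((\<lambda>x. c + hlin c x) has_derivative hlin c) (at x)"
    by (auto intro!: derivative_eq_intros linear_imp_has_derivative linear_hlin)
  from diff_chain_at[OF this Ck_SucD(1)[OF assms]]
  have "((\<lambda>x. \<phi> (hmul c x)) has_derivative (\<lambda>v. frechet_derivative \<phi> (at (hmul c x)) (hlin c v))) (at x)"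
    by (simp add: o_def hmul_eq)
  from frechet_derivative_at[OF this, symmetric] show ?thesis
    by (simp add: X_classical_def hlin_hfield)
qed

lemma X_classical_outside:
  assumes K: "closed K" "\<And>x. x \<notin> K \<Longrightarrow> \<phi> x = 0" and x: "x \<notin> K"
  shows "X_classical j \<phi> x = 0"
proof -
  have "((\<lambda>x. 0) has_derivative (\<lambda>v. 0)) (at x)"
    by simp
  then have "(\<phi> has_derivative (\<lambda>v. 0)) (at x)"
    by (rule has_derivative_transform_within_open[where s="- K"]) (use assms in auto)
  from frechet_derivative_at[OF this, symmetric] show ?thesis
    by (simp add: X_classical_def)
qed

text \<open>The flow \<open>x \<mapsto> x + s X\<^sub>j(x)\<close> of \<open>X\<^sub>j\<close> preserves the measure, so the difference quotients of
  \<open>g\<close> along it have integral zero.\<close>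

lemma integral_X_classical_eq_0:
  assumes g: "g \<in> test_funs (UNIV :: 'n::finite heis set)"
  shows "(\<integral>x. X_classical j g x \<partial>lebesgue) = 0"
proof -
  obtain K where K: "compact K" "\<And>x. x \<notin> K \<Longrightarrow> g x = 0"
    using g by (rule test_funsE) blast
  have Ck: "Ck k g" for k
    using g by (rule test_funs_Ck)
  let ?h = "hfield j :: 'n heis \<Rightarrow> 'n heis" and ?X = "X_classical j g"
  have X0: "?X x = 0" if "x \<notin> K" for x
    using X_classical_outside[OF compact_imp_closed[OF K(1)] K(2) that] .
  have contX: "continuous_on UNIV ?X"
    using X_classical_continuous[OF Ck] .
  have contg: "continuous_on UNIV g"
    using Ck_continuous[OF Ck] .
  have "compact (?X ` K)"
    using K(1) contX by (metis compact_continuous_image continuous_on_subset subset_UNIV)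
  then obtain M where M: "\<And>x. x \<in> K \<Longrightarrow> \<bar>?X x\<bar> \<le> M"
    by (meson bounded_real compact_imp_bounded imageI)
  \<comment> \<open>The set swept out by \<open>K\<close> under the backward flow up to time 1. It
    is compact and contains the supports of all the difference quotients, hence serves for
    domination.\<close>
  define K' where "K' = (\<lambda>(s, y). y - s *\<^sub>R ?h y) ` ({0..1} \<times> K)"
  have K': "compact K'"
    unfolding K'_def using K(1) 
    by (intro compact_continuous_image compact_Times)
      (auto simp: split_beta intro!: continuous_intros continuous_on_compose2[OF continuous_hfield])
  have K'I: "x \<in> K'" if "x + s *\<^sub>R ?h x \<in> K" "0 \<le> s" "s \<le> 1" for x s
    unfolding K'_def using that by (intro image_eqI[of _ _ "(s, x + s *\<^sub>R ?h x)"]) (auto simp: hfield_flow)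
  have deriv: "((\<lambda>s. g (x + s *\<^sub>R ?h x)) has_real_derivative ?X (x + s *\<^sub>R ?h x)) (at s)" for x s
  proof -
    have "((\<lambda>s. x + s *\<^sub>R ?h x) has_derivative (\<lambda>t. t *\<^sub>R ?h x)) (at s)"
      by (auto intro!: derivative_eq_intros)
    from diff_chain_at[OF this Ck_SucD(1)[OF Ck]]
    have "((\<lambda>s. g (x + s *\<^sub>R ?h x)) has_derivative
        (\<lambda>t. frechet_derivative g (at (x + s *\<^sub>R ?h x)) (t *\<^sub>R ?h x))) (at s)"
      by (simp add: o_def)
    moreover have "frechet_derivative g (at (x + s *\<^sub>R ?h x)) (t *\<^sub>R ?h x) = ?X (x + s *\<^sub>R ?h x) * t" for t
      by (simp add: X_classical_def hfield_flow linear_cmul[OF has_derivative_linear[OF Ck_SucD(1)[OF Ck]]])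
    ultimately show ?thesis
      by (simp add: has_field_derivative_def)
  qed
  define r where "r n = inverse (real (Suc n))" for n
  have r: "0 < r n" "r n \<le> 1" for n
    by (auto simp: r_def field_simps)
  let ?F = "\<lambda>n x. (g (x + r n *\<^sub>R ?h x) - g x) / r n"
  \<comment> \<open>By the mean value theorem the quotient is a value of
    \<open>X_classical j g\<close> at an intermediate point of the flow line, which is either in
    \<open>K\<close>, where \<open>M\<close> bounds it, or gives 0.\<close>
  have bound: "\<bar>?F n x\<bar> \<le> M * indicator K' x" for n x
  proof -
    have "\<exists>z>0. z < r n \<and> g (x + r n *\<^sub>R ?h x) - g (x + 0 *\<^sub>R ?h x) = (r n - 0) * ?X (x + z *\<^sub>R ?h x)"
      using MVT2[of 0 "r n" "\<lambda>s. g (x + s *\<^sub>R ?h x)" "\<lambda>s. ?X (x + s *\<^sub>R ?h x)"] r[of n] deriv by blast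
    then obtain z where z: "0 < z" "z < r n" "?F n x = ?X (x + z *\<^sub>R ?h x)"
      using r[of n] by auto
    show ?thesis
    proof (cases "x + z *\<^sub>R ?h x \<in> K")
      case True
      with z r[of n] have "x \<in> K'"
        by (intro K'I[of x z]) auto
      then show ?thesis
        using M[OF True] z(3) by simp
    next
      case False
      then have "?F n x = 0"
        using z(3) X0 by simp
      \<comment> \<open>If \<open>K\<close> is empty, \<open>M\<close> may be negative; but a point
        of \<open>K'\<close> comes from a point of \<open>K\<close>.\<close>
      moreover have "0 \<le> M * indicator K' x"
      proof (cases "x \<in> K'")
        case True
        then have "K \<noteq> {}" by (auto simp: K'_def)
        then show ?thesis using M True by (metis abs_ge_zero equals0I indicator_simps(1) mult.right_neutral order_trans)
      qed simp
      ultimately show ?thesis by (metis abs_zero)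
    qed
  qed
  have meas: "f \<in> borel_measurable lebesgue" if "continuous_on UNIV f" for f :: "'n heis \<Rightarrow> real"
    using that by (intro measurable_completion) (simp add: borel_measurable_continuous_onI)
  have contF: "continuous_on UNIV (?F n)" for n
    using r[of n] by (auto intro!: continuous_intros continuous_on_compose2[OF contg] continuous_hfield)
  have "(\<lambda>n. \<integral>x. ?F n x \<partial>lebesgue) \<longlonglongrightarrow> (\<integral>x. ?X x \<partial>lebesgue)"
  proof (rule integral_dominated_convergence)
    show "integrable lebesgue (\<lambda>x. M * indicator K' x)"
      using K' by (intro integrable_mult_right integrable_real_indicator)
        (use emeasure_compact_finite[OF K'] in \<open>auto simp: compact_imp_closed less_top\<close>)
    show "AE x in lebesgue. (\<lambda>n. ?F n x) \<longlonglongrightarrow> ?X x"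
    proof (intro always_eventually allI)
      fix x
      have "((\<lambda>s. (g (x + s *\<^sub>R ?h x) - g x) / s) \<longlongrightarrow> ?X x) (at 0)"
        using deriv[of x 0] by (simp add: DERIV_def)
      moreover have "filterlim r (at 0) sequentially"
        unfolding r_def using LIMSEQ_inverse_real_of_nat by (auto simp: filterlim_at)
      ultimately show "(\<lambda>n. ?F n x) \<longlonglongrightarrow> ?X x"
        by (rule filterlim_compose)
    qed
    show "AE x in lebesgue. norm (?F n x) \<le> M * indicator K' x" for n
      using bound by auto
  qed (use contX contF meas in auto)
  moreover have "(\<integral>x. ?F n x \<partial>lebesgue) = 0" for n
  proof -
    have "compact (g ` K)"
      using K(1) contg by (metis compact_continuous_image continuous_on_subset subset_UNIV)
    then obtain B where "\<And>x. x \<in> K \<Longrightarrow> \<bar>g x\<bar> \<le> B"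
      by (meson bounded_real compact_imp_bounded imageI)
    then have int: "integrable lebesgue g"
      using K contg meas emeasure_compact_finite[OF K(1)]
      by (intro integrableI_bounded_set[where A=K and B=B]) (auto simp: compact_imp_closed)
    have "integrable lebesgue (\<lambda>x. g (x + r n *\<^sub>R ?h x))"
      "(\<integral>x. g (x + r n *\<^sub>R ?h x) \<partial>lebesgue) = (\<integral>x. g x \<partial>lebesgue)"
      using integrable_compose_preserving[OF hfield_flow_preserves meas[OF contg]] int
        integral_compose_preserving[OF hfield_flow_preserves meas[OF contg]] by auto
    with int show ?thesis by simp
  qed
  ultimately have "(\<lambda>n. 0) \<longlonglongrightarrow> (\<integral>x. ?X x \<partial>lebesgue)"
    by (simp only:)
  then show ?thesis
    by (simp add: LIMSEQ_const_iff)
qed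

section \<open>Weak horizontal derivatives\<close>

lemma norm_add_powr_le:
  assumes "\<alpha> \<ge> 0"
  shows "norm (a + b) powr \<alpha> \<le> 2 powr \<alpha> * (norm a powr \<alpha> + norm b powr \<alpha>)"
proof -
  let ?m = "max (norm a) (norm b)"
  have "norm (a + b) \<le> 2 * ?m"
    using norm_triangle_ineq[of a b] by linarith
  then have "norm (a + b) powr \<alpha> \<le> (2 * ?m) powr \<alpha>"
    using assms by (intro powr_mono2) auto
  also have "\<dots> = 2 powr \<alpha> * ?m powr \<alpha>"
    by (simp add: powr_mult)
  also have "\<dots> \<le> 2 powr \<alpha> * (norm a powr \<alpha> + norm b powr \<alpha>)"
    by (intro mult_left_mono) (auto simp: max_def)
  finally show ?thesis .
qed

lemma integrable_norm_powr_mono: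
  assumes "\<alpha> \<ge> 0" "integrable M (\<lambda>x. norm (g x) powr \<alpha>)" "f \<in> borel_measurable M"
    and "\<And>x. norm (f x) \<le> norm (g x)"
  shows "integrable M (\<lambda>x. norm (f x) powr \<alpha>)"
  by (rule Bochner_Integration.integrable_bound[OF assms(2)])
    (use assms in \<open>auto intro!: powr_mono2 powr_real_measurable\<close>)

lemma integrable_norm_powr_add:
  assumes "\<alpha> \<ge> 0" "f \<in> borel_measurable M" "g \<in> borel_measurable M"
    and "integrable M (\<lambda>x. norm (f x) powr \<alpha>)" "integrable M (\<lambda>x. norm (g x) powr \<alpha>)"
    and "(\<lambda>x. f x + g x) \<in> borel_measurable M"
  shows "integrable M (\<lambda>x. norm (f x + g x) powr \<alpha>)"
proof (rule Bochner_Integration.integrable_bound)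
  show "integrable M (\<lambda>x. 2 powr \<alpha> * (norm (f x) powr \<alpha> + norm (g x) powr \<alpha>))"
    using assms by auto
  show "AE x in M. norm (norm (f x + g x) powr \<alpha>) \<le> norm (2 powr \<alpha> * (norm (f x) powr \<alpha> + norm (g x) powr \<alpha>))"
    using norm_add_powr_le[OF assms(1)] by (auto simp: abs_mult)
qed (use assms in \<open>auto intro!: powr_real_measurable\<close>)

text \<open>If t > \<eta>, the factor (t/\<eta>)^(\<alpha>-1) is at least 1. This replaces the
  Hoelder inequality on sets of finite measure: \<eta> = 1 gives local integrability, and small
  \<eta> gives the passage to the limit in weak derivatives.\<close>

lemma le_add_powr:
  assumes "t \<ge> 0" "\<eta> > 0" "\<alpha> \<ge> 1"
  shows "t \<le> \<eta> + \<eta> powr (1 - \<alpha>) * t powr (\<alpha> :: real)"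
proof (cases "t \<le> \<eta>")
  case False
  with assms have t: "t > 0" "1 \<le> t / \<eta>" by auto
  have "t * 1 \<le> t * (t / \<eta>) powr (\<alpha> - 1)"
    using t assms by (intro mult_left_mono ge_one_powr_ge_zero) auto
  also have "\<dots> = \<eta> powr (1 - \<alpha>) * t powr \<alpha>"
    using t assms by (simp add: powr_divide powr_diff field_simps)
  finally show ?thesis using assms by simp
qed (use assms in \<open>simp add: add_increasing2\<close>)

lemma measurable_lebesgue_continuous:
  fixes f :: "'a::euclidean_space \<Rightarrow> 'b::topological_space"
  shows "continuous_on UNIV f \<Longrightarrow> f \<in> borel_measurable lebesgue"
  by (intro measurable_completion) (simp add: borel_measurable_continuous_onI)

lemma bounded_continuous_compact_support:
  fixes f :: "'a::euclidean_space \<Rightarrow> 'b::real_normed_vector"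
  assumes "continuous_on UNIV f" "compact K" "\<And>x. x \<notin> K \<Longrightarrow> f x = 0"
  obtains B where "B \<ge> 0" "\<And>x. norm (f x) \<le> B"
proof -
  have "compact (f ` K)"
    using compact_continuous_image[OF continuous_on_subset[OF assms(1) subset_UNIV] assms(2)] .
  then have "bounded (f ` K)"
    by (rule compact_imp_bounded)
  then obtain B where B: "B > 0" "\<And>x. x \<in> K \<Longrightarrow> norm (f x) \<le> B"
    by (auto simp: bounded_pos)
  have "norm (f x) \<le> B" for x
    using B assms(3)[of x] by (cases "x \<in> K") auto
  with B(1) show ?thesis
    by (intro that[of B]) auto
qed

lemma integrable_continuous_compact_support:
  fixes f :: "'a::euclidean_space \<Rightarrow> 'b::euclidean_space"
  assumes "continuous_on UNIV f" "compact K" "\<And>x. x \<notin> K \<Longrightarrow> f x = 0"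
  shows "integrable lebesgue f"
proof -
  obtain B where "\<And>x. norm (f x) \<le> B"
    using bounded_continuous_compact_support[OF assms] by metis
  then show ?thesis
    using assms emeasure_compact_finite[OF assms(2)]
    by (intro integrableI_bounded_set[where A=K and B=B] measurable_lebesgue_continuous)
      (auto simp: compact_imp_closed)
qed

lemma loc_integrable_times:
  fixes u :: "'a::euclidean_space \<Rightarrow> real"
  assumes u: "loc_integrable A u" and K: "compact K" "K \<subseteq> A"
    and f: "continuous_on UNIV f" "\<And>x. x \<notin> K \<Longrightarrow> f x = 0"
  shows "integrable lebesgue (\<lambda>x. u x * f x)"
proof -
  obtain B where B: "B \<ge> 0" "\<And>x. norm (f x) \<le> B"
    using bounded_continuous_compact_support[OF f(1) K(1) f(2)] by metis
  have int: "integrable lebesgue (\<lambda>x. indicator K x * u x)"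
    using u K integrable_restrict_space[of K lebesgue u] by (auto simp: loc_integrable_def compact_imp_closed)
  have eq: "u x * f x = (indicator K x * u x) * f x" for x
    using f(2)[of x] by (auto simp: indicator_def)
  show ?thesis
  proof (rule Bochner_Integration.integrable_bound)
    show "integrable lebesgue (\<lambda>x. B * \<bar>indicator K x * u x\<bar>)"
      using int by auto
    show "(\<lambda>x. u x * f x) \<in> borel_measurable lebesgue"
      unfolding eq
      by (rule borel_measurable_times[OF borel_measurable_integrable[OF int] measurable_lebesgue_continuous[OF f(1)]])
    show "AE x in lebesgue. norm (u x * f x) \<le> norm (B * \<bar>indicator K x * u x\<bar>)"
    proof (intro always_eventually allI)
      fix x
      have "norm (u x * f x) = \<bar>indicator K x * u x\<bar> * \<bar>f x\<bar>"
        by (subst eq) (simp add: abs_mult)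
      also have "\<dots> \<le> \<bar>indicator K x * u x\<bar> * B"
        using B(2)[of x] by (intro mult_left_mono) auto
      finally show "norm (u x * f x) \<le> norm (B * \<bar>indicator K x * u x\<bar>)"
        using B(1) by (simp add: abs_mult mult_ac)
    qed
  qed
qed

lemma loc_integrable_continuous:
  assumes "continuous_on UNIV (u :: 'a::euclidean_space \<Rightarrow> real)"
  shows "loc_integrable A u"
  unfolding loc_integrable_def
proof (intro allI impI)
  fix K assume "compact K \<and> K \<subseteq> A"
  then have K: "compact K" by simp
  have "compact (u ` K)"
    using compact_continuous_image[OF continuous_on_subset[OF assms subset_UNIV] K] .
  then have "bounded (u ` K)"
    by (rule compact_imp_bounded)
  then obtain B where "\<And>x. x \<in> K \<Longrightarrow> norm (u x) \<le> B"
    by (auto simp: bounded_pos)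
  then have "integrable lebesgue (\<lambda>x. indicator K x *\<^sub>R u x)"
    using K emeasure_compact_finite[OF K] measurable_lebesgue_continuous[OF assms]
    by (intro integrableI_bounded_set_indicator[where B=B]) (auto simp: compact_imp_closed)
  then show "integrable (lebesgue_on K) u"
    using K by (subst integrable_restrict_space) (auto simp: compact_imp_closed)
qed

lemma loc_integrable_lin:
  "loc_integrable A u \<Longrightarrow> loc_integrable A v \<Longrightarrow> loc_integrable A (\<lambda>x. u x + c * v x)"
  by (simp add: loc_integrable_def)

lemma loc_integrable_if_powr_integrable:
  fixes u :: "'a::euclidean_space \<Rightarrow> real"
  assumes "u \<in> borel_measurable lebesgue" "integrable lebesgue (\<lambda>x. \<bar>u x\<bar> powr \<alpha>)" "\<alpha> \<ge> 1"
  shows "loc_integrable A u"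
  unfolding loc_integrable_def
proof (intro allI impI)
  fix K assume "compact K \<and> K \<subseteq> A"
  then have K: "compact K" by simp
  have "integrable lebesgue (\<lambda>x. indicator K x *\<^sub>R u x)"
  proof (rule Bochner_Integration.integrable_bound)
    show "integrable lebesgue (\<lambda>x. indicator K x + \<bar>u x\<bar> powr \<alpha>)"
      using assms emeasure_compact_finite[OF K] K
      by (intro Bochner_Integration.integrable_add integrable_real_indicator) (auto simp: compact_imp_closed)
    show "AE x in lebesgue. norm (indicator K x *\<^sub>R u x) \<le> norm (indicator K x + \<bar>u x\<bar> powr \<alpha>)"
      using le_add_powr[of _ 1 \<alpha>] assms(3) by (auto simp: indicator_def)
  qed (use assms K in \<open>auto simp: compact_imp_closed intro!: borel_measurable_times borel_measurable_indicator\<close>)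
  then show "integrable (lebesgue_on K) u"
    using K by (subst integrable_restrict_space) (auto simp: compact_imp_closed)
qed

section \<open>Pairing with test functions, uniqueness, and consistency with classical
  derivatives\<close>

lemma test_funsE_X:
  assumes "\<phi> \<in> test_funs (A :: 'n::finite heis set)"
  obtains K where "compact K" "K \<subseteq> A" "\<And>x. x \<notin> K \<Longrightarrow> \<phi> x = 0" "\<And>j x. x \<notin> K \<Longrightarrow> X_classical j \<phi> x = 0"
    "continuous_on UNIV \<phi>" "\<And>j. continuous_on UNIV (X_classical j \<phi>)"
proof -
  obtain K where K: "compact K" "K \<subseteq> A" "\<And>x. x \<notin> K \<Longrightarrow> \<phi> x = 0"
    using assms by (rule test_funsE) blast
  moreover have "X_classical j \<phi> x = 0" if "x \<notin> K" for j x
    using X_classical_outside[OF compact_imp_closed[OF K(1)] K(3) that] .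
  ultimately show ?thesis
    using Ck_continuous[OF test_funs_Ck[OF assms]] X_classical_continuous[OF test_funs_Ck[OF assms]] that by blast
qed

lemma test_funs_UNIV: "\<phi> \<in> test_funs A \<Longrightarrow> \<phi> \<in> test_funs UNIV"
  using test_funs_mono[of A UNIV] by auto

lemma integral_lebesgue_on_eq:
  fixes f :: "'a::euclidean_space \<Rightarrow> real"
  assumes "A \<in> sets lebesgue" "\<And>x. x \<notin> A \<Longrightarrow> f x = 0"
  shows "(\<integral>x. f x \<partial>lebesgue_on A) = (\<integral>x. f x \<partial>lebesgue)"
proof -
  have "(\<integral>x. f x \<partial>lebesgue_on A) = (\<integral>x. indicator A x *\<^sub>R f x \<partial>lebesgue)"
    by (rule integral_restrict_space) (use assms in simp)
  also have "\<dots> = (\<integral>x. f x \<partial>lebesgue)"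
    by (rule Bochner_Integration.integral_cong) (use assms(2) in \<open>auto simp: indicator_def\<close>)
  finally show ?thesis .
qed

text \<open>Test functions on \<open>A\<close> and their derivatives vanish off \<open>A\<close>, so
  all pairings may be taken over the whole group, where translations and zero extensions are easy to
  handle.\<close>

lemma weak_X_iff:
  fixes A :: "'n::finite heis set"
  assumes A: "open A"
  shows "weak_X A j u w \<longleftrightarrow> loc_integrable A u \<and> loc_integrable A w \<and>
     (\<forall>\<phi>\<in>test_funs A. (\<integral>x. u x * X_classical j \<phi> x \<partial>lebesgue) = - (\<integral>x. w x * \<phi> x \<partial>lebesgue))"
proof -
  have "(\<integral>x. u x * X_classical j \<phi> x \<partial>lebesgue_on A) = (\<integral>x. u x * X_classical j \<phi> x \<partial>lebesgue)"
    "(\<integral>x. w x * \<phi> x \<partial>lebesgue_on A) = (\<integral>x. w x * \<phi> x \<partial>lebesgue)" if \<phi>: "\<phi> \<in> test_funs A" for \<phi>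
  proof -
    obtain K where K: "K \<subseteq> A" "\<And>x. x \<notin> K \<Longrightarrow> \<phi> x = 0" "\<And>x. x \<notin> K \<Longrightarrow> X_classical j \<phi> x = 0"
      using \<phi> by (rule test_funsE_X) blast
    then have "u x * X_classical j \<phi> x = 0" "w x * \<phi> x = 0" if "x \<notin> A" for x
      using that by (metis mult_zero_right subsetD)+
    moreover have "A \<in> sets lebesgue"
      using A by simp
    ultimately show "(\<integral>x. u x * X_classical j \<phi> x \<partial>lebesgue_on A) = (\<integral>x. u x * X_classical j \<phi> x \<partial>lebesgue)"
      "(\<integral>x. w x * \<phi> x \<partial>lebesgue_on A) = (\<integral>x. w x * \<phi> x \<partial>lebesgue)"
      by (auto intro!: integral_lebesgue_on_eq)
  qed
  then show ?thesis
    by (simp add: weak_X_def)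
qed

lemma weak_X_integrable:
  assumes "loc_integrable A u" "\<phi> \<in> test_funs (A :: 'n::finite heis set)"
  shows "integrable lebesgue (\<lambda>x. u x * \<phi> x)" "integrable lebesgue (\<lambda>x. u x * X_classical j \<phi> x)"
  using assms(2) by (rule test_funsE_X, blast intro: loc_integrable_times[OF assms(1)])+

lemma weak_X_lin:
  assumes A: "open A" and u: "weak_X A j u w" and v: "weak_X A j v z"
  shows "weak_X A j (\<lambda>x. u x + c * v x) (\<lambda>x. w x + c * z x)"
proof -
  note u' = u[unfolded weak_X_iff[OF A]] and v' = v[unfolded weak_X_iff[OF A]]
  have "(\<integral>x. (u x + c * v x) * X_classical j \<phi> x \<partial>lebesgue) = - (\<integral>x. (w x + c * z x) * \<phi> x \<partial>lebesgue)"
    if \<phi>: "\<phi> \<in> test_funs A" for \<phi>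
  proof -
    have [simp]: "integrable lebesgue (\<lambda>x. u x * X_classical j \<phi> x)" "integrable lebesgue (\<lambda>x. v x * X_classical j \<phi> x)"
        "integrable lebesgue (\<lambda>x. w x * \<phi> x)" "integrable lebesgue (\<lambda>x. z x * \<phi> x)"
      using u' v' \<phi> by (auto intro: weak_X_integrable)
    have "(\<integral>x. (u x + c * v x) * X_classical j \<phi> x \<partial>lebesgue) =
        (\<integral>x. u x * X_classical j \<phi> x \<partial>lebesgue) + c * (\<integral>x. v x * X_classical j \<phi> x \<partial>lebesgue)"
      by (simp add: ring_distribs mult.assoc)
    moreover have "(\<integral>x. (w x + c * z x) * \<phi> x \<partial>lebesgue) =
        (\<integral>x. w x * \<phi> x \<partial>lebesgue) + c * (\<integral>x. z x * \<phi> x \<partial>lebesgue)"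
      by (simp add: ring_distribs mult.assoc)
    ultimately show ?thesis
      using u' v' \<phi> by simp
  qed
  then show ?thesis
    using u' v' by (simp add: weak_X_iff[OF A] loc_integrable_lin)
qed

lemma weak_X_unique:
  assumes A: "open A" and "weak_X A j u w" "weak_X A j u z"
  shows "AE x in lebesgue_on A. w x = z x"
proof -
  have 0: "weak_X A j (\<lambda>x. u x + - 1 * u x) (\<lambda>x. w x + - 1 * z x)"
    using assms by (rule weak_X_lin)
  then have "AE x in lebesgue_on A. w x + - 1 * z x = 0"
    using A by (intro fundamental_lemma_calculus_of_variations) (auto simp: weak_X_def)
  then show ?thesis by eventually_elim simp
qed

text \<open>The product of \<open>u\<close> and \<phi> is itself a test function, so
  \<open>integral_X_classical_eq_0\<close> applies to it and the Leibniz rule splits the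
  integral.\<close>

lemma integration_by_parts_X:
  assumes u: "\<And>k. Ck k u" and \<phi>: "\<phi> \<in> test_funs (A :: 'n::finite heis set)"
  shows "(\<integral>x. u x * X_classical j \<phi> x \<partial>lebesgue) = - (\<integral>x. X_classical j u x * \<phi> x \<partial>lebesgue)"
proof -
  have "loc_integrable A u" "loc_integrable A (X_classical j u)"
    by (intro loc_integrable_continuous Ck_continuous[OF u] X_classical_continuous[OF u])+
  note int = weak_X_integrable(2)[OF this(1) \<phi>] weak_X_integrable(1)[OF this(2) \<phi>]
  have "(\<integral>x. X_classical j (\<lambda>x. u x * \<phi> x) x \<partial>lebesgue) = 0"
    by (intro integral_X_classical_eq_0 test_funs_mult_Ck u test_funs_UNIV[OF \<phi>])
  then show ?thesis
    using int by (simp add: X_classical_mult[OF u test_funs_Ck[OF \<phi>]])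
qed

lemma weak_X_Ck:
  assumes A: "open A" and u: "\<And>k. Ck k u"
  shows "weak_X A j u (X_classical j u)"
  using integration_by_parts_X[OF u]
  by (auto simp: weak_X_iff[OF A] intro!: loc_integrable_continuous Ck_continuous[OF u] X_classical_continuous[OF u])

lemma weak_X_hgrad:
  assumes "weak_X A j u w"
  shows "weak_X A j u (\<lambda>x. hgrad A u x $ j)"
proof -
  have "weak_X A j u (SOME w. weak_X A j u w)"
    using someI[where P="weak_X A j u", OF assms] .
  then show ?thesis by (simp add: hgrad_def)
qed

text \<open>The bridge from the representatives chosen in \<open>hgrad\<close> to an explicit
  gradient; energies and norms see no more than almost everywhere equality.\<close>

lemma hgrad_AE_eq:
  assumes A: "open A" and w: "\<And>j. weak_X A j u (\<lambda>x. w x $ j)"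
  shows "AE x in lebesgue_on A. hgrad A u x = w x"
proof -
  have "AE x in lebesgue_on A. \<forall>j\<in>UNIV. hgrad A u x $ j = w x $ j"
    by (rule AE_finite_allI) (auto intro: weak_X_unique[OF A weak_X_hgrad[OF w] w])
  then show ?thesis by eventually_elim (simp add: vec_eq_iff)
qed

section \<open>Closure of the test functions in the jet norm\<close>

definition jet :: "('n::finite heis \<Rightarrow> real) \<Rightarrow> 'n heis \<Rightarrow> real \<times> 'n horiz" where
  "jet \<phi> x = (\<phi> x, \<chi> j. X_classical j \<phi> x)"

text \<open>The pairs \<open>(u, \<nabla>u)\<close> for \<open>u\<close> in the closure of the test functions on \<open>A\<close>, extended by zero
  to the whole group.\<close>

definition W0_jets :: "real \<Rightarrow> 'n::finite heis set \<Rightarrow> ('n heis \<Rightarrow> real \<times> 'n horiz) set" where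
  "W0_jets \<alpha> A = {F \<in> borel_measurable lebesgue. (\<forall>x. x \<notin> A \<longrightarrow> F x = 0) \<and>
     integrable lebesgue (\<lambda>x. norm (F x) powr \<alpha>) \<and>
     (\<forall>\<epsilon>>0. \<exists>\<phi>\<in>test_funs A. (\<integral>x. norm (F x - jet \<phi> x) powr \<alpha> \<partial>lebesgue) < \<epsilon>)}"

lemma jet_test_fun:
  assumes "\<phi> \<in> test_funs (A :: 'n::finite heis set)"
  obtains K where "compact K" "K \<subseteq> A" "continuous_on UNIV (jet \<phi>)" "\<And>x. x \<notin> K \<Longrightarrow> jet \<phi> x = 0"
proof -
  obtain K where K: "compact K" "K \<subseteq> A" "\<And>x. x \<notin> K \<Longrightarrow> \<phi> x = 0" "\<And>j x. x \<notin> K \<Longrightarrow> X_classical j \<phi> x = 0"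
    "continuous_on UNIV \<phi>" "\<And>j. continuous_on UNIV (X_classical j \<phi>)"
    using assms by (rule test_funsE_X) blast
  have "continuous_on UNIV (jet \<phi>)"
    unfolding jet_def using K(5,6) by (auto intro!: continuous_intros)
  moreover have "jet \<phi> x = 0" if "x \<notin> K" for x
    using K(3,4)[OF that] by (simp add: jet_def zero_prod_def vec_eq_iff)
  ultimately show ?thesis
    using K(1,2) that by blast
qed

lemma jet_measurable: "\<phi> \<in> test_funs A \<Longrightarrow> jet \<phi> \<in> borel_measurable lebesgue"
  by (elim jet_test_fun) (rule measurable_lebesgue_continuous)

lemma jet_powr_integrable:
  assumes "\<phi> \<in> test_funs A" "\<alpha> > 0"
  shows "integrable lebesgue (\<lambda>x. norm (jet \<phi> x) powr \<alpha>)"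
  using assms(1)
proof (rule jet_test_fun)
  fix K assume K: "compact K" "continuous_on UNIV (jet \<phi>)" "\<And>x. x \<notin> K \<Longrightarrow> jet \<phi> x = 0"
  then show ?thesis
    using assms(2) by (intro integrable_continuous_compact_support[OF _ K(1)] continuous_on_powr' continuous_intros) auto
qed

lemma jet_0: "jet (\<lambda>x. 0) x = 0"
  by (simp add: jet_def X_classical_0 zero_prod_def vec_eq_iff)

lemma jet_add:
  assumes "\<phi> \<in> test_funs A" "\<psi> \<in> test_funs B"
  shows "jet (\<lambda>x. \<phi> x + \<psi> x) x = jet \<phi> x + jet \<psi> x"
  by (simp add: jet_def X_classical_add[OF test_funs_Ck[OF assms(1)] test_funs_Ck[OF assms(2)]] vec_eq_iff)

lemma jet_hmul:
  assumes "\<phi> \<in> test_funs A"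
  shows "jet (\<lambda>x. \<phi> (hmul c x)) x = jet \<phi> (hmul c x)"
  by (simp add: jet_def X_classical_hmul[OF test_funs_Ck[OF assms]])

lemma test_funs_hmul:
  assumes \<phi>: "\<phi> \<in> test_funs (A :: 'n::finite heis set)" and B: "\<And>x. x \<in> A \<Longrightarrow> hmul c x \<in> B"
  shows "(\<lambda>x. \<phi> (hmul (- c) x)) \<in> test_funs B"
proof -
  obtain K where K: "compact K" "K \<subseteq> A" "\<And>x. x \<notin> K \<Longrightarrow> \<phi> x = 0"
    using \<phi> by (rule test_funsE) blast
  have "continuous_on K (hmul c)"
    unfolding hmul_eq by (intro continuous_intros linear_continuous_on linear_hlin linear_conv_bounded_linear[THEN iffD1])
  then have "compact (hmul c ` K)"
    using K(1) by (rule compact_continuous_image)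
  moreover have "hmul c ` K \<subseteq> B"
    using K(2) B by auto
  moreover have "\<phi> (hmul (- c) x) = 0" if "x \<notin> hmul c ` K" for x
    using that K(3)[of "hmul (- c) x"] by (metis hmul_minus_cancel(2) image_eqI)
  moreover have "Ck k (\<lambda>x. \<phi> (hmul (- c) x))" for k
    unfolding hmul_eq by (intro Ck_affine linear_hlin test_funs_Ck[OF \<phi>])
  ultimately show ?thesis
    by (intro test_funsI)
qed

lemma W0_jetsD:
  assumes "F \<in> W0_jets \<alpha> A"
  shows "F \<in> borel_measurable lebesgue" "\<And>x. x \<notin> A \<Longrightarrow> F x = 0"
    "integrable lebesgue (\<lambda>x. norm (F x) powr \<alpha>)"
  using assms by (auto simp: W0_jets_def)

lemma W0_jets_approx:
  assumes "F \<in> W0_jets \<alpha> A" "\<epsilon> > 0"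
  obtains \<phi> where "\<phi> \<in> test_funs A" "(\<integral>x. norm (F x - jet \<phi> x) powr \<alpha> \<partial>lebesgue) < \<epsilon>"
  using assms by (auto simp: W0_jets_def)

lemma W0_jets_diff_integrable:
  assumes F: "F \<in> W0_jets \<alpha> A" and \<phi>: "\<phi> \<in> test_funs B" and \<alpha>: "\<alpha> > 0"
  shows "integrable lebesgue (\<lambda>x. norm (F x - jet \<phi> x) powr \<alpha>)"
proof -
  have "integrable lebesgue (\<lambda>x. norm (F x + - jet \<phi> x) powr \<alpha>)"
    using \<alpha> W0_jetsD[OF F] jet_measurable[OF \<phi>] jet_powr_integrable[OF \<phi> \<alpha>]
    by (intro integrable_norm_powr_add) auto
  then show ?thesis by simp
qed

lemma W0_jets_0: "(\<lambda>x. 0) \<in> W0_jets \<alpha> A"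
  by (auto simp: W0_jets_def jet_0 intro!: bexI[OF _ test_funs_0])

lemma W0_jets_add:
  assumes F: "F \<in> W0_jets \<alpha> A" and G: "G \<in> W0_jets \<alpha> A" and \<alpha>: "\<alpha> > 0"
  shows "(\<lambda>x. F x + G x) \<in> W0_jets \<alpha> A"
proof -
  note F' = W0_jetsD[OF F] and G' = W0_jetsD[OF G]
  have meas: "(\<lambda>x. F x + G x) \<in> borel_measurable lebesgue"
    using F'(1) G'(1) by (rule borel_measurable_add)
  have "\<exists>\<phi>\<in>test_funs A. (\<integral>x. norm (F x + G x - jet \<phi> x) powr \<alpha> \<partial>lebesgue) < \<epsilon>" if \<epsilon>: "\<epsilon> > 0" for \<epsilon>
  proof -
    define \<delta> where "\<delta> = \<epsilon> / (2 * 2 powr \<alpha>)"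
    have \<delta>: "\<delta> > 0" using \<epsilon> by (simp add: \<delta>_def)
    obtain \<phi> where \<phi>: "\<phi> \<in> test_funs A" "(\<integral>x. norm (F x - jet \<phi> x) powr \<alpha> \<partial>lebesgue) < \<delta>"
      using W0_jets_approx[OF F \<delta>] .
    obtain \<psi> where \<psi>: "\<psi> \<in> test_funs A" "(\<integral>x. norm (G x - jet \<psi> x) powr \<alpha> \<partial>lebesgue) < \<delta>"
      using W0_jets_approx[OF G \<delta>] .
    note int = W0_jets_diff_integrable[OF F \<phi>(1) \<alpha>] W0_jets_diff_integrable[OF G \<psi>(1) \<alpha>]
    let ?D = "\<lambda>x. F x + G x - jet (\<lambda>x. \<phi> x + \<psi> x) x"
    have D: "?D x = (F x - jet \<phi> x) + (G x - jet \<psi> x)" for x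
      by (simp add: jet_add[OF \<phi>(1) \<psi>(1)])
    have "(\<integral>x. norm (?D x) powr \<alpha> \<partial>lebesgue) \<le>
        (\<integral>x. 2 powr \<alpha> * (norm (F x - jet \<phi> x) powr \<alpha> + norm (G x - jet \<psi> x) powr \<alpha>) \<partial>lebesgue)"
      unfolding D
    proof (rule integral_mono)
      show "integrable lebesgue (\<lambda>x. norm (F x - jet \<phi> x + (G x - jet \<psi> x)) powr \<alpha>)"
        using \<alpha> int F' G' jet_measurable[OF \<phi>(1)] jet_measurable[OF \<psi>(1)]
        by (intro integrable_norm_powr_add borel_measurable_add borel_measurable_diff) auto
    qed (use int \<alpha> in \<open>auto intro!: norm_add_powr_le simp del: split_paired_All\<close>)
    also have "\<dots> < 2 powr \<alpha> * (\<delta> + \<delta>)"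
      using int \<phi>(2) \<psi>(2) by (simp add: add_strict_mono)
    also have "\<dots> = \<epsilon>"
      by (simp add: \<delta>_def)
    finally show ?thesis
      using test_funs_add[OF \<phi>(1) \<psi>(1)] by auto
  qed
  moreover have "integrable lebesgue (\<lambda>x. norm (F x + G x) powr \<alpha>)"
    using \<alpha> F' G' meas by (intro integrable_norm_powr_add) auto
  ultimately show ?thesis
    using meas F'(2) G'(2) by (auto simp: W0_jets_def)
qed

lemma W0_jets_sum:
  assumes "\<And>i. i \<in> I \<Longrightarrow> F i \<in> W0_jets \<alpha> A" "\<alpha> > 0"
  shows "(\<lambda>x. \<Sum>i\<in>I. F i x) \<in> W0_jets \<alpha> A"
  using assms(1) by (induction I rule: infinite_finite_induct) (auto intro: W0_jets_0 W0_jets_add[OF _ _ assms(2)])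

text \<open>By left invariance the jet of a translate is the translate of the jet, and translations
  preserve the measure, so the approximation error is unchanged.\<close>

lemma W0_jets_hmul:
  assumes F: "F \<in> W0_jets \<alpha> A" and \<alpha>: "\<alpha> > 0" and B: "\<And>x. x \<in> A \<Longrightarrow> hmul c x \<in> B"
  shows "(\<lambda>x. F (hmul (- c) x)) \<in> W0_jets \<alpha> B"
proof -
  note F' = W0_jetsD[OF F]
  have "\<exists>\<phi>\<in>test_funs B. (\<integral>x. norm (F (hmul (- c) x) - jet \<phi> x) powr \<alpha> \<partial>lebesgue) < \<epsilon>" if \<epsilon>: "\<epsilon> > 0" for \<epsilon>
  proof -
    obtain \<phi> where \<phi>: "\<phi> \<in> test_funs A" "(\<integral>x. norm (F x - jet \<phi> x) powr \<alpha> \<partial>lebesgue) < \<epsilon>"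
      using W0_jets_approx[OF F \<epsilon>] .
    have "(\<integral>x. norm (F (hmul (- c) x) - jet \<phi> (hmul (- c) x)) powr \<alpha> \<partial>lebesgue) =
        (\<integral>x. norm (F x - jet \<phi> x) powr \<alpha> \<partial>lebesgue)"
      using W0_jets_diff_integrable[OF F \<phi>(1) \<alpha>]
      by (intro integral_compose_preserving[OF hmul_preserves]) auto
    then show ?thesis
      using \<phi> test_funs_hmul[OF \<phi>(1) B] by (intro bexI[of _ "\<lambda>x. \<phi> (hmul (- c) x)"]) (auto simp: jet_hmul)
  qed
  moreover have "F (hmul (- c) x) = 0" if "x \<notin> B" for x
    using that F'(2)[of "hmul (- c) x"] B[of "hmul (- c) x"] by auto
  moreover have "integrable lebesgue (\<lambda>x. norm (F (hmul (- c) x)) powr \<alpha>)"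
    using integrable_compose_preserving[OF hmul_preserves, of "\<lambda>x. norm (F x) powr \<alpha>"] F'(3) by auto
  ultimately show ?thesis
    using borel_measurable_compose_preserving[OF hmul_preserves F'(1)] by (auto simp: W0_jets_def)
qed

lemma jet_components:
  fixes F :: "'a::euclidean_space \<Rightarrow> real \<times> (real^'m::finite)"
  assumes F: "F \<in> borel_measurable lebesgue" "integrable lebesgue (\<lambda>x. norm (F x) powr \<alpha>)" and \<alpha>: "\<alpha> > 0"
  shows "(\<lambda>x. fst (F x)) \<in> borel_measurable lebesgue" "(\<lambda>x. snd (F x)) \<in> borel_measurable lebesgue"
    "(\<lambda>x. snd (F x) $ j) \<in> borel_measurable lebesgue"
    "integrable lebesgue (\<lambda>x. \<bar>fst (F x)\<bar> powr \<alpha>)" "integrable lebesgue (\<lambda>x. \<bar>snd (F x) $ j\<bar> powr \<alpha>)"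
proof -
  have comp: "(\<lambda>x. h (F x)) \<in> borel_measurable lebesgue" if "continuous_on UNIV h"
    for h :: "real \<times> (real^'m) \<Rightarrow> 'b::topological_space"
    using F(1) borel_measurable_continuous_onI[OF that] by (rule measurable_compose)
  show 1: "(\<lambda>x. fst (F x)) \<in> borel_measurable lebesgue"
    by (intro comp continuous_intros)
  show "(\<lambda>x. snd (F x)) \<in> borel_measurable lebesgue"
    using F(1) by (rule measurable_compose) (intro borel_measurable_continuous_onI continuous_intros)
  show 2: "(\<lambda>x. snd (F x) $ j) \<in> borel_measurable lebesgue"
    by (intro comp continuous_intros)
  show "integrable lebesgue (\<lambda>x. \<bar>fst (F x)\<bar> powr \<alpha>)"
    using integrable_norm_powr_mono[OF _ F(2) 1] \<alpha> norm_fst_le[of "fst (F x)" "snd (F x)" for x] by simp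
  have "norm (snd p $ j) \<le> norm p" for p :: "real \<times> (real^'m)"
    using component_le_norm_cart[of "snd p" j] norm_snd_le[of "snd p" "fst p"] by simp
  then show "integrable lebesgue (\<lambda>x. \<bar>snd (F x) $ j\<bar> powr \<alpha>)"
    using integrable_norm_powr_mono[OF _ F(2) 2] \<alpha> by simp
qed

text \<open>Here extension by zero is shown to be harmless: \<open>A\<close> may be any open set and
  need not lie in \<open>B\<close>. The approximating test functions satisfy integration by parts on
  the whole group, and the identity survives the limit, so no singular derivative appears on the
  boundary of \<open>B\<close>.\<close>

lemma W0_jets_weak_X:
  fixes A :: "'n::finite heis set"
  assumes F: "F \<in> W0_jets \<alpha> B" and \<alpha>: "\<alpha> > 1" and A: "open A"
  shows "weak_X A j (\<lambda>x. fst (F x)) (\<lambda>x. snd (F x) $ j)"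
proof -
  have "\<alpha> > 0"
    using \<alpha> by simp
  note comp = jet_components[OF W0_jetsD(1)[OF F] W0_jetsD(3)[OF F] this]
  have loc: "loc_integrable S (\<lambda>x. fst (F x))" "loc_integrable S (\<lambda>x. snd (F x) $ j)" for S
    by (rule loc_integrable_if_powr_integrable[OF comp(1) comp(4) less_imp_le[OF \<alpha>]],
        rule loc_integrable_if_powr_integrable[OF comp(3) comp(5) less_imp_le[OF \<alpha>]])
  have "(\<integral>x. fst (F x) * X_classical j \<psi> x \<partial>lebesgue) = - (\<integral>x. snd (F x) $ j * \<psi> x \<partial>lebesgue)"
    if \<psi>: "\<psi> \<in> test_funs A" for \<psi>
  proof -
    obtain K where K: "compact K" "K \<subseteq> A" "\<And>x. x \<notin> K \<Longrightarrow> \<psi> x = 0" "\<And>j x. x \<notin> K \<Longrightarrow> X_classical j \<psi> x = 0"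
      "continuous_on UNIV \<psi>" "\<And>j. continuous_on UNIV (X_classical j \<psi>)"
      by (rule test_funsE_X[OF \<psi>], rule that)
    obtain B1 where B1: "\<And>x. norm (\<psi> x) \<le> B1"
      using bounded_continuous_compact_support[OF K(5,1,3)] by metis
    obtain B2 where B2: "\<And>x. norm (X_classical j \<psi> x) \<le> B2"
      using bounded_continuous_compact_support[OF K(6,1,4)] by metis
    \<comment> \<open>The pairing of a jet with the test function \<psi>, linear in the jet. The
      claim is that its integral along \<open>F\<close> vanishes, as it does along jets of test
      functions.\<close>
    define P where "P p x = fst p * X_classical j \<psi> x + snd p $ j * \<psi> x" for p :: "real \<times> 'n horiz" and x
    define k where "k = measure lebesgue K"
    have P_le: "\<bar>P p x\<bar> \<le> (B1 + B2) * (norm p * indicator K x)" for p x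
    proof (cases "x \<in> K")
      case True
      have "\<bar>P p x\<bar> \<le> \<bar>fst p\<bar> * \<bar>X_classical j \<psi> x\<bar> + \<bar>snd p $ j\<bar> * \<bar>\<psi> x\<bar>"
        by (simp add: P_def abs_triangle_ineq flip: abs_mult)
      also have "\<dots> \<le> norm p * B2 + norm p * B1"
        using B1[of x] B2[of x] component_le_norm_cart[of "snd p" j] norm_snd_le[of "snd p" "fst p"] norm_fst_le[of "fst p" "snd p"]
        by (intro add_mono mult_mono) auto
      finally show ?thesis using True by (simp add: algebra_simps)
    qed (simp add: P_def K)
    have B: "B1 + B2 \<ge> 0"
      using B1[of 0] B2[of 0] by (meson add_nonneg_nonneg norm_ge_zero order_trans)
    have intF: "integrable lebesgue (\<lambda>x. P (F x) x)"
      using weak_X_integrable(2)[OF loc(1) \<psi>] weak_X_integrable(1)[OF loc(2) \<psi>] by (simp add: P_def)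
    have "\<bar>\<integral>x. P (F x) x \<partial>lebesgue\<bar> \<le> 0 + e" if e: "e > 0" for e
    proof -
      \<comment> \<open>With an approximation error below \<eta>^\<alpha>,
        \<open>le_add_powr\<close> yields the bound (B1 + B2) (\<eta> k + \<eta>^(1-\<alpha>)
        \<eta>^\<alpha>) = (B1 + B2) \<eta> (k + 1), at most \<open>e\<close>. The added 1s keep the
        denominator positive.\<close>
      define \<eta> where "\<eta> = e / ((B1 + B2 + 1) * (k + 1))"
      have k: "k \<ge> 0" by (simp add: k_def)
      have \<eta>: "\<eta> > 0" using e B k by (simp add: \<eta>_def)
      obtain \<phi> where \<phi>: "\<phi> \<in> test_funs B" "(\<integral>x. norm (F x - jet \<phi> x) powr \<alpha> \<partial>lebesgue) < \<eta> powr \<alpha>"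
        using W0_jets_approx[OF F, of "\<eta> powr \<alpha>"] \<eta> by auto
      have int\<phi>: "integrable lebesgue (\<lambda>x. P (jet \<phi> x) x)" "(\<integral>x. P (jet \<phi> x) x \<partial>lebesgue) = 0"
      proof -
        have "\<And>k. Ck k \<phi>" using test_funs_Ck[OF \<phi>(1)] .
        note Ck = this
        have 1: "integrable lebesgue (\<lambda>x. \<phi> x * X_classical j \<psi> x)" "integrable lebesgue (\<lambda>x. X_classical j \<phi> x * \<psi> x)"
          using weak_X_integrable[OF loc_integrable_continuous \<psi>] Ck_continuous[OF Ck] X_classical_continuous[OF Ck] by blast+
        then show "integrable lebesgue (\<lambda>x. P (jet \<phi> x) x)"
          by (simp add: P_def jet_def)
        show "(\<integral>x. P (jet \<phi> x) x \<partial>lebesgue) = 0"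
          using 1 integration_by_parts_X[OF Ck \<psi>] by (simp add: P_def jet_def)
      qed
      have P_diff: "P (F x) x - P (jet \<phi> x) x = P (F x - jet \<phi> x) x" for x
        by (simp add: P_def algebra_simps)
      have "\<bar>\<integral>x. P (F x) x \<partial>lebesgue\<bar> = \<bar>\<integral>x. P (F x - jet \<phi> x) x \<partial>lebesgue\<bar>"
        using int\<phi> intF by (simp flip: P_diff)
      also have "\<dots> \<le> (\<integral>x. (B1 + B2) * (\<eta> * indicator K x + \<eta> powr (1 - \<alpha>) * norm (F x - jet \<phi> x) powr \<alpha>) \<partial>lebesgue)"
      proof (rule integral_abs_bound[THEN order_trans], rule integral_mono)
        show "integrable lebesgue (\<lambda>x. \<bar>P (F x - jet \<phi> x) x\<bar>)"
          using intF int\<phi> by (intro integrable_abs) (simp flip: P_diff)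
        show "integrable lebesgue (\<lambda>x. (B1 + B2) * (\<eta> * indicator K x + \<eta> powr (1 - \<alpha>) * norm (F x - jet \<phi> x) powr \<alpha>))"
          using W0_jets_diff_integrable[OF F \<phi>(1)] \<alpha> K(1) emeasure_compact_finite[OF K(1)]
          by (intro integrable_mult_right Bochner_Integration.integrable_add integrable_real_indicator)
            (auto simp: compact_imp_closed)
        fix x
        have "norm (F x - jet \<phi> x) * indicator K x \<le> \<eta> * indicator K x + \<eta> powr (1 - \<alpha>) * norm (F x - jet \<phi> x) powr \<alpha>"
          using le_add_powr[of "norm (F x - jet \<phi> x)" \<eta> \<alpha>] \<eta> \<alpha> by (auto simp: indicator_def)
        then show "\<bar>P (F x - jet \<phi> x) x\<bar> \<le> (B1 + B2) * (\<eta> * indicator K x + \<eta> powr (1 - \<alpha>) * norm (F x - jet \<phi> x) powr \<alpha>)"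
          using P_le[of "F x - jet \<phi> x" x] B by (meson mult_left_mono order_trans)
      qed
      also have "\<dots> = (B1 + B2) * (\<eta> * k + \<eta> powr (1 - \<alpha>) * (\<integral>x. norm (F x - jet \<phi> x) powr \<alpha> \<partial>lebesgue))"
        using W0_jets_diff_integrable[OF F \<phi>(1)] \<alpha> K(1) emeasure_compact_finite[OF K(1)]
        by (subst integral_mult_right_zero, subst Bochner_Integration.integral_add)
          (auto simp: compact_imp_closed k_def)
      also have "\<dots> \<le> (B1 + B2) * (\<eta> * k + \<eta> powr (1 - \<alpha>) * \<eta> powr \<alpha>)"
        using \<phi>(2) B by (intro mult_left_mono add_left_mono) auto
      also have "\<dots> = (B1 + B2) * (\<eta> * (k + 1))"
        using \<eta> by (simp add: algebra_simps flip: powr_add)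
      also have "\<dots> \<le> (B1 + B2 + 1) * (\<eta> * (k + 1))"
        using \<eta> k by (intro mult_right_mono) auto
      also have "\<dots> = e"
        using B k by (simp add: \<eta>_def)
      finally show ?thesis by simp
    qed
    then have "(\<integral>x. P (F x) x \<partial>lebesgue) = 0"
      using field_le_epsilon[of "\<bar>\<integral>x. P (F x) x \<partial>lebesgue\<bar>" 0] by simp
    then show ?thesis
      using weak_X_integrable(2)[OF loc(1) \<psi>] weak_X_integrable(1)[OF loc(2) \<psi>] by (simp add: P_def)
  qed
  then show ?thesis
    using loc by (simp add: weak_X_iff[OF A])
qed

section \<open>The minimisation problem in terms of jets\<close>

lemma jet_outside:
  assumes "\<phi> \<in> test_funs A" "x \<notin> A"
  shows "jet \<phi> x = 0"
proof -
  obtain K where "K \<subseteq> A" "\<And>x. x \<notin> K \<Longrightarrow> jet \<phi> x = 0"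
    using jet_test_fun[OF assms(1)] by metis
  with assms(2) show ?thesis by (meson subsetD)
qed

text \<open>Completeness of Lebesgue measure at work. It settles measurability of expressions in
  \<open>hgrad\<close> by comparison with an explicit gradient.\<close>

lemma lebesgue_on_AE_measurable:
  fixes f g :: "'a::euclidean_space \<Rightarrow> 'b::topological_space"
  assumes A: "A \<in> sets lebesgue" and f: "f \<in> borel_measurable (lebesgue_on A)"
    and ae: "AE x in lebesgue_on A. f x = g x"
  shows "g \<in> borel_measurable (lebesgue_on A)"
proof (rule measurableI)
  fix B :: "'b set" assume B: "B \<in> sets borel"
  have "AE x in lebesgue. x \<in> A \<longrightarrow> f x = g x"
    using ae A by (simp add: AE_restrict_space_iff)
  then have "AE x in lebesgue. x \<in> f -` B \<inter> A \<longleftrightarrow> x \<in> g -` B \<inter> A"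
    by eventually_elim auto
  moreover have "f -` B \<inter> A \<in> sets lebesgue"
    using measurable_sets[OF f B] A by (auto simp: sets_restrict_space space_restrict_space)
  ultimately have "g -` B \<inter> A \<in> sets lebesgue"
    by (rule completion.in_sets_AE) auto
  then show "g -` B \<inter> space (lebesgue_on A) \<in> sets (lebesgue_on A)"
    using A by (auto simp: sets_restrict_space_iff space_restrict_space)
qed auto

lemma lebesgue_on_integral_AE_eq:
  fixes f g :: "'a::euclidean_space \<Rightarrow> 'b::{banach, second_countable_topology}"
  assumes "A \<in> sets lebesgue" "f \<in> borel_measurable (lebesgue_on A)" "AE x in lebesgue_on A. f x = g x"
  shows "(\<integral>x. g x \<partial>lebesgue_on A) = (\<integral>x. f x \<partial>lebesgue_on A)"
  using lebesgue_on_AE_measurable[OF assms] assms by (intro integral_cong_AE) auto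

lemma linear_lin_fun: "linear (lin_fun q)"
proof (rule linearI)
  have *: "hproj (x + y) = hproj x + hproj y" "hproj (r *\<^sub>R x) = r *\<^sub>R hproj x" for x y :: "'a heis" and r
    by (auto simp: hproj_def vec_eq_iff split_beta split: sum.splits)
  show "lin_fun q (x + y) = lin_fun q x + lin_fun q y" "lin_fun q (r *\<^sub>R x) = r *\<^sub>R lin_fun q x" for x y r
    by (simp_all add: lin_fun_def * inner_simps)
qed

lemma X_classical_lin_fun: "X_classical j (lin_fun q) x = q $ j"
proof -
  have "frechet_derivative (lin_fun q) (at x) = lin_fun q"
    using frechet_derivative_at[OF linear_imp_has_derivative[OF linear_lin_fun]] by metis
  moreover have "hproj (hfield j x) = axis j 1"
    by (cases j) (auto simp: hproj_def hfield_def vec_eq_iff axis_def split_beta split: sum.splits)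
  ultimately show ?thesis
    by (simp add: X_classical_def lin_fun_def inner_axis)
qed

text \<open>The total integrand under the root in \<open>W_norm\<close>, as a function of the jet.
  The two bounds below compare it with \<open>norm p powr \<alpha>\<close>, so that closure in
  \<open>W_norm\<close> and closure in the sense of \<open>W0_jets\<close> agree.\<close>

definition powr_sum :: "real \<Rightarrow> real \<times> (real^'m::finite) \<Rightarrow> real" where
  "powr_sum \<alpha> p = \<bar>fst p\<bar> powr \<alpha> + (\<Sum>j\<in>UNIV. \<bar>snd p $ j\<bar> powr \<alpha>)"

lemma powr_sum_le_norm:
  assumes "\<alpha> > 0"
  shows "powr_sum \<alpha> p \<le> (1 + real CARD('m)) * norm (p :: real \<times> (real^'m::finite)) powr \<alpha>"
proof -
  have "\<bar>fst p\<bar> \<le> norm p" "\<bar>snd p $ j\<bar> \<le> norm p" for j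
    using norm_fst_le[of "fst p" "snd p"] component_le_norm_cart[of "snd p" j] norm_snd_le[of "snd p" "fst p"] by auto
  then have "powr_sum \<alpha> p \<le> norm p powr \<alpha> + (\<Sum>j\<in>(UNIV :: 'm set). norm p powr \<alpha>)"
    unfolding powr_sum_def using assms by (intro add_mono sum_mono powr_mono2) auto
  then show ?thesis by (simp add: algebra_simps)
qed

text \<open>Each of the 1 + m components is at most the 1/\<alpha> power of the sum, and the norm is
  at most the sum of the absolute values of the components.\<close>

lemma norm_le_powr_sum:
  fixes p :: "real \<times> (real^'m::finite)"
  assumes "\<alpha> > 0"
  shows "norm p powr \<alpha> \<le> (1 + real CARD('m)) powr \<alpha> * powr_sum \<alpha> p"
proof -
  let ?S = "powr_sum \<alpha> p"
  have S: "?S \<ge> 0" by (auto simp: powr_sum_def intro!: add_nonneg_nonneg sum_nonneg)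
  have root: "\<bar>c\<bar> \<le> ?S powr (1 / \<alpha>)" if "\<bar>c\<bar> powr \<alpha> \<le> ?S" for c
  proof -
    have "\<bar>c\<bar> = (\<bar>c\<bar> powr \<alpha>) powr (1 / \<alpha>)"
      using assms by (simp add: powr_powr)
    also have "\<dots> \<le> ?S powr (1 / \<alpha>)"
      using that assms by (intro powr_mono2) auto
    finally show ?thesis .
  qed
  have "norm p \<le> \<bar>fst p\<bar> + norm (snd p)"
    using norm_Pair_le[of "fst p" "snd p"] by simp
  also have "\<dots> \<le> \<bar>fst p\<bar> + (\<Sum>j\<in>UNIV. \<bar>snd p $ j\<bar>)"
    by (intro add_left_mono norm_le_l1_cart)
  also have "\<dots> \<le> ?S powr (1 / \<alpha>) + (\<Sum>j\<in>(UNIV :: 'm set). ?S powr (1 / \<alpha>))"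
  proof (intro add_mono sum_mono root)
    show "\<bar>fst p\<bar> powr \<alpha> \<le> ?S"
      by (auto simp: powr_sum_def intro!: sum_nonneg)
    show "\<bar>snd p $ j\<bar> powr \<alpha> \<le> ?S" for j
      unfolding powr_sum_def by (intro add_increasing member_le_sum) auto
  qed
  also have "\<dots> = (1 + real CARD('m)) * ?S powr (1 / \<alpha>)"
    by (simp add: algebra_simps)
  finally have "norm p powr \<alpha> \<le> ((1 + real CARD('m)) * ?S powr (1 / \<alpha>)) powr \<alpha>"
    using assms by (intro powr_mono2) auto
  also have "\<dots> = (1 + real CARD('m)) powr \<alpha> * ?S"
    using assms S by (simp add: powr_mult powr_powr)
  finally show ?thesis .
qed

lemma powr_sum_integrable:
  fixes G :: "'a::euclidean_space \<Rightarrow> real \<times> (real^'m::finite)"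
  assumes "G \<in> borel_measurable lebesgue" "integrable lebesgue (\<lambda>x. norm (G x) powr \<alpha>)" "\<alpha> > 0"
  shows "integrable lebesgue (\<lambda>x. powr_sum \<alpha> (G x))"
  unfolding powr_sum_def using jet_components[OF assms]
  by (intro Bochner_Integration.integrable_add Bochner_Integration.integrable_sum)

lemma weak_X_cong:
  assumes "\<And>x. x \<in> A \<Longrightarrow> u x = u' x" "\<And>x. x \<in> A \<Longrightarrow> w x = w' x" "weak_X A j u w"
  shows "weak_X A j u' w'"
proof -
  have loc: "loc_integrable A v \<Longrightarrow> loc_integrable A v'" if "\<And>x. x \<in> A \<Longrightarrow> v x = v' x" for v v' :: "'a heis \<Rightarrow> real"
    unfolding loc_integrable_def
  proof (intro allI impI)
    fix K assume *: "\<forall>K. compact K \<and> K \<subseteq> A \<longrightarrow> integrable (lebesgue_on K) v" "compact K \<and> K \<subseteq> A"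
    have "integrable (lebesgue_on K) v \<longleftrightarrow> integrable (lebesgue_on K) v'"
      using subsetD[OF conjunct2[OF *(2)]] that
      by (intro Bochner_Integration.integrable_cong refl) (simp add: space_restrict_space)
    with * show "integrable (lebesgue_on K) v'" by blast
  qed
  have "(\<integral>x. u x * X_classical j \<phi> x \<partial>lebesgue_on A) = (\<integral>x. u' x * X_classical j \<phi> x \<partial>lebesgue_on A)" for \<phi>
    using assms(1) by (intro Bochner_Integration.integral_cong refl) (simp add: space_restrict_space)
  moreover have "(\<integral>x. w x * \<phi> x \<partial>lebesgue_on A) = (\<integral>x. w' x * \<phi> x \<partial>lebesgue_on A)" for \<phi>
    using assms(2) by (intro Bochner_Integration.integral_cong refl) (simp add: space_restrict_space)
  ultimately show ?thesis
    using assms(3) loc[OF assms(1)] loc[OF assms(2)] by (simp add: weak_X_def)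
qed

text \<open>Uniqueness of weak derivatives eliminates \<open>hgrad\<close>, and the vanishing of
  \<open>G\<close> off \<open>A\<close> turns integrals over \<open>A\<close> into integrals over
  the whole group.\<close>

lemma W_norm_eq:
  fixes G :: "'n::finite heis \<Rightarrow> real \<times> 'n horiz"
  assumes A: "open A" and \<alpha>: "\<alpha> > 0"
    and G: "G \<in> borel_measurable lebesgue" "integrable lebesgue (\<lambda>x. norm (G x) powr \<alpha>)" "\<And>x. x \<notin> A \<Longrightarrow> G x = 0"
    and v: "\<And>x. x \<in> A \<Longrightarrow> fst (G x) = v x" "\<And>j. weak_X A j v (\<lambda>x. snd (G x) $ j)"
  shows "W_norm \<alpha> A v = (\<integral>x. powr_sum \<alpha> (G x) \<partial>lebesgue) powr (1 / \<alpha>)"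
proof -
  note comp = jet_components[OF G(1,2) \<alpha>]
  have A': "A \<in> sets lebesgue" using A by simp
  have 1: "(\<integral>x. \<bar>v x\<bar> powr \<alpha> \<partial>lebesgue_on A) = (\<integral>x. \<bar>fst (G x)\<bar> powr \<alpha> \<partial>lebesgue)"
  proof -
    have "(\<integral>x. \<bar>v x\<bar> powr \<alpha> \<partial>lebesgue_on A) = (\<integral>x. \<bar>fst (G x)\<bar> powr \<alpha> \<partial>lebesgue_on A)"
      using v(1) by (intro Bochner_Integration.integral_cong refl) (simp add: space_restrict_space)
    also have "\<dots> = (\<integral>x. \<bar>fst (G x)\<bar> powr \<alpha> \<partial>lebesgue)"
      using A' G(3) by (intro integral_lebesgue_on_eq) auto
    finally show ?thesis .
  qed
  have 2: "(\<integral>x. \<bar>hgrad A v x $ j\<bar> powr \<alpha> \<partial>lebesgue_on A) = (\<integral>x. \<bar>snd (G x) $ j\<bar> powr \<alpha> \<partial>lebesgue)" for j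
  proof -
    have "AE x in lebesgue_on A. hgrad A v x = snd (G x)"
      using A v(2) by (rule hgrad_AE_eq)
    then have "AE x in lebesgue_on A. \<bar>snd (G x) $ j\<bar> powr \<alpha> = \<bar>hgrad A v x $ j\<bar> powr \<alpha>"
      by eventually_elim simp
    then have "(\<integral>x. \<bar>hgrad A v x $ j\<bar> powr \<alpha> \<partial>lebesgue_on A) = (\<integral>x. \<bar>snd (G x) $ j\<bar> powr \<alpha> \<partial>lebesgue_on A)"
      using comp(3)[of j] A' by (intro lebesgue_on_integral_AE_eq measurable_restrict_space1 measurable_abs_powr)
    also have "\<dots> = (\<integral>x. \<bar>snd (G x) $ j\<bar> powr \<alpha> \<partial>lebesgue)"
      using A' G(3) by (intro integral_lebesgue_on_eq) auto
    finally show ?thesis .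
  qed
  show ?thesis
    unfolding W_norm_def powr_sum_def 1 2 using comp(4,5)
    by (subst Bochner_Integration.integral_add) (auto simp: Bochner_Integration.integral_sum)
qed

lemma Lp_fun_iff:
  assumes "A \<in> sets lebesgue"
  shows "u \<in> Lp_fun \<alpha> A \<longleftrightarrow> (\<lambda>x. indicator A x * u x) \<in> borel_measurable lebesgue \<and>
    integrable lebesgue (\<lambda>x. \<bar>indicator A x * u x\<bar> powr \<alpha>)"
proof -
  have eq: "indicator A x * \<bar>u x\<bar> powr \<alpha> = \<bar>indicator A x * u x\<bar> powr \<alpha>" for x
    by (auto simp: indicator_def)
  show ?thesis
    using assms by (simp add: Lp_fun_def borel_measurable_restrict_space_iff integrable_restrict_space eq)
qed

lemma W_space_jet:
  fixes A :: "'n::finite heis set"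
  assumes A: "open A" and \<alpha>: "\<alpha> > 0" and u: "u \<in> W_space \<alpha> A"
  obtains F where "F \<in> borel_measurable lebesgue" "\<And>x. x \<notin> A \<Longrightarrow> F x = 0"
    "integrable lebesgue (\<lambda>x. norm (F x) powr \<alpha>)" "\<And>x. x \<in> A \<Longrightarrow> fst (F x) = u x"
    "\<And>j. weak_X A j u (\<lambda>x. snd (F x) $ j)"
proof -
  have A': "A \<in> sets lebesgue" using A by simp
  from u have "\<forall>j. \<exists>w. w \<in> Lp_fun \<alpha> A \<and> weak_X A j u w" and u': "u \<in> Lp_fun \<alpha> A"
    by (auto simp: W_space_def)
  then obtain w where w: "\<And>j. w j \<in> Lp_fun \<alpha> A" "\<And>j. weak_X A j u (w j)"
    by metis
  \<comment> \<open>The gradient is written as a finite sum of axis vectors, so that its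
    measurability follows from that of sums and scalar multiples.\<close>
  define F where "F x = (indicator A x * u x, \<Sum>j\<in>UNIV. (indicator A x * w j x) *\<^sub>R axis j (1::real))" for x
  have snd_F: "snd (F x) $ j = indicator A x * w j x" for x j
    by (simp add: F_def axis_def if_distrib sum.delta' cong: if_cong)
  note u'' = u'[unfolded Lp_fun_iff[OF A']] and w'' = w(1)[unfolded Lp_fun_iff[OF A']]
  have meas: "F \<in> borel_measurable lebesgue"
    unfolding F_def using u'' w''
    by (intro borel_measurable_Pair borel_measurable_sum borel_measurable_scaleR) auto
  have "integrable lebesgue (\<lambda>x. norm (F x) powr \<alpha>)"
  proof (rule Bochner_Integration.integrable_bound)
    have "integrable lebesgue (\<lambda>x. powr_sum \<alpha> (F x))"
      unfolding powr_sum_def snd_F using u'' w''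
      by (intro Bochner_Integration.integrable_add Bochner_Integration.integrable_sum) (auto simp: F_def)
    then show "integrable lebesgue (\<lambda>x. (1 + real CARD('n + 'n)) powr \<alpha> * powr_sum \<alpha> (F x))"
      by (rule integrable_mult_right)
    show "AE x in lebesgue. norm (norm (F x) powr \<alpha>) \<le> norm ((1 + real CARD('n + 'n)) powr \<alpha> * powr_sum \<alpha> (F x))"
      using norm_le_powr_sum[OF \<alpha>, of "F x" for x] by (intro always_eventually allI) (simp add: order_trans[OF _ abs_ge_self])
  qed (use meas in auto)
  moreover have "F x = 0" if "x \<notin> A" for x
    using that by (simp add: F_def zero_prod_def)
  moreover have "weak_X A j u (\<lambda>x. snd (F x) $ j)" for j
    by (rule weak_X_cong[OF _ _ w(2)]) (auto simp: snd_F)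
  ultimately show ?thesis
    using meas by (intro that[of F]) (auto simp: F_def)
qed

text \<open>The jet is the one from \<open>W_space_jet\<close>; test functions approximating
  \<open>u\<close> in \<open>W_norm\<close> also approximate it in jet norm, by
  \<open>norm_le_powr_sum\<close>.\<close>

lemma W0_space_jet:
  fixes A :: "'n::finite heis set"
  assumes A: "open A" and \<alpha>: "\<alpha> > 1" and u: "u \<in> W0_space \<alpha> A"
  obtains F where "F \<in> W0_jets \<alpha> A" "\<And>x. x \<in> A \<Longrightarrow> fst (F x) = u x" "\<And>j. weak_X A j u (\<lambda>x. snd (F x) $ j)"
proof -
  have \<alpha>': "\<alpha> > 0" using \<alpha> by simp
  have "u \<in> W_space \<alpha> A"
    using u by (simp add: W0_space_def)
  then obtain F where F: "F \<in> borel_measurable lebesgue" "\<And>x. x \<notin> A \<Longrightarrow> F x = 0"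
    "integrable lebesgue (\<lambda>x. norm (F x) powr \<alpha>)" "\<And>x. x \<in> A \<Longrightarrow> fst (F x) = u x"
    "\<And>j. weak_X A j u (\<lambda>x. snd (F x) $ j)"
    using W_space_jet[OF A \<alpha>'] by blast
  let ?K = "(1 + real CARD('n + 'n)) powr \<alpha>"
  have "\<exists>\<phi>\<in>test_funs A. (\<integral>x. norm (F x - jet \<phi> x) powr \<alpha> \<partial>lebesgue) < \<epsilon>" if \<epsilon>: "\<epsilon> > 0" for \<epsilon>
  proof -
    have K: "?K > 0" by (simp add: add_pos_nonneg)
    \<comment> \<open>\<open>W_norm\<close> below this threshold means that the integral of
      \<open>powr_sum\<close> is below \<epsilon> divided by the comparison constant.\<close>
    define \<delta> where "\<delta> = (\<epsilon> / ?K) powr (1 / \<alpha>)"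
    have "\<delta> > 0" using \<epsilon> K by (simp add: \<delta>_def)
    then obtain \<phi> where \<phi>: "\<phi> \<in> test_funs A" "W_norm \<alpha> A (\<lambda>x. u x - \<phi> x) < \<delta>"
      using u by (auto simp: W0_space_def)
    define G where "G x = F x - jet \<phi> x" for x
    have G: "G \<in> borel_measurable lebesgue" "integrable lebesgue (\<lambda>x. norm (G x) powr \<alpha>)"
    proof -
      show 1: "G \<in> borel_measurable lebesgue"
        unfolding G_def using F(1) jet_measurable[OF \<phi>(1)] by (rule borel_measurable_diff)
      have "integrable lebesgue (\<lambda>x. norm (F x + - jet \<phi> x) powr \<alpha>)"
        using \<alpha> F(1,3) 1 jet_measurable[OF \<phi>(1)] jet_powr_integrable[OF \<phi>(1) \<alpha>']
        by (intro integrable_norm_powr_add) (auto simp: G_def)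
      then show "integrable lebesgue (\<lambda>x. norm (G x) powr \<alpha>)"
        by (simp add: G_def)
    qed
    have G0: "G x = 0" if "x \<notin> A" for x
      using F(2)[OF that] jet_outside[OF \<phi>(1) that] by (simp add: G_def)
    have "W_norm \<alpha> A (\<lambda>x. u x - \<phi> x) = (\<integral>x. powr_sum \<alpha> (G x) \<partial>lebesgue) powr (1 / \<alpha>)"
    proof (rule W_norm_eq[OF A \<alpha>' G G0])
      show "fst (G x) = u x - \<phi> x" if "x \<in> A" for x
        using F(4)[OF that] by (simp add: G_def jet_def)
      show "weak_X A j (\<lambda>x. u x - \<phi> x) (\<lambda>x. snd (G x) $ j)" for j
        using weak_X_lin[OF A F(5) weak_X_Ck[OF A test_funs_Ck[OF \<phi>(1)]], of j "- 1"] by (simp add: G_def jet_def)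
    qed
    with \<phi>(2) have "(\<integral>x. powr_sum \<alpha> (G x) \<partial>lebesgue) powr (1 / \<alpha>) < (\<epsilon> / ?K) powr (1 / \<alpha>)"
      by (simp add: \<delta>_def)
    then have less: "(\<integral>x. powr_sum \<alpha> (G x) \<partial>lebesgue) < \<epsilon> / ?K"
      using powr_mono2[of "1 / \<alpha>" "\<epsilon> / ?K"] \<alpha>' \<epsilon> K by (meson divide_pos_pos less_imp_le not_le zero_le_divide_1_iff)
    have "(\<integral>x. norm (G x) powr \<alpha> \<partial>lebesgue) \<le> (\<integral>x. ?K * powr_sum \<alpha> (G x) \<partial>lebesgue)"
      by (intro integral_mono integrable_mult_right G(2) powr_sum_integrable[OF G \<alpha>'] norm_le_powr_sum[OF \<alpha>'])
    also have "\<dots> = ?K * (\<integral>x. powr_sum \<alpha> (G x) \<partial>lebesgue)"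
      by (rule integral_mult_right_zero)
    also have "\<dots> < ?K * (\<epsilon> / ?K)"
      using less K by (intro mult_strict_left_mono)
    also have "\<dots> = \<epsilon>" using K by simp
    finally show ?thesis
      using \<phi>(1) unfolding G_def by (rule bexI)
  qed
  then have "F \<in> W0_jets \<alpha> A"
    using F(1-3) by (simp add: W0_jets_def)
  then show ?thesis using F(4,5) by (rule that)
qed

text \<open>The converse of \<open>W0_space_jet\<close>. That the second component of a jet really
  is the weak gradient of the first is supplied by \<open>W0_jets_weak_X\<close>.\<close>

lemma W0_jets_W0_space:
  fixes A :: "'n::finite heis set"
  assumes A: "open A" and \<alpha>: "\<alpha> > 1" and F: "F \<in> W0_jets \<alpha> A"
  shows "(\<lambda>x. fst (F x)) \<in> W0_space \<alpha> A"
proof -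
  have \<alpha>': "\<alpha> > 0" using \<alpha> by simp
  have A': "A \<in> sets lebesgue" using A by simp
  note F' = W0_jetsD[OF F]
  note comp = jet_components[OF F'(1,3) \<alpha>'] and wk = W0_jets_weak_X[OF F \<alpha> A]
  have Lp: "u \<in> Lp_fun \<alpha> A" if "u \<in> borel_measurable lebesgue" "integrable lebesgue (\<lambda>x. \<bar>u x\<bar> powr \<alpha>)" for u
    using that A' integrable_mult_indicator[OF A' that(2)]
    by (auto simp: Lp_fun_def integrable_restrict_space measurable_restrict_space1)
  have W: "(\<lambda>x. fst (F x)) \<in> W_space \<alpha> A"
    unfolding W_space_def using Lp[OF comp(1,4)] Lp[OF comp(3,5)] wk by (intro CollectI conjI allI bexI)
  have "\<exists>\<phi>\<in>test_funs A. W_norm \<alpha> A (\<lambda>x. fst (F x) - \<phi> x) < \<epsilon>" if \<epsilon>: "\<epsilon> > 0" for \<epsilon>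
  proof -
    let ?c = "1 + real CARD('n + 'n)"
    have c: "?c > 0" by simp
    define \<delta> where "\<delta> = \<epsilon> powr \<alpha> / ?c"
    have "\<delta> > 0" using \<epsilon> by (simp add: \<delta>_def add_pos_nonneg)
    then obtain \<phi> where \<phi>: "\<phi> \<in> test_funs A" "(\<integral>x. norm (F x - jet \<phi> x) powr \<alpha> \<partial>lebesgue) < \<delta>"
      by (rule W0_jets_approx[OF F])
    define G where "G x = F x - jet \<phi> x" for x
    have G: "G \<in> borel_measurable lebesgue" "integrable lebesgue (\<lambda>x. norm (G x) powr \<alpha>)"
      unfolding G_def using F'(1) jet_measurable[OF \<phi>(1)] W0_jets_diff_integrable[OF F \<phi>(1) \<alpha>'] by auto
    have G0: "G x = 0" if "x \<notin> A" for x
      using F'(2)[OF that] jet_outside[OF \<phi>(1) that] by (simp add: G_def)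
    have "W_norm \<alpha> A (\<lambda>x. fst (F x) - \<phi> x) = (\<integral>x. powr_sum \<alpha> (G x) \<partial>lebesgue) powr (1 / \<alpha>)"
    proof (rule W_norm_eq[OF A \<alpha>' G G0])
      show "fst (G x) = fst (F x) - \<phi> x" for x
        by (simp add: G_def jet_def)
      show "weak_X A j (\<lambda>x. fst (F x) - \<phi> x) (\<lambda>x. snd (G x) $ j)" for j
        using weak_X_lin[OF A wk weak_X_Ck[OF A test_funs_Ck[OF \<phi>(1)]], of j "- 1"] by (simp add: G_def jet_def)
    qed
    moreover have "(\<integral>x. powr_sum \<alpha> (G x) \<partial>lebesgue) < \<epsilon> powr \<alpha>"
    proof -
      have "(\<integral>x. powr_sum \<alpha> (G x) \<partial>lebesgue) \<le> (\<integral>x. ?c * norm (G x) powr \<alpha> \<partial>lebesgue)"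
        by (intro integral_mono integrable_mult_right G(2) powr_sum_integrable[OF G \<alpha>'] powr_sum_le_norm[OF \<alpha>'])
      also have "\<dots> = ?c * (\<integral>x. norm (G x) powr \<alpha> \<partial>lebesgue)"
        by (rule integral_mult_right_zero)
      also have "\<dots> < ?c * \<delta>"
        using \<phi>(2) c unfolding G_def by (intro mult_strict_left_mono)
      also have "\<dots> = \<epsilon> powr \<alpha>" using c by (simp add: \<delta>_def)
      finally show ?thesis .
    qed
    moreover have "0 \<le> (\<integral>x. powr_sum \<alpha> (G x) \<partial>lebesgue)"
      by (auto simp: powr_sum_def intro!: integral_nonneg_AE add_nonneg_nonneg sum_nonneg)
    ultimately have "W_norm \<alpha> A (\<lambda>x. fst (F x) - \<phi> x) < (\<epsilon> powr \<alpha>) powr (1 / \<alpha>)"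
      using \<alpha>' by (simp add: powr_less_mono2)
    also have "\<dots> = \<epsilon>" using \<alpha>' \<epsilon> by (simp add: powr_powr)
    finally show ?thesis using \<phi>(1) by blast
  qed
  with W show ?thesis by (simp add: W0_space_def)
qed

section \<open>Gluing along tiles\<close>

lemma integrand_measurable:
  assumes "sup_measurable f" "v \<in> borel_measurable lebesgue"
  shows "(\<lambda>x. f x (v x)) \<in> borel_measurable lebesgue"
  using assms by (simp add: sup_measurable_def)

text \<open>Gradients are determined on the interior, while the energy is integrated over
  \<open>A\<close> itself; the difference is a null set.\<close>

lemma energy_AE_eq:
  assumes f: "sup_measurable f" and A: "A \<in> sets lebesgue" "A - interior A \<in> null_sets lebesgue"
    and h: "h \<in> borel_measurable lebesgue" and ae: "AE x in lebesgue_on (interior A). g x = h x"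
  shows "(\<integral>x. f x (g x) \<partial>lebesgue_on A) = (\<integral>x. f x (h x) \<partial>lebesgue_on A)"
proof (rule lebesgue_on_integral_AE_eq[OF A(1)])
  show "(\<lambda>x. f x (h x)) \<in> borel_measurable (lebesgue_on A)"
    using integrand_measurable[OF f h] by (rule measurable_restrict_space1)
  have "AE x in lebesgue. x \<in> interior A \<longrightarrow> g x = h x"
    using ae by (simp add: AE_restrict_space_iff)
  moreover have "AE x in lebesgue. x \<notin> A - interior A"
    using A(2) by (rule AE_not_in)
  ultimately have "AE x in lebesgue. x \<in> A \<longrightarrow> f x (h x) = f x (g x)"
    by eventually_elim auto
  then show "AE x in lebesgue_on A. f x (h x) = f x (g x)"
    using A(1) by (simp add: AE_restrict_space_iff)
qed

lemma weak_X_lin_fun: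
  assumes "open A"
  shows "weak_X A j (lin_fun q) (\<lambda>x. q $ j)"
proof -
  have "X_classical j (lin_fun q) = (\<lambda>x. q $ j)"
    by (rule ext) (rule X_classical_lin_fun)
  then show ?thesis
    using weak_X_Ck[OF assms Ck_linear[OF linear_lin_fun], of j q] by (simp only:)
qed

lemma W_space_lin_fun:
  fixes A :: "'n::finite heis set"
  assumes A: "open A" "bounded A" and \<alpha>: "\<alpha> > 0"
  shows "lin_fun q \<in> W_space \<alpha> A"
proof -
  have A': "A \<in> sets lebesgue" using A by simp
  have Lp: "u \<in> Lp_fun \<alpha> A" if u: "continuous_on UNIV u" for u
  proof -
    have "bounded (u ` closure A)"
      using A(2) u by (intro compact_imp_bounded compact_continuous_image) (auto intro: continuous_on_subset)
    then obtain B where B: "\<And>x. x \<in> closure A \<Longrightarrow> norm (u x) \<le> B"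
      by (auto simp: bounded_iff)
    have "integrable lebesgue (\<lambda>x. indicator A x *\<^sub>R (\<bar>u x\<bar> powr \<alpha>))"
    proof (rule integrableI_bounded_set_indicator[where B="B powr \<alpha>"])
      show "emeasure lebesgue A < \<infinity>"
        using emeasure_bounded_finite[OF A(2)] A(1) by simp
      show "AE x in lebesgue. x \<in> A \<longrightarrow> norm (\<bar>u x\<bar> powr \<alpha>) \<le> B powr \<alpha>"
        using B closure_subset[of A] \<alpha> by (intro always_eventually allI impI) (simp add: powr_mono2 subsetD)
    qed (use A' measurable_lebesgue_continuous[OF u] in auto)
    then show ?thesis
      using A' measurable_lebesgue_continuous[OF u]
      by (simp add: Lp_fun_def integrable_restrict_space measurable_restrict_space1)
  qed
  show ?thesis
    using weak_X_lin_fun[OF A(1)] Lp[OF Ck_continuous[OF Ck_linear[OF linear_lin_fun]]] Lp[OF continuous_on_const]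
    unfolding W_space_def by (intro CollectI conjI allI bexI)
qed

lemma W_space_add:
  fixes A :: "'n::finite heis set"
  assumes A: "open A" and \<alpha>: "\<alpha> > 0" and u: "u \<in> W_space \<alpha> A" and v: "v \<in> W_space \<alpha> A"
  shows "(\<lambda>x. u x + v x) \<in> W_space \<alpha> A"
proof -
  have Lp: "(\<lambda>x. f x + g x) \<in> Lp_fun \<alpha> A" if "f \<in> Lp_fun \<alpha> A" "g \<in> Lp_fun \<alpha> A" for f g
    using that integrable_norm_powr_add[of \<alpha> f "lebesgue_on A" g] \<alpha> by (auto simp: Lp_fun_def)
  have "\<exists>z\<in>Lp_fun \<alpha> A. weak_X A j (\<lambda>x. u x + v x) z" for j
  proof -
    obtain w z where "w \<in> Lp_fun \<alpha> A" "weak_X A j u w" "z \<in> Lp_fun \<alpha> A" "weak_X A j v z"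
      using u v unfolding W_space_def by blast
    then show ?thesis
      using Lp weak_X_lin[OF A, of j u w v z 1] by (intro bexI[of _ "\<lambda>x. w x + z x"]) simp_all
  qed
  then show ?thesis
    using Lp u v by (simp add: W_space_def)
qed

text \<open>Writing \<open>u\<close> as \<open>lin_fun q\<close> plus a function \<open>v\<close> in
  the closure of the test functions turns the gradient into \<open>q\<close> plus that of
  \<open>v\<close>. From here on neither \<open>hgrad\<close> nor the Sobolev spaces appear; the
  competitors form a set closed under sums and translations.\<close>

lemma mu_eq_Inf_W0_jets:
  fixes A :: "'n::finite heis set"
  assumes f: "sup_measurable f" and A: "A \<in> sets lebesgue" "A - interior A \<in> null_sets lebesgue" "bounded A"
    and \<alpha>: "\<alpha> > 1"
  shows "mu \<alpha> f q A = Inf ((\<lambda>F. \<integral>x. f x (q + snd (F x)) \<partial>lebesgue_on A) ` W0_jets \<alpha> (interior A))"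
proof -
  have \<alpha>': "\<alpha> > 0" using \<alpha> by simp
  let ?O = "interior A"
  have lin: "weak_X ?O j (lin_fun q) (\<lambda>x. q $ j)" for j
    using open_interior by (rule weak_X_lin_fun)
  have energy: "(\<integral>x. f x (hgrad ?O u x) \<partial>lebesgue_on A) = (\<integral>x. f x (q + snd (F x)) \<partial>lebesgue_on A)"
    if F: "F \<in> W0_jets \<alpha> ?O" and wk: "\<And>j. weak_X ?O j (\<lambda>x. u x - lin_fun q x) (\<lambda>x. snd (F x) $ j)" for F u
  proof (rule energy_AE_eq[OF f A(1,2)])
    show "(\<lambda>x. q + snd (F x)) \<in> borel_measurable lebesgue"
      using jet_components(2)[OF W0_jetsD(1,3)[OF F] \<alpha>'] by simp
    have "weak_X ?O j u (\<lambda>x. (q + snd (F x)) $ j)" for j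
      using weak_X_lin[OF open_interior wk lin, of j 1] by (simp add: add.commute)
    then show "AE x in lebesgue_on ?O. hgrad ?O u x = q + snd (F x)"
      by (rule hgrad_AE_eq[OF open_interior])
  qed
  have "{\<integral>x. f x (hgrad ?O u x) \<partial>lebesgue_on A | u.
      u \<in> W_space \<alpha> ?O \<and> (\<lambda>x. u x - lin_fun q x) \<in> W0_space \<alpha> ?O} =
    (\<lambda>F. \<integral>x. f x (q + snd (F x)) \<partial>lebesgue_on A) ` W0_jets \<alpha> ?O" (is "?L = ?R")
  proof (intro equalityI subsetI)
    fix e assume "e \<in> ?L"
    then obtain u where e: "e = (\<integral>x. f x (hgrad ?O u x) \<partial>lebesgue_on A)"
      and u: "(\<lambda>x. u x - lin_fun q x) \<in> W0_space \<alpha> ?O" by blast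
    obtain F where F: "F \<in> W0_jets \<alpha> ?O" "\<And>j. weak_X ?O j (\<lambda>x. u x - lin_fun q x) (\<lambda>x. snd (F x) $ j)"
      by (rule W0_space_jet[OF open_interior \<alpha> u], rule that)
    show "e \<in> ?R"
      unfolding e energy[OF F] using F(1) by (rule imageI)
  next
    fix e assume "e \<in> ?R"
    then obtain F where e: "e = (\<integral>x. f x (q + snd (F x)) \<partial>lebesgue_on A)" and F: "F \<in> W0_jets \<alpha> ?O" by blast
    define u where "u x = lin_fun q x + fst (F x)" for x
    have diff: "(\<lambda>x. u x - lin_fun q x) = (\<lambda>x. fst (F x))"
      by (simp add: u_def)
    have W0: "(\<lambda>x. fst (F x)) \<in> W0_space \<alpha> ?O"
      by (rule W0_jets_W0_space[OF open_interior \<alpha> F])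
    then have "u \<in> W_space \<alpha> ?O"
      unfolding u_def using A(3) bounded_subset[OF A(3) interior_subset] \<alpha>'
      by (intro W_space_add W_space_lin_fun) (auto simp: W0_space_def)
    moreover have "e = (\<integral>x. f x (hgrad ?O u x) \<partial>lebesgue_on A)"
      using energy[OF F, of u] W0_jets_weak_X[OF F \<alpha> open_interior] unfolding e diff by simp
    ultimately show "e \<in> ?L"
      using W0 diff by auto
  qed
  then show ?thesis by (simp add: mu_def)
qed

text \<open>A non-integrable function has integral 0 by convention, so splitting the energy over
  tiles requires integrability of every piece; the growth bound provides a majorant.\<close>

lemma energy_integrable:
  fixes F :: "'n::finite heis \<Rightarrow> real \<times> 'n horiz"
  assumes f: "sup_measurable f" and f0: "\<And>x p. 0 \<le> f x p" and f1: "\<And>x p. f x p \<le> C * (norm p powr \<alpha> + 1)"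
    and \<alpha>: "\<alpha> > 0" and C: "C > 0"
    and A: "A \<in> sets lebesgue" "bounded A" and F: "F \<in> W0_jets \<alpha> B"
  shows "integrable lebesgue (\<lambda>x. indicator A x * f x (q + snd (F x)))"
proof (rule Bochner_Integration.integrable_bound)
  let ?b = "\<lambda>x. C * (2 powr \<alpha> * (norm q powr \<alpha> * indicator A x + norm (F x) powr \<alpha>) + indicator A x)"
  have "emeasure lebesgue A < \<infinity>"
    using fmeasurableD2[OF bounded_set_imp_lmeasurable[OF A(2,1)]] by (simp add: less_top)
  then show "integrable lebesgue ?b"
    using A(1) W0_jetsD(3)[OF F]
    by (intro integrable_mult_right Bochner_Integration.integrable_add integrable_real_indicator) auto
  show "(\<lambda>x. indicator A x * f x (q + snd (F x))) \<in> borel_measurable lebesgue"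
    using A(1) jet_components(2)[OF W0_jetsD(1,3)[OF F] \<alpha>]
    by (intro borel_measurable_times borel_measurable_indicator integrand_measurable[OF f]) simp_all
  show "AE x in lebesgue. norm (indicator A x * f x (q + snd (F x))) \<le> norm (?b x)"
  proof (intro always_eventually allI)
    fix x
    have "indicator A x * f x (q + snd (F x)) \<le> ?b x"
    proof (cases "x \<in> A")
      case True
      have "f x (q + snd (F x)) \<le> C * (norm (q + snd (F x)) powr \<alpha> + 1)"
        by (rule f1)
      also have "\<dots> \<le> C * (2 powr \<alpha> * (norm q powr \<alpha> + norm (snd (F x)) powr \<alpha>) + 1)"
        using \<alpha> C by (intro mult_left_mono add_right_mono norm_add_powr_le) auto
      also have "\<dots> \<le> C * (2 powr \<alpha> * (norm q powr \<alpha> + norm (F x) powr \<alpha>) + 1)"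
        using \<alpha> C norm_snd_le[of "snd (F x)" "fst (F x)"]
        by (intro mult_left_mono add_right_mono add_left_mono powr_mono2) auto
      finally show ?thesis using True by simp
    next
      case False
      then show ?thesis using C by simp
    qed
    moreover have "0 \<le> indicator A x * f x (q + snd (F x))"
      using f0 by simp
    ultimately show "norm (indicator A x * f x (q + snd (F x))) \<le> norm (?b x)"
      unfolding real_norm_def by linarith
  qed
qed

section \<open>Tiles and the glued competitor\<close>

lemma tile_iff: "x \<in> hmul c ` A \<longleftrightarrow> hmul (- c) x \<in> A"
proof
  assume "hmul (- c) x \<in> A"
  then have "hmul c (hmul (- c) x) \<in> hmul c ` A" by (rule imageI)
  then show "x \<in> hmul c ` A" by simp
qed auto

lemma tile_measurable:
  assumes "A \<in> sets lebesgue"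
  shows "hmul c ` A \<in> sets lebesgue"
proof -
  have "hmul (- c) -` A \<inter> space lebesgue \<in> sets lebesgue"
    using lebesgue_measure_preserving(1)[OF hmul_preserves] assms by (rule measurable_sets)
  moreover have "hmul (- c) -` A \<inter> space lebesgue = hmul c ` A"
    by (simp add: set_eq_iff tile_iff del: split_paired_All)
  ultimately show ?thesis by simp
qed

text \<open>Both integral claims come from one pointwise splitting of the indicator of
  \<open>Q'\<close> into indicators of the tiles and of the remainder \<open>R\<close>. On a tile,
  periodicity turns the integrand into a translate of the one on \<open>Q\<close>; on
  \<open>R\<close> the gradient is just \<open>q\<close>, and the growth bound applies.\<close>

lemma glued_jet:
  fixes f :: "'n::finite heis \<Rightarrow> 'n horiz \<Rightarrow> real" and T Q Q' :: "'n heis set"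
  assumes f: "sup_measurable f" and f0: "\<And>x p. 0 \<le> f x p" and f1: "\<And>x p. f x p \<le> C * (norm p powr \<alpha> + 1)"
    and \<alpha>: "\<alpha> > 1" and C: "C > 0"
    and Q: "Q \<in> sets lebesgue" "bounded Q" and Q': "Q' \<in> sets lebesgue" "bounded Q'"
    and F: "F \<in> W0_jets \<alpha> (interior Q)"
    and T: "finite T" and sub: "\<And>c. c \<in> T \<Longrightarrow> hmul c ` Q \<subseteq> Q'"
    and disj: "\<And>c d x. c \<in> T \<Longrightarrow> d \<in> T \<Longrightarrow> x \<in> hmul c ` Q \<Longrightarrow> x \<in> hmul d ` Q \<Longrightarrow> c = d"
    and per: "\<And>c x p. c \<in> T \<Longrightarrow> f (hmul c x) p = f x p"
  defines "G \<equiv> \<lambda>x. \<Sum>c\<in>T. F (hmul (- c) x)"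
  defines "R \<equiv> Q' - (\<Union>c\<in>T. hmul c ` Q)"
  shows "G \<in> W0_jets \<alpha> (interior Q')"
    and "(\<integral>x. f x (q + snd (G x)) \<partial>lebesgue_on Q') \<le>
      real (card T) * (\<integral>x. f x (q + snd (F x)) \<partial>lebesgue_on Q) + C * (norm q powr \<alpha> + 1) * measure lebesgue R"
    and "measure lebesgue Q' = real (card T) * measure lebesgue Q + measure lebesgue R"
proof -
  have \<alpha>': "\<alpha> > 0" using \<alpha> by simp
  have "(\<lambda>x. F (hmul (- c) x)) \<in> W0_jets \<alpha> (interior Q')" if c: "c \<in> T" for c
  proof (rule W0_jets_hmul[OF F \<alpha>'])
    have "open (hmul c ` interior Q)"
    proof -
      have "continuous_on UNIV (hmul (- c))"
        unfolding hmul_eq by (intro continuous_intros linear_continuous_on linear_hlin linear_conv_bounded_linear[THEN iffD1])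
      then have "open (hmul (- c) -` interior Q)"
        by (simp add: open_vimage)
      moreover have "hmul (- c) -` interior Q = hmul c ` interior Q"
        by (simp add: set_eq_iff tile_iff del: split_paired_All)
      ultimately show ?thesis by simp
    qed
    moreover have "hmul c ` interior Q \<subseteq> Q'"
      using sub[OF c] interior_subset by blast
    ultimately show "hmul c x \<in> interior Q'" if "x \<in> interior Q" for x
      using that interior_maximal by blast
  qed
  then show G: "G \<in> W0_jets \<alpha> (interior Q')"
    unfolding G_def using \<alpha>' by (rule W0_jets_sum)
  note tile_meas = tile_measurable[OF Q(1)]
  have R: "R \<in> sets lebesgue" "bounded R"
    unfolding R_def using sets.Diff[OF Q'(1) sets.finite_UN[OF T tile_meas]] bounded_subset[OF Q'(2)] by auto
  have uniq: "d = c" if "c \<in> T" "d \<in> T" "hmul (- c) x \<in> Q" "hmul (- d) x \<in> Q" for c d x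
    by (rule disj[OF that(2,1), of x]) (simp_all only: tile_iff that)
  \<comment> \<open>A point of \<open>Q'\<close> lies in exactly one tile or else in
    \<open>R\<close>.\<close>
  have part: "indicator Q' x = (\<Sum>c\<in>T. indicator Q (hmul (- c) x)) + (indicator R x :: real)" for x
  proof (cases "\<exists>c\<in>T. x \<in> hmul c ` Q")
    case True
    then obtain c where c: "c \<in> T" "x \<in> hmul c ` Q" by blast
    from c(2) have cQ: "hmul (- c) x \<in> Q" by (simp only: tile_iff)
    have "indicator Q (hmul (- d) x) = (if d = c then 1 else (0::real))" if "d \<in> T" for d
      using uniq[OF c(1) that cQ] cQ by (cases "hmul (- d) x \<in> Q") (simp_all, metis)
    then have "(\<Sum>d\<in>T. indicator Q (hmul (- d) x)) = (\<Sum>d\<in>T. if d = c then 1 else (0::real))"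
      by (rule sum.cong[OF refl])
    moreover have "x \<in> Q'" "x \<notin> R"
      using c subsetD[OF sub[OF c(1)] c(2)] by (simp only:, unfold R_def, blast)
    ultimately show ?thesis using T c(1) by simp
  next
    case False
    then have "indicator Q (hmul (- d) x) = (0::real)" if "d \<in> T" for d
      using that by (simp add: tile_iff)
    then have "(\<Sum>d\<in>T. indicator Q (hmul (- d) x)) = (0::real)"
      by (rule sum.neutral[OF ballI])
    moreover have "x \<in> R \<longleftrightarrow> x \<in> Q'"
      unfolding R_def using False by blast
    ultimately show ?thesis by (simp add: indicator_def)
  qed
  have F0: "F y = 0" if "y \<notin> Q" for y
    by (rule W0_jetsD(2)[OF F]) (use that interior_subset in blast)
  \<comment> \<open>The other translates of \<open>F\<close> vanish here, because the tiles are
    disjoint and \<open>F\<close> is zero off \<open>Q\<close>.\<close>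
  have G_tile: "G x = F (hmul (- c) x)" if c: "c \<in> T" "hmul (- c) x \<in> Q" for c x
  proof -
    have "F (hmul (- d) x) = (if d = c then F (hmul (- c) x) else 0)" if "d \<in> T" for d
      using uniq[OF c(1) that c(2)] F0[of "hmul (- d) x"] by (cases "hmul (- d) x \<in> Q") auto
    then have "G x = (\<Sum>d\<in>T. if d = c then F (hmul (- c) x) else 0)"
      unfolding G_def by (rule sum.cong[OF refl])
    then show ?thesis using T c(1) by simp
  qed
  \<comment> \<open>On the remainder the competitor is \<open>lin_fun q\<close> itself.\<close>
  have G_R: "G x = 0" if "x \<in> R" for x
  proof -
    have "F (hmul (- c) x) = 0" if "c \<in> T" for c
    proof (rule F0)
      have "x \<notin> hmul c ` Q"
        using \<open>x \<in> R\<close> that unfolding R_def by blast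
      then show "hmul (- c) x \<notin> Q" by (simp only: tile_iff not_False_eq_True)
    qed
    then show ?thesis
      unfolding G_def by (rule sum.neutral[OF ballI])
  qed
  let ?e = "\<lambda>x. indicator Q x * f x (q + snd (F x))" and ?r = "\<lambda>x. indicator R x * f x (q + snd (G x))"
  have split: "indicator Q' x * f x (q + snd (G x)) = (\<Sum>c\<in>T. ?e (hmul (- c) x)) + ?r x" for x
  proof -
    have "indicator Q (hmul (- c) x) * f x (q + snd (G x)) = ?e (hmul (- c) x)" if "c \<in> T" for c
      using G_tile[OF that] per[OF that, of "hmul (- c) x"] by (cases "hmul (- c) x \<in> Q") auto
    then have "(\<Sum>c\<in>T. indicator Q (hmul (- c) x) * f x (q + snd (G x))) = (\<Sum>c\<in>T. ?e (hmul (- c) x))"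
      by (rule sum.cong[OF refl])
    then show ?thesis
      by (simp only: part[of x] distrib_right sum_distrib_right)
  qed
  have int_e: "integrable lebesgue ?e"
    using energy_integrable[OF f f0 f1 \<alpha>' C Q F] .
  have int_r: "integrable lebesgue ?r"
    using energy_integrable[OF f f0 f1 \<alpha>' C R G] .
  have int_e': "integrable lebesgue (\<lambda>x. ?e (hmul (- c) x))" "(\<integral>x. ?e (hmul (- c) x) \<partial>lebesgue) = (\<integral>x. ?e x \<partial>lebesgue)" for c
    using integrable_compose_preserving[OF hmul_preserves borel_measurable_integrable[OF int_e], of "- c"]
      integral_compose_preserving[OF hmul_preserves borel_measurable_integrable[OF int_e], of "- c"] int_e by auto
  have finR: "emeasure lebesgue R < \<infinity>" and finQ: "emeasure lebesgue Q < \<infinity>"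
    using fmeasurableD2[OF bounded_set_imp_lmeasurable[OF R(2,1)]] fmeasurableD2[OF bounded_set_imp_lmeasurable[OF Q(2,1)]]
    by (simp_all add: less_top)
  have "(\<integral>x. f x (q + snd (G x)) \<partial>lebesgue_on Q') = (\<integral>x. indicator Q' x *\<^sub>R f x (q + snd (G x)) \<partial>lebesgue)"
    using Q'(1) by (intro integral_restrict_space) simp
  also have "\<dots> = (\<integral>x. (\<Sum>c\<in>T. ?e (hmul (- c) x)) + ?r x \<partial>lebesgue)"
    by (intro Bochner_Integration.integral_cong refl) (simp only: real_scaleR_def split)
  also have "\<dots> = (\<Sum>c\<in>T. \<integral>x. ?e (hmul (- c) x) \<partial>lebesgue) + (\<integral>x. ?r x \<partial>lebesgue)"
    using int_e'(1) int_r
    by (subst Bochner_Integration.integral_add, intro Bochner_Integration.integrable_sum, blast, blast)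
      (subst Bochner_Integration.integral_sum, simp_all)
  also have "(\<Sum>c\<in>T. \<integral>x. ?e (hmul (- c) x) \<partial>lebesgue) = real (card T) * (\<integral>x. ?e x \<partial>lebesgue)"
    by (simp only: int_e'(2) sum_constant)
  also have "(\<integral>x. ?e x \<partial>lebesgue) = (\<integral>x. f x (q + snd (F x)) \<partial>lebesgue_on Q)"
    using Q(1) by (subst integral_restrict_space) simp_all
  also have "(\<integral>x. ?r x \<partial>lebesgue) \<le> (\<integral>x. C * (norm q powr \<alpha> + 1) * indicator R x \<partial>lebesgue)"
  proof (rule integral_mono[OF int_r])
    show "integrable lebesgue (\<lambda>x. C * (norm q powr \<alpha> + 1) * indicator R x)"
      using R(1) finR by (intro integrable_mult_right integrable_real_indicator) auto
    show "?r x \<le> C * (norm q powr \<alpha> + 1) * indicator R x" for x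
      using G_R[of x] f1[of x q] by (auto simp: indicator_def)
  qed
  also have "\<dots> = C * (norm q powr \<alpha> + 1) * measure lebesgue R"
    using R(1) by simp
  finally show "(\<integral>x. f x (q + snd (G x)) \<partial>lebesgue_on Q') \<le>
      real (card T) * (\<integral>x. f x (q + snd (F x)) \<partial>lebesgue_on Q) + C * (norm q powr \<alpha> + 1) * measure lebesgue R"
    by simp
  have ind: "integrable lebesgue (indicator Q :: 'n heis \<Rightarrow> real)" "integrable lebesgue (indicator R :: 'n heis \<Rightarrow> real)"
    using Q(1) R(1) finR finQ by (auto intro!: integrable_real_indicator)
  have ind': "integrable lebesgue (\<lambda>x. indicator Q (hmul (- c) x) :: real)"
    "(\<integral>x. indicator Q (hmul (- c) x) \<partial>lebesgue) = measure lebesgue Q" for c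
    using integrable_compose_preserving[OF hmul_preserves borel_measurable_integrable[OF ind(1)], of "- c"]
      integral_compose_preserving[OF hmul_preserves borel_measurable_integrable[OF ind(1)], of "- c"] ind(1) Q(1) by auto
  have "measure lebesgue Q' = (\<integral>x. indicator Q' x \<partial>lebesgue)"
    using Q'(1) by simp
  also have "\<dots> = (\<integral>x. (\<Sum>c\<in>T. indicator Q (hmul (- c) x)) + indicator R x \<partial>lebesgue)"
    by (simp only: part)
  also have "\<dots> = (\<Sum>c\<in>T. \<integral>x. indicator Q (hmul (- c) x) \<partial>lebesgue) + (\<integral>x. indicator R x \<partial>lebesgue)"
    using ind'(1) ind(2)
    by (subst Bochner_Integration.integral_add, intro Bochner_Integration.integrable_sum, blast, blast)
      (subst Bochner_Integration.integral_sum, simp_all)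
  also have "\<dots> = real (card T) * measure lebesgue Q + measure lebesgue R"
    using R(1) by (simp only: ind'(2) sum_constant) simp
  finally show "measure lebesgue Q' = real (card T) * measure lebesgue Q + measure lebesgue R" .
qed

section \<open>The tiling by translates of the boxes\<close>

text \<open>Upper corner of the symmetric box with half-widths \<open>s\<close> horizontally and
  \<open>t\<close> vertically; the two are separate because dilations scale them
  differently.\<close>

definition hcorner :: "real \<Rightarrow> real \<Rightarrow> 'n::finite heis" where
  "hcorner s t = (\<chi> i. s, \<chi> i. s, t)"

lemma mem_cbox_hcorner:
  "x \<in> cbox (- hcorner s t) (hcorner s t) \<longleftrightarrow>
    (\<forall>i. \<bar>fst x $ i\<bar> \<le> s) \<and> (\<forall>i. \<bar>fst (snd x) $ i\<bar> \<le> s) \<and> \<bar>snd (snd x)\<bar> \<le> t"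
  by (cases x) (auto simp: hcorner_def cbox_Pair_eq mem_box_cart abs_le_iff minus_le_iff)

lemma mem_box_hcorner:
  "x \<in> box (- hcorner s t) (hcorner s t) \<longleftrightarrow>
    (\<forall>i. \<bar>fst x $ i\<bar> < s) \<and> (\<forall>i. \<bar>fst (snd x) $ i\<bar> < s) \<and> \<bar>snd (snd x)\<bar> < t"
proof -
  have box_Pair: "box (a, c) (b, d) = box a b \<times> box c d"
    for a b :: "'u::euclidean_space" and c d :: "'v::euclidean_space"
    by (auto simp: box_def Basis_prod_def ball_Un)
  show ?thesis
    by (cases x) (auto simp: hcorner_def box_Pair mem_box_cart abs_less_iff minus_less_iff)
qed

lemma measure_cbox_hcorner:
  assumes "s \<ge> 0" "t \<ge> 0"
  shows "measure lebesgue (cbox (- hcorner s t) (hcorner s t) :: 'n::finite heis set) =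
    (2 * s) ^ CARD('n) * ((2 * s) ^ CARD('n) * (2 * t))"
proof -
  have "measure lborel (cbox (- (\<chi> i. s)) (\<chi> i. s) :: (real^'n) set) = (2 * s) ^ CARD('n)"
    using assms by (subst content_cbox_cart) (auto simp: interval_ne_empty_cart)
  then show ?thesis
    using assms by (simp add: hcorner_def content_Pair)
qed

lemma mem_cubeQk:
  assumes "k \<ge> 1"
  shows "x \<in> cubeQk k \<longleftrightarrow> (\<forall>i. - real k \<le> fst x $ i \<and> fst x $ i < real k) \<and>
    (\<forall>i. - real k \<le> fst (snd x) $ i \<and> fst (snd x) $ i < real k) \<and>
    - (real k)\<^sup>2 \<le> snd (snd x) \<and> snd (snd x) < (real k)\<^sup>2"
proof -
  have k: "real k > 0" using assms by simp
  have inv: "hdil (real k) (hdil (1 / real k) x) = x" for x :: "'a heis"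
    using k by (simp add: hdil_def split_beta power_one_over)
  have inv': "hdil (1 / real k) (hdil (real k) x) = x" for x :: "'a heis"
    using k by (simp add: hdil_def split_beta power_one_over)
  have "x \<in> cubeQk k \<longleftrightarrow> hdil (1 / real k) x \<in> cubeQ"
  proof
    assume "x \<in> cubeQk k"
    then obtain y where "y \<in> cubeQ" "x = hdil (real k) y"
      unfolding cubeQk_def by blast
    then show "hdil (1 / real k) x \<in> cubeQ"
      by (simp only: inv')
  next
    assume "hdil (1 / real k) x \<in> cubeQ"
    then have "hdil (real k) (hdil (1 / real k) x) \<in> cubeQk k"
      unfolding cubeQk_def by (rule imageI)
    then show "x \<in> cubeQk k"
      by (simp only: inv)
  qed
  then show ?thesis
    using k by (simp add: hdil_def cubeQ_def split_beta field_simps power_one_over)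
qed

lemma cubeQk_boxes:
  assumes "k \<ge> 1"
  shows "box (- hcorner (real k) ((real k)\<^sup>2)) (hcorner (real k) ((real k)\<^sup>2)) \<subseteq> cubeQk k"
    and "cubeQk k \<subseteq> cbox (- hcorner (real k) ((real k)\<^sup>2)) (hcorner (real k) ((real k)\<^sup>2))"
  unfolding subset_iff mem_cubeQk[OF assms] mem_box_hcorner mem_cbox_hcorner
  by (simp_all add: abs_less_iff abs_le_iff less_imp_le minus_less_iff minus_le_iff)

text \<open>The half-open box is sandwiched between an open and a closed box that differ by a null
  set.\<close>

lemma cubeQk_lebesgue:
  fixes k :: nat
  assumes "k \<ge> 1"
  defines "Q \<equiv> cubeQk k :: 'n::finite heis set"
  shows "Q \<in> sets lebesgue" "bounded Q" "Q - interior Q \<in> null_sets lebesgue"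
    "measure lebesgue Q = (2 * real k) ^ CARD('n) * ((2 * real k) ^ CARD('n) * (2 * (real k)\<^sup>2))"
proof -
  let ?v = "hcorner (real k) ((real k)\<^sup>2) :: 'n heis"
  have boxes: "box (- ?v) ?v \<subseteq> Q" "Q \<subseteq> cbox (- ?v) ?v"
    unfolding Q_def by (rule cubeQk_boxes[OF assms(1)])+
  have null: "cbox (- ?v) ?v - box (- ?v) ?v \<in> null_sets lebesgue"
    using negligible_frontier_interval by (simp add: negligible_iff_null_sets)
  have Q: "Q = cbox (- ?v) ?v - (cbox (- ?v) ?v - Q)"
    using boxes(2) by blast
  have null': "cbox (- ?v) ?v - Q \<in> null_sets lebesgue"
    by (rule null_sets_completion_subset[OF _ null]) (use boxes(1) in blast)
  show Q_sets: "Q \<in> sets lebesgue"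
    by (subst Q) (use null' in auto)
  show "bounded Q"
    using bounded_cbox boxes(2) by (rule bounded_subset)
  show "Q - interior Q \<in> null_sets lebesgue"
  proof (rule null_sets_completion_subset[OF _ null])
    have "box (- ?v) ?v \<subseteq> interior Q"
      using boxes(1) open_box by (rule interior_maximal)
    then show "Q - interior Q \<subseteq> cbox (- ?v) ?v - box (- ?v) ?v"
      using boxes(2) by blast
  qed
  have "measure lebesgue Q = measure lebesgue (cbox (- ?v) ?v)"
    by (subst Q) (rule measure_Diff_null_set[OF _ null'], simp)
  also have "\<dots> = (2 * real k) ^ CARD('n) * ((2 * real k) ^ CARD('n) * (2 * (real k)\<^sup>2))"
    by (rule measure_cbox_hcorner) simp_all
  finally show "measure lebesgue Q = (2 * real k) ^ CARD('n) * ((2 * real k) ^ CARD('n) * (2 * (real k)\<^sup>2))" .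
qed

section \<open>The lattice of tile centres and the tiling property\<close>

lemma mem_int_points:
  "p \<in> int_points \<longleftrightarrow> (\<forall>i. fst p $ i \<in> \<int>) \<and> (\<forall>i. fst (snd p) $ i \<in> \<int>) \<and> snd (snd p) \<in> \<int>"
  by (cases p) (simp add: int_points_def)

text \<open>This is \<open>\<delta>\<^sub>k (2 \<int>\<^sup>N)\<close>; the left translates of \<open>Q\<^sup>k\<close> by it tile the group.\<close>

definition tiling_lattice :: "nat \<Rightarrow> 'n::finite heis set" where
  "tiling_lattice k = (\<lambda>p. 2 *\<^sub>R hdil (real k) p) ` int_points"

text \<open>Since \<open>k\<close> is an integer, the dilation maps integer points to integer
  points, so every tile centre is one of the periods of \<open>f\<close>.\<close>

lemma tiling_lattice_int_points:
  assumes "c \<in> tiling_lattice k"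
  obtains p where "p \<in> int_points" "c = 2 *\<^sub>R p"
proof -
  obtain p where p: "p \<in> int_points" "c = 2 *\<^sub>R hdil (real k) p"
    using assms by (auto simp: tiling_lattice_def)
  then have "hdil (real k) p \<in> int_points"
    by (auto simp: mem_int_points hdil_def split_beta)
  then show ?thesis using p(2) by (rule that)
qed

lemma tile_exists_scalar:
  fixes K y :: real
  assumes "K > 0"
  obtains a where "a \<in> \<int>" "- K \<le> y - 2 * (K * a)" "y - 2 * (K * a) < K"
proof -
  \<comment> \<open>The condition - K \<le> y - 2 K a < K amounts to a \<le> (y + K) / (2 K) < a +
    1.\<close>
  define a where "a = real_of_int \<lfloor>(y + K) / (2 * K)\<rfloor>"
  have "a \<le> (y + K) / (2 * K)" "(y + K) / (2 * K) < a + 1"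
    unfolding a_def by linarith+
  then have "a * (2 * K) \<le> y + K" "y + K < (a + 1) * (2 * K)"
    using assms by (simp_all add: pos_le_divide_eq pos_divide_less_eq)
  then show ?thesis
    by (intro that[of a]) (auto simp: a_def algebra_simps)
qed

lemma tile_unique_scalar:
  fixes K y :: real
  assumes "K > 0" "a \<in> \<int>" "b \<in> \<int>" "- K \<le> y - 2 * (K * a)" "y - 2 * (K * a) < K"
    "- K \<le> y - 2 * (K * b)" "y - 2 * (K * b) < K"
  shows "a = b"
proof -
  have "2 * K * \<bar>a - b\<bar> = \<bar>2 * K * (a - b)\<bar>"
    using assms(1) by (simp add: abs_mult)
  also have "\<dots> < 2 * K * 1"
    using assms(4-7) by (simp add: algebra_simps)
  finally have "\<bar>a - b\<bar> < 1"
    using assms(1) by simp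
  moreover have "a - b \<in> \<int>"
    using assms by simp
  ultimately have "a - b = 0"
    using Ints_nonzero_abs_less1 by blast
  then show ?thesis by simp
qed

text \<open>The conditions are triangular: each horizontal entry of \<open>p\<close> is subject to a
  scalar condition of its own, and once these entries are fixed, the shear merely shifts the
  vertical coordinate, leaving one scalar condition on the last entry. Existence and uniqueness of
  the tile thus reduce to the scalar case.\<close>

lemma mem_tile_cubeQk:
  fixes p x :: "'n::finite heis"
  assumes k: "k \<ge> 1"
  shows "hmul (- (2 *\<^sub>R hdil (real k) p)) x \<in> cubeQk k \<longleftrightarrow>
    (\<forall>i. - real k \<le> fst x $ i - 2 * (real k * fst p $ i) \<and> fst x $ i - 2 * (real k * fst p $ i) < real k) \<and>
    (\<forall>i. - real k \<le> fst (snd x) $ i - 2 * (real k * fst (snd p) $ i) \<and>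
      fst (snd x) $ i - 2 * (real k * fst (snd p) $ i) < real k) \<and>
    - (real k)\<^sup>2 \<le> (snd (snd x) + real k * (fst (snd p) \<bullet> fst x - fst p \<bullet> fst (snd x))) - 2 * ((real k)\<^sup>2 * snd (snd p)) \<and>
    (snd (snd x) + real k * (fst (snd p) \<bullet> fst x - fst p \<bullet> fst (snd x))) - 2 * ((real k)\<^sup>2 * snd (snd p)) < (real k)\<^sup>2"
proof -
  let ?y = "hmul (- (2 *\<^sub>R hdil (real k) p)) x"
  have "fst ?y $ i = fst x $ i - 2 * (real k * fst p $ i)"
    "fst (snd ?y) $ i = fst (snd x) $ i - 2 * (real k * fst (snd p) $ i)" for i
    by (simp_all add: hmul_def hdil_def split_beta)
  moreover have "snd (snd ?y) =
      (snd (snd x) + real k * (fst (snd p) \<bullet> fst x - fst p \<bullet> fst (snd x))) - 2 * ((real k)\<^sup>2 * snd (snd p))"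
    by (simp add: hmul_def hdil_def split_beta field_simps)
  ultimately show ?thesis
    unfolding mem_cubeQk[OF k] by (simp only:)
qed

lemma tile_exists:
  fixes x :: "'n::finite heis"
  assumes k: "k \<ge> 1"
  obtains c where "c \<in> tiling_lattice k" "hmul (- c) x \<in> cubeQk k"
proof -
  have k': "real k > 0" "(real k)\<^sup>2 > 0" using k by auto
  have "\<forall>i. \<exists>a. a \<in> \<int> \<and> - real k \<le> fst x $ i - 2 * (real k * a) \<and> fst x $ i - 2 * (real k * a) < real k"
    using tile_exists_scalar[OF k'(1)] by metis
  then obtain a where a: "\<And>i. a i \<in> \<int> \<and> - real k \<le> fst x $ i - 2 * (real k * a i) \<and> fst x $ i - 2 * (real k * a i) < real k"
    by metis
  have "\<forall>i. \<exists>b. b \<in> \<int> \<and> - real k \<le> fst (snd x) $ i - 2 * (real k * b) \<and> fst (snd x) $ i - 2 * (real k * b) < real k"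
    using tile_exists_scalar[OF k'(1)] by metis
  then obtain b where b: "\<And>i. b i \<in> \<int> \<and> - real k \<le> fst (snd x) $ i - 2 * (real k * b i) \<and> fst (snd x) $ i - 2 * (real k * b i) < real k"
    by metis
  obtain d where d: "d \<in> \<int>"
    "- (real k)\<^sup>2 \<le> (snd (snd x) + real k * ((\<chi> i. b i) \<bullet> fst x - (\<chi> i. a i) \<bullet> fst (snd x))) - 2 * ((real k)\<^sup>2 * d)"
    "(snd (snd x) + real k * ((\<chi> i. b i) \<bullet> fst x - (\<chi> i. a i) \<bullet> fst (snd x))) - 2 * ((real k)\<^sup>2 * d) < (real k)\<^sup>2"
    by (rule tile_exists_scalar[OF k'(2)])
  let ?p = "(\<chi> i. a i, \<chi> i. b i, d) :: 'n heis"
  have "?p \<in> int_points"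
    using a b d by (simp add: mem_int_points)
  then have "2 *\<^sub>R hdil (real k) ?p \<in> tiling_lattice k"
    by (simp add: tiling_lattice_def)
  moreover have "hmul (- (2 *\<^sub>R hdil (real k) ?p)) x \<in> cubeQk k"
    unfolding mem_tile_cubeQk[OF k] using a b d by simp
  ultimately show ?thesis by (rule that)
qed

lemma tile_unique:
  fixes x :: "'n::finite heis"
  assumes k: "k \<ge> 1" and c: "c \<in> tiling_lattice k" "hmul (- c) x \<in> cubeQk k"
    and d: "d \<in> tiling_lattice k" "hmul (- d) x \<in> cubeQk k"
  shows "c = d"
proof -
  have k': "real k > 0" "(real k)\<^sup>2 > 0" using k by auto
  obtain p r where p: "p \<in> int_points" "c = 2 *\<^sub>R hdil (real k) p" and r: "r \<in> int_points" "d = 2 *\<^sub>R hdil (real k) r"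
    using c(1) d(1) unfolding tiling_lattice_def by blast
  have ints: "fst p $ i \<in> \<int>" "fst (snd p) $ i \<in> \<int>" "snd (snd p) \<in> \<int>"
    "fst r $ i \<in> \<int>" "fst (snd r) $ i \<in> \<int>" "snd (snd r) \<in> \<int>" for i
    using p(1) r(1) by (simp_all add: mem_int_points)
  note P = c(2)[unfolded p(2) mem_tile_cubeQk[OF k]] and R = d(2)[unfolded r(2) mem_tile_cubeQk[OF k]]
  have 1: "fst p = fst r"
    unfolding vec_eq_iff using P R ints k' by (intro allI tile_unique_scalar[OF k'(1)]) blast+
  have 2: "fst (snd p) = fst (snd r)"
    unfolding vec_eq_iff using P R ints k' by (intro allI tile_unique_scalar[OF k'(1)]) blast+
  \<comment> \<open>The horizontal parts agree by now, so both vertical conditions concern the same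
    shifted coordinate.\<close>
  have "snd (snd p) = snd (snd r)"
    using P R[folded 1 2] by (intro tile_unique_scalar[OF k'(2) ints(3,6)]) blast+
  with 1 2 have "p = r" by (simp add: prod_eq_iff)
  then show ?thesis using p r by simp
qed

section \<open>Tiles that stay inside a larger box\<close>

lemma abs_inner_le_card:
  fixes u v :: "real^'n::finite"
  assumes "\<And>i. \<bar>u $ i\<bar> \<le> a" "\<And>i. \<bar>v $ i\<bar> \<le> b"
  shows "\<bar>u \<bullet> v\<bar> \<le> real CARD('n) * (a * b)"
proof -
  have a: "a \<ge> 0" using assms(1)[of undefined] by simp
  have "\<bar>u \<bullet> v\<bar> \<le> (\<Sum>i\<in>UNIV. \<bar>u $ i * v $ i\<bar>)"
    unfolding inner_vec_def by (simp add: sum_abs)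
  also have "\<dots> \<le> (\<Sum>i\<in>(UNIV :: 'n set). a * b)"
    using assms a by (intro sum_mono) (simp add: abs_mult mult_mono)
  finally show ?thesis by simp
qed

text \<open>In a tile meeting the inner box, the vertical coordinate varies by at most
  \<open>2 k\<^sup>2 + 2 n k (h + k)\<close>, because left translation shears the box.\<close>

lemma tile_inside:
  fixes x c :: "'n::finite heis" and k h :: nat
  defines "R \<equiv> 2 * real k + 1 + 2 * (real k)\<^sup>2 + 2 * real CARD('n) * real k * (1 + real k)"
  assumes k: "k \<ge> 1" and h: "h \<ge> 1"
    and x: "x \<in> cbox (- hcorner (real h - R) ((real h)\<^sup>2 - R * real h)) (hcorner (real h - R) ((real h)\<^sup>2 - R * real h))"
    and c: "hmul (- c) x \<in> cubeQk k"
  shows "hmul c ` cubeQk k \<subseteq> cubeQk h"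
proof
  fix y assume "y \<in> hmul c ` cubeQk k"
  then obtain b where b: "b \<in> cubeQk k" "y = hmul c b" by blast
  define a where "a = hmul (- c) x"
  have a: "a \<in> cubeQk k" "x = hmul c a"
    using c by (simp_all add: a_def)
  \<comment> \<open>This part of \<open>R\<close> covers the horizontal width 2 k of a tile with
    margin 1; the other summands bound the vertical variation divided by \<open>h\<close>.\<close>
  have R: "R \<ge> 2 * real k + 1"
    by (simp add: R_def)
  have h1: "real h \<ge> 1" using h by simp
  note A = a(1)[unfolded mem_cubeQk[OF k]] and B = b(1)[unfolded mem_cubeQk[OF k]] and X = x[unfolded mem_cbox_hcorner]
  have d1: "\<bar>(fst b - fst a) $ i\<bar> \<le> 2 * real k" "\<bar>(fst (snd b) - fst (snd a)) $ i\<bar> \<le> 2 * real k" for i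
    using A B by (auto simp: abs_le_iff) (smt (verit))+
  have x1: "fst x = fst c + fst a" "fst (snd x) = fst (snd c) + fst (snd a)"
    by (simp_all add: a(2) hmul_def split_beta)
  have c1: "\<bar>fst c $ i\<bar> \<le> real h + real k" "\<bar>fst (snd c) $ i\<bar> \<le> real h + real k" for i
  proof -
    have "\<bar>fst x $ i\<bar> \<le> real h - R" "\<bar>fst (snd x) $ i\<bar> \<le> real h - R" using X by auto
    moreover have "\<bar>fst a $ i\<bar> \<le> real k" "\<bar>fst (snd a) $ i\<bar> \<le> real k" using A by (auto simp: abs_le_iff less_imp_le minus_le_iff)
    ultimately show "\<bar>fst c $ i\<bar> \<le> real h + real k" "\<bar>fst (snd c) $ i\<bar> \<le> real h + real k"
      using R unfolding x1 by auto
  qed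
  have y1: "fst y = fst x + (fst b - fst a)" "fst (snd y) = fst (snd x) + (fst (snd b) - fst (snd a))"
    by (simp_all add: b(2) a(2) hmul_def split_beta)
  \<comment> \<open>Comparing two points of the same tile leaves the horizontal part of
    \<open>c\<close> only in products with bounded differences, so the shear is of order
    \<open>h\<close> rather than h^2.\<close>
  have y3: "snd (snd y) = snd (snd x) + (snd (snd b) - snd (snd a)) +
      (fst c \<bullet> (fst (snd b) - fst (snd a)) - fst (snd c) \<bullet> (fst b - fst a)) / 2"
    by (simp add: b(2) a(2) hmul_def split_beta inner_diff_right field_simps)
  let ?n = "real CARD('n)"
  have sum_bound: "\<bar>u + v + (p - r) / 2\<bar> \<le> \<bar>u\<bar> + V + M" if "\<bar>p\<bar> \<le> M" "\<bar>r\<bar> \<le> M" "\<bar>v\<bar> \<le> V"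
    for u v p r V M :: real
    using that by (simp add: abs_le_iff field_simps) linarith
  have "\<bar>fst c \<bullet> (fst (snd b) - fst (snd a))\<bar> \<le> ?n * ((real h + real k) * (2 * real k))"
    "\<bar>fst (snd c) \<bullet> (fst b - fst a)\<bar> \<le> ?n * ((real h + real k) * (2 * real k))"
    using c1 d1 by (auto intro!: abs_inner_le_card)
  moreover have "\<bar>snd (snd b) - snd (snd a)\<bar> \<le> 2 * (real k)\<^sup>2"
    using A B by (simp add: abs_le_iff)
  ultimately have "\<bar>snd (snd y)\<bar> \<le> \<bar>snd (snd x)\<bar> + 2 * (real k)\<^sup>2 + ?n * ((real h + real k) * (2 * real k))"
    unfolding y3 by (intro sum_bound)
  \<comment> \<open>The terms without a factor \<open>h\<close> are enlarged by one, as h \<ge> 1,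
    so that they can be absorbed by \<open>R * real h\<close>.\<close>
  also have "\<dots> \<le> ((real h)\<^sup>2 - R * real h) + 2 * (real k)\<^sup>2 * real h + ?n * ((real h + real k * real h) * (2 * real k))"
  proof -
    have "2 * (real k)\<^sup>2 * 1 \<le> 2 * (real k)\<^sup>2 * real h" using h1 by (intro mult_left_mono) auto
    moreover have "?n * ((real h + real k * 1) * (2 * real k)) \<le> ?n * ((real h + real k * real h) * (2 * real k))"
      using h1 by (intro mult_left_mono mult_right_mono add_left_mono) auto
    moreover have "\<bar>snd (snd x)\<bar> \<le> (real h)\<^sup>2 - R * real h"
      using X by blast
    ultimately show ?thesis
      unfolding mult_1_right by linarith
  qed
  also have "\<dots> = (real h)\<^sup>2 - (2 * real k + 1) * real h"
    by (simp add: R_def algebra_simps power2_eq_square)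
  also have "\<dots> < (real h)\<^sup>2"
    using h1 by simp
  finally have "\<bar>snd (snd y)\<bar> < (real h)\<^sup>2" .
  moreover have "\<bar>fst y $ i\<bar> < real h" "\<bar>fst (snd y) $ i\<bar> < real h" for i
  proof -
    have "\<bar>fst x $ i\<bar> \<le> real h - R" "\<bar>fst (snd x) $ i\<bar> \<le> real h - R" using X by auto
    then show "\<bar>fst y $ i\<bar> < real h" "\<bar>fst (snd y) $ i\<bar> < real h"
      unfolding y1 using d1[of i] R by simp_all
  qed
  ultimately show "y \<in> cubeQk h"
    using cubeQk_boxes(1)[OF h] by (auto simp: mem_box_hcorner)
qed

text \<open>For fixed \<open>k\<close> and \<open>F\<close> the last term tends to 0 as
  \<open>h\<close> grows. The power is the volume ratio of the inner box of
  \<open>tile_inside\<close> to \<open>cubeQk h\<close>: the half-widths h - R and h^2 - R h are h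
  and h^2 times the same factor 1 - R/h, and there are 2n + 1 sides.\<close>

lemma mu_cubeQk_le:
  fixes f :: "'n::finite heis \<Rightarrow> 'n horiz \<Rightarrow> real" and k h :: nat
  assumes f: "sup_measurable f" and f0: "\<And>x p. 0 \<le> f x p" and f1: "\<And>x p. f x p \<le> C * (norm p powr \<alpha> + 1)"
    and \<alpha>: "\<alpha> > 1" and C: "C > 0"
    and per: "\<And>x p c. c \<in> int_points \<Longrightarrow> f (hmul (2 *\<^sub>R c) x) p = f x p"
  defines "R \<equiv> 2 * real k + 1 + 2 * (real k)\<^sup>2 + 2 * real CARD('n) * real k * (1 + real k)"
  assumes k: "k \<ge> 1" and h: "real h \<ge> R"
    and F: "F \<in> W0_jets \<alpha> (interior (cubeQk k))"
  shows "mu \<alpha> f q (cubeQk h) / measure lebesgue (cubeQk h :: 'n heis set) \<le>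
    (\<integral>x. f x (q + snd (F x)) \<partial>lebesgue_on (cubeQk k)) / measure lebesgue (cubeQk k :: 'n heis set) +
    C * (norm q powr \<alpha> + 1) * (1 - (1 - R / real h) ^ (2 * CARD('n) + 1))"
proof -
  have "R \<ge> 1" by (simp add: R_def)
  then have h1: "h \<ge> 1" and R0: "R \<ge> 0" using h by auto
  let ?Q = "cubeQk k :: 'n heis set" and ?Q' = "cubeQk h :: 'n heis set"
  let ?E = "\<integral>x. f x (q + snd (F x)) \<partial>lebesgue_on ?Q" and ?m = "measure lebesgue :: 'n heis set \<Rightarrow> real"
  let ?w = "hcorner (real h - R) ((real h)\<^sup>2 - R * real h) :: 'n heis"
  note Q = cubeQk_lebesgue[OF k, where 'n='n] and Q' = cubeQk_lebesgue[OF h1, where 'n='n]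
  have Qpos: "?m ?Q > 0" "?m ?Q' > 0"
    using k h1 by (simp_all add: Q(4) Q'(4))
  define T where "T = {c \<in> tiling_lattice k. hmul c ` ?Q \<subseteq> ?Q'}"
  \<comment> \<open>Kept general in \<open>G\<close> and \<open>S\<close> because it serves twice:
    with the zero jet and finite subsets, to prove by counting volume that \<open>T\<close> is
    finite, and then with \<open>F\<close> and all of \<open>T\<close>.\<close>
  have glue: "G \<in> W0_jets \<alpha> (interior ?Q) \<Longrightarrow> finite S \<Longrightarrow> S \<subseteq> T \<Longrightarrow>
      (\<lambda>x. \<Sum>c\<in>S. G (hmul (- c) x)) \<in> W0_jets \<alpha> (interior ?Q') \<and>
      (\<integral>x. f x (q + snd (\<Sum>c\<in>S. G (hmul (- c) x))) \<partial>lebesgue_on ?Q') \<le>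
        real (card S) * (\<integral>x. f x (q + snd (G x)) \<partial>lebesgue_on ?Q) +
        C * (norm q powr \<alpha> + 1) * ?m (?Q' - (\<Union>c\<in>S. hmul c ` ?Q)) \<and>
      ?m ?Q' = real (card S) * ?m ?Q + ?m (?Q' - (\<Union>c\<in>S. hmul c ` ?Q))" for G S
  proof -
    assume G: "G \<in> W0_jets \<alpha> (interior ?Q)" and S: "finite S" "S \<subseteq> T"
    have sub: "hmul c ` ?Q \<subseteq> ?Q'" and lat: "c \<in> tiling_lattice k" if "c \<in> S" for c
      using that S(2) unfolding T_def by blast+
    have disj: "c = d" if "c \<in> S" "d \<in> S" "x \<in> hmul c ` ?Q" "x \<in> hmul d ` ?Q" for c d x
      by (rule tile_unique[OF k lat[OF that(1)] _ lat[OF that(2)]]) (use that(3,4) in \<open>simp_all only: tile_iff\<close>)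
    have per': "f (hmul c x) p = f x p" if c: "c \<in> S" for c x p
    proof -
      obtain r where "r \<in> int_points" "c = 2 *\<^sub>R r"
        by (rule tiling_lattice_int_points[OF lat[OF c]])
      then show ?thesis using per by simp
    qed
    show ?thesis
      using glued_jet[OF f f0 f1 \<alpha> C Q(1,2) Q'(1,2) G S(1) sub disj per'] by (intro conjI)
  qed
  have "finite T"
  proof (rule ccontr)
    assume inf: "infinite T"
    \<comment> \<open>So many disjoint tiles would exceed the volume of the large box.\<close>
    obtain N :: nat where N: "?m ?Q' < real N * ?m ?Q"
      using reals_Archimedean3[OF Qpos(1)] by blast
    obtain S where S: "S \<subseteq> T" "finite S" "card S = N"
      using infinite_arbitrarily_large[OF inf] by blast
    have "?m ?Q' = real N * ?m ?Q + ?m (?Q' - (\<Union>c\<in>S. hmul c ` ?Q))"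
      using glue[OF W0_jets_0 S(2,1)] unfolding S(3) by (elim conjE)
    then show False using N measure_nonneg[of lebesgue "?Q' - (\<Union>c\<in>S. hmul c ` ?Q)"] by linarith
  qed
  define Z where "Z = ?Q' - (\<Union>c\<in>T. hmul c ` ?Q)"
  define G where "G x = (\<Sum>c\<in>T. F (hmul (- c) x))" for x
  have G: "G \<in> W0_jets \<alpha> (interior ?Q')"
    and E: "(\<integral>x. f x (q + snd (G x)) \<partial>lebesgue_on ?Q') \<le> real (card T) * ?E + C * (norm q powr \<alpha> + 1) * ?m Z"
    and m: "?m ?Q' = real (card T) * ?m ?Q + ?m Z"
    using glue[OF F \<open>finite T\<close> subset_refl] unfolding G_def Z_def by (simp_all only:)
  \<comment> \<open>Every point of the inner box lies in some tile, which \<open>tile_inside\<close>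
    places in the large box; so the remainder \<open>Z\<close> avoids the inner box.\<close>
  have inner: "cbox (- ?w) ?w \<subseteq> (\<Union>c\<in>T. hmul c ` ?Q)"
  proof
    fix x assume x: "x \<in> cbox (- ?w) ?w"
    obtain c where c: "c \<in> tiling_lattice k" "hmul (- c) x \<in> ?Q"
      by (rule tile_exists[OF k])
    have "hmul c ` ?Q \<subseteq> ?Q'"
      using tile_inside[OF k h1 x[unfolded R_def] c(2)] .
    then have "c \<in> T" using c(1) unfolding T_def by blast
    moreover have "x \<in> hmul c ` ?Q" using c(2) by (simp only: tile_iff)
    ultimately show "x \<in> (\<Union>c\<in>T. hmul c ` ?Q)" by blast
  qed
  have "?m Z \<le> ?m ?Q' - ?m (cbox (- ?w) ?w)"
  proof -
    have fin: "cbox (- ?w) ?w \<in> fmeasurable lebesgue" "?Q' \<in> fmeasurable lebesgue" "Z \<in> fmeasurable lebesgue"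
    proof -
      show "cbox (- ?w) ?w \<in> fmeasurable lebesgue" "?Q' \<in> fmeasurable lebesgue"
        using bounded_set_imp_lmeasurable[OF Q'(2,1)] by auto
      moreover have "Z \<in> sets lebesgue"
      proof -
        have "hmul c ` ?Q \<in> sets lebesgue" for c
          by (rule tile_measurable[OF Q(1)])
        then show ?thesis
          unfolding Z_def using Q'(1) \<open>finite T\<close> by (intro sets.Diff sets.finite_UN)
      qed
      ultimately show "Z \<in> fmeasurable lebesgue"
        by (rule_tac fmeasurableI2) (auto simp: Z_def)
    qed
    have sub: "cbox (- ?w) ?w \<subseteq> ?Q'"
      using inner unfolding T_def by blast
    have "?m Z \<le> ?m (?Q' - cbox (- ?w) ?w)"
      using fin inner by (intro measure_mono_fmeasurable) (auto simp: Z_def)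
    also have "\<dots> = ?m ?Q' - ?m (cbox (- ?w) ?w)"
      using fin sub by (intro measurable_measure_Diff) auto
    finally show ?thesis .
  qed
  also have "?m (cbox (- ?w) ?w) = (1 - R / real h) ^ (2 * CARD('n) + 1) * ?m ?Q'"
  proof -
    have "(real h)\<^sup>2 - R * real h \<ge> 0"
      using h by (simp add: power2_eq_square mult_right_mono)
    then have "?m (cbox (- ?w) ?w) = (2 * (real h - R)) ^ CARD('n) * ((2 * (real h - R)) ^ CARD('n) * (2 * ((real h)\<^sup>2 - R * real h)))"
      using h by (intro measure_cbox_hcorner) auto
    moreover have "2 * (real h - R) = (1 - R / real h) * (2 * real h)"
      using h1 by (simp add: field_simps)
    moreover have "2 * ((real h)\<^sup>2 - R * real h) = (1 - R / real h) * (2 * (real h)\<^sup>2)"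
      using h1 by (simp add: field_simps power2_eq_square)
    moreover have "(u * s) ^ n * ((u * s) ^ n * (u * t)) = u ^ (2 * n + 1) * (s ^ n * (s ^ n * t))"
      for u s t :: real and n
      by (simp add: power_mult_distrib power_add mult_2)
    ultimately show ?thesis
      by (simp only: Q'(4))
  qed
  also have "?m ?Q' - (1 - R / real h) ^ (2 * CARD('n) + 1) * ?m ?Q' =
      (1 - (1 - R / real h) ^ (2 * CARD('n) + 1)) * ?m ?Q'"
    by (simp only: left_diff_distrib mult_1_left)
  finally have Z: "?m Z / ?m ?Q' \<le> 1 - (1 - R / real h) ^ (2 * CARD('n) + 1)"
    using Qpos(2) by (simp only: pos_divide_le_eq)
  have E0: "?E \<ge> 0"
    by (rule integral_nonneg_AE) (simp add: f0)
  have "mu \<alpha> f q ?Q' \<le> (\<integral>x. f x (q + snd (G x)) \<partial>lebesgue_on ?Q')"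
    unfolding mu_eq_Inf_W0_jets[OF f Q'(1,3,2) \<alpha>]
    by (intro cInf_lower imageI G bdd_belowI[of _ 0]) (auto intro!: integral_nonneg_AE simp: f0)
  also note E
  finally have "mu \<alpha> f q ?Q' / ?m ?Q' \<le> (real (card T) * ?E + C * (norm q powr \<alpha> + 1) * ?m Z) / ?m ?Q'"
    using Qpos(2) by (simp add: divide_right_mono)
  also have "\<dots> = real (card T) * ?E / ?m ?Q' + C * (norm q powr \<alpha> + 1) * (?m Z / ?m ?Q')"
    by (simp add: add_divide_distrib)
  also have "\<dots> \<le> ?E / ?m ?Q + C * (norm q powr \<alpha> + 1) * (1 - (1 - R / real h) ^ (2 * CARD('n) + 1))"
  proof (rule add_mono)
    \<comment> \<open>The tiles have total volume at most that of the large box, so their energy per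
      unit volume of it is at most the average on one tile.\<close>
    have "real (card T) * ?m ?Q \<le> ?m ?Q'"
      using m measure_nonneg[of lebesgue Z] by linarith
    then have "?E * (real (card T) * ?m ?Q) \<le> ?E * ?m ?Q'"
      using E0 by (rule mult_left_mono)
    then show "real (card T) * ?E / ?m ?Q' \<le> ?E / ?m ?Q"
      using Qpos by (simp add: field_simps)
    show "C * (norm q powr \<alpha> + 1) * (?m Z / ?m ?Q') \<le> C * (norm q powr \<alpha> + 1) * (1 - (1 - R / real h) ^ (2 * CARD('n) + 1))"
      using Z C by (intro mult_left_mono) auto
  qed
  finally show ?thesis .
qed

theorem theorem5p1:
  fixes f :: "'n::finite heis \<Rightarrow> 'n horiz \<Rightarrow> real"
    and C1 C2 \<alpha> :: real
    and q :: "'n horiz"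
  assumes "sup_measurable f"
    and "C1 > 0" and "C2 > 0" and "\<alpha> > 1"
    and "\<And>x p. C1 * norm p powr \<alpha> \<le> f x p"
    and "\<And>x p. f x p \<le> C2 * (norm p powr \<alpha> + 1)"
    and "\<And>x p k. k \<in> int_points \<Longrightarrow> f (hmul (2 *\<^sub>R k) x) p = f x p"
  defines "C \<equiv> (INF k\<in>{1::nat..}. mu \<alpha> f q (cubeQk k) / measure lebesgue (cubeQk k :: 'n heis set))"
  shows "0 \<le> C \<and>
    ((\<lambda>k::nat. mu \<alpha> f q (cubeQk k) / measure lebesgue (cubeQk k :: 'n heis set)) \<longlonglongrightarrow> C)"
proof -
  define r where "r k = mu \<alpha> f q (cubeQk k) / measure lebesgue (cubeQk k :: 'n heis set)" for k :: nat
  let ?m = "measure lebesgue :: 'n heis set \<Rightarrow> real"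
  let ?E = "\<lambda>k F. \<integral>x. f x (q + snd (F x)) \<partial>lebesgue_on (cubeQk k)"
  have f0: "0 \<le> f x p" for x p
    using assms(5)[of p x] assms(2) by (smt (verit) mult_nonneg_nonneg powr_ge_zero)
  have mu_eq: "mu \<alpha> f q (cubeQk k) = Inf (?E k ` W0_jets \<alpha> (interior (cubeQk k)))" if "k \<ge> 1" for k
    using cubeQk_lebesgue[OF that, where 'n='n] by (intro mu_eq_Inf_W0_jets assms(1,4))
  have E0: "0 \<le> ?E k F" for k F
    by (rule integral_nonneg_AE) (simp add: f0)
  have mu0: "mu \<alpha> f q (cubeQk k) \<ge> 0" if "k \<ge> 1" for k
    unfolding mu_eq[OF that] using W0_jets_0 by (intro cInf_greatest) (use E0 in blast)+
  have r0: "r k \<ge> 0" if "k \<ge> 1" for k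
    using mu0[OF that] by (simp add: r_def)
  have C: "C = (INF k\<in>{1..}. r k)"
    by (simp add: C_def r_def)
  have "0 \<le> C"
    unfolding C by (rule cINF_greatest) (auto simp: r0)
  have bdd: "bdd_below (r ` {1..})"
    by (rule bdd_belowI[of _ 0]) (auto simp: r0)
  have lower: "C \<le> r k" if "k \<ge> 1" for k
    unfolding C using bdd that by (intro cINF_lower) auto
  have "r \<longlonglongrightarrow> C"
  proof (rule order_tendstoI)
    \<comment> \<open>The lower half is immediate, as every ratio is at least the infimum.\<close>
    fix a assume "a < C"
    then show "\<forall>\<^sub>F h in sequentially. a < r h"
      using lower by (intro eventually_sequentiallyI[of 1]) (meson less_le_trans)
  next
    fix a assume "C < a"
    then obtain k where k: "k \<ge> 1" "r k < a"
      unfolding C using bdd by (subst (asm) cINF_less_iff) auto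
    have mk: "?m (cubeQk k) > 0"
      using k(1) by (simp add: cubeQk_lebesgue(4))
    have "mu \<alpha> f q (cubeQk k) < a * ?m (cubeQk k)"
      using k(2) mk by (simp add: r_def pos_divide_less_eq)
    then have lt: "Inf (?E k ` W0_jets \<alpha> (interior (cubeQk k))) < a * ?m (cubeQk k)"
      unfolding mu_eq[OF k(1)] .
    \<comment> \<open>The zero jet, that is, the competitor \<open>lin_fun q\<close>, makes the set
      of energies nonempty, as needed to extract a near-optimal \<open>F\<close> from the strict
      inequality.\<close>
    have "?E k ` W0_jets \<alpha> (interior (cubeQk k)) \<noteq> {}"
      unfolding image_is_empty using W0_jets_0 by (metis empty_iff)
    from cInf_lessD[OF this lt] have "\<exists>F\<in>W0_jets \<alpha> (interior (cubeQk k)). ?E k F < a * ?m (cubeQk k)"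
      by (simp only: bex_simps)
    then obtain F where F: "F \<in> W0_jets \<alpha> (interior (cubeQk k))" "?E k F < a * ?m (cubeQk k)"
      by (rule bexE)
    define R where "R = 2 * real k + 1 + 2 * (real k)\<^sup>2 + 2 * real CARD('n) * real k * (1 + real k)"
    define b where "b h = ?E k F / ?m (cubeQk k) +
      C2 * (norm q powr \<alpha> + 1) * (1 - (1 - R / real h) ^ (2 * CARD('n) + 1))" for h :: nat
    \<comment> \<open>Now \<open>k\<close> and \<open>F\<close> are fixed and only \<open>h\<close>
      grows: the boundary contribution vanishes, and the limit is the average energy of
      \<open>F\<close>, which is strictly below \<open>a\<close>.\<close>
    have "b \<longlonglongrightarrow> ?E k F / ?m (cubeQk k) + C2 * (norm q powr \<alpha> + 1) * (1 - (1 - 0) ^ (2 * CARD('n) + 1))"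
      unfolding b_def by (intro tendsto_intros lim_const_over_n)
    moreover have "?E k F / ?m (cubeQk k) + C2 * (norm q powr \<alpha> + 1) * (1 - (1 - 0) ^ (2 * CARD('n) + 1)) < a"
      using F(2) mk by (simp add: pos_divide_less_eq)
    ultimately have "\<forall>\<^sub>F h in sequentially. b h < a"
      by (rule order_tendstoD)
    moreover have "\<forall>\<^sub>F h in sequentially. real h \<ge> R"
      using filterlim_real_sequentially by (simp add: filterlim_at_top)
    ultimately show "\<forall>\<^sub>F h in sequentially. r h < a"
    proof eventually_elim
      case (elim h)
      have "r h \<le> b h"
        unfolding r_def b_def R_def
        by (rule mu_cubeQk_le[OF assms(1) f0 assms(6,4,3,7) k(1) _ F(1)]) (use elim(2) in \<open>simp_all add: R_def\<close>)
      with elim(1) show ?case by simp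
    qed
  qed
  with \<open>0 \<le> C\<close> show ?thesis
    unfolding r_def by blast
qed

end
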